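(* The following are equivalent over $\mathsf{ACA}_0^{\omega}$. (1) The principle $\mathsf{BOOT}$: for every $Y:(\mathbb{N}^{\mathbb{N}}\times\mathbb{N})\to\mathbb{N}$ there is $X\subset\mathbb{N}$ such that $(\forall n\in\mathbb{N})\big[n\in X\leftrightarrow(\exists f\in\mathbb{N}^{\mathbb{N}})(Y(f,n)=0)\big]$. (2) For any $X\subset\mathbb{R}$, the set $\mathrm{int}(X)$ exists. (3) For any $X\subset\mathbb{R}$, the set $\mathrm{int}(X)$ exists and has an RM-code. (4) For any $X\subset\mathbb{R}$, the set $\overline{X}$ exists. (5) For any $X\subset\mathbb{R}$, the set $\overline{X}$ exists and has an RM-code.
   Context: $\mathsf{RCA}_0^{\omega}$ is Kohlenbach's base theory of higher-order Reverse Mathematics: classical logic in the language of all finite types, primitive recursive arithmetic in all finite types (combinators, recursor for type $0$, quantifier-free induction, axiom of extensionality) plus $\mathsf{QF\text{-}AC}^{1,0}$, i.e. for quantifier-free $\varphi$: $(\forall f\in\mathbb{N}^{\mathbb{N}})(\exists n\in\mathbb{N})\varphi(f,n)\to(\exists\Phi:\mathbb{N}^{\mathbb{N}}\to\mathbb{N})(\forall f)\varphi(f,\Phi(f))$. $\mathsf{ACA}_0^{\omega}$ is $\mathsf{RCA}_0^{\omega}+(\exists^2)$, where $(\exists^2)$ is: $(\exists E:\mathbb{N}^{\mathbb{N}}\to\{0,1\})(\forall f\in\mathbb{N}^{\mathbb{N}})\big(E(f)=0\leftrightarrow(\exists n\in\mathbb{N})(f(n)=0)\big)$. Reals are fast-converging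 Cauchy sequences of rationals; functions on $\mathbb{R}$ are functionals on Baire space respecting $=_{\mathbb{R}}$. A set $A\subset\mathbb{R}$ is given by a representation function $F_A:\mathbb{R}\to\mathbb{R}^{+}\cup\{0\}$ with $x\in A\leftrightarrow F_A(x)>0$ (over $\mathsf{ACA}_0^\omega$ equivalently by a characteristic function); a set exists if such a function exists. $B(x,r)$ is the open ball. $x$ is a limit point of $E$ if $(\forall k\in\mathbb{N})(\exists y\in B(x,2^{-k}))(y\neq x\wedge y\in E)$; the closure $\overline{E}$ is $E$ together with all its limit points; $\mathrm{int}(E)=\{x\in E:(\exists N\in\mathbb{N})(B(x,2^{-N})\subset E)\}$. An RM-code of an open set $O$ is a pair of sequences of reals $(a_n)_{n\in\mathbb{N}},(b_n)_{n\in\mathbb{N}}$ with $x\in O\leftrightarrow x\in\bigcup_n(a_n,b_n)$ for all $x\in\mathbb{R}$; an RM-code of a closed set is an RM-code of its (open) complement. *)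

theory Defs
  imports Main
begin

section \<open>Finite types, terms and formulas\<close>

datatype ty = T0 | Fn ty ty  (infixr "\<leadsto>" 65)

abbreviation T1 :: ty where "T1 \<equiv> T0 \<leadsto> T0"
abbreviation T2 :: ty where "T2 \<equiv> T1 \<leadsto> T0"

text \<open>Variables carry their type, so \<open>Var n \<sigma>\<close> and \<open>Var n \<tau>\<close> are unrelated for distinct
  types. \<open>Var\<close>s are the variables bound by quantifiers; \<open>Par\<close>s are the free variables
  (eigenvariables) of derivations and are never bound. Hence instantiating a quantifier by a term
  without \<open>Var\<close>s cannot capture anything.\<close>

datatype tm =
    Var nat ty
  | Par nat ty
  | Zero
  | Succ
  | Kc ty ty         \<comment> \<open>Kohlenbach's \<open>\<Pi>\<^sub>\<rho>\<^sub>\<tau>\<close>\<close>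
  | Sc ty ty ty      \<comment> \<open>Kohlenbach's \<open>\<Sigma>\<^sub>\<delta>\<^sub>\<rho>\<^sub>\<tau>\<close>\<close>
  | Rec              \<comment> \<open>the recursor \<open>R\<^sub>0\<close> of type 0\<close>
  | App tm tm        (infixl "\<cdot>" 90)

datatype fm =
    Eq tm tm         \<comment> \<open>equality of type 0, the only primitive relation\<close>
  | Bot
  | Imp fm fm
  | All nat ty fm

text \<open>The value of \<open>tyof\<close> is meaningful for well-typed terms only.\<close>

primrec tyof :: "tm \<Rightarrow> ty" where
  "tyof (Var n \<tau>) = \<tau>"
| "tyof (Par n \<tau>) = \<tau>"
| "tyof Zero = T0"
| "tyof Succ = T1"
| "tyof (Kc \<rho> \<tau>) = \<rho> \<leadsto> \<tau> \<leadsto> \<rho>"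
| "tyof (Sc \<delta> \<rho> \<tau>) = (\<delta> \<leadsto> \<rho> \<leadsto> \<tau>) \<leadsto> (\<delta> \<leadsto> \<rho>) \<leadsto> \<delta> \<leadsto> \<tau>"
| "tyof Rec = T0 \<leadsto> T0 \<leadsto> (T0 \<leadsto> T0 \<leadsto> T0) \<leadsto> T0"
| "tyof (App s t) = (case tyof s of T0 \<Rightarrow> T0 | \<rho> \<leadsto> \<tau> \<Rightarrow> \<tau>)"

primrec wt :: "tm \<Rightarrow> bool" where
  "wt (Var n \<tau>) = True"
| "wt (Par n \<tau>) = True"
| "wt Zero = True"
| "wt Succ = True"
| "wt (Kc \<rho> \<tau>) = True"
| "wt (Sc \<delta> \<rho> \<tau>) = True"
| "wt Rec = True"
| "wt (App s t) = (wt s \<and> wt t \<and> tyof s = tyof t \<leadsto> tyof (App s t))"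

primrec fvt :: "tm \<Rightarrow> (nat \<times> ty) set" where
  "fvt (Var n \<tau>) = {(n, \<tau>)}"
| "fvt (Par n \<tau>) = {}"
| "fvt Zero = {}"
| "fvt Succ = {}"
| "fvt (Kc \<rho> \<tau>) = {}"
| "fvt (Sc \<delta> \<rho> \<tau>) = {}"
| "fvt Rec = {}"
| "fvt (App s t) = fvt s \<union> fvt t"

primrec parst :: "tm \<Rightarrow> (nat \<times> ty) set" where
  "parst (Var n \<tau>) = {}"
| "parst (Par n \<tau>) = {(n, \<tau>)}"
| "parst Zero = {}"
| "parst Succ = {}"
| "parst (Kc \<rho> \<tau>) = {}"
| "parst (Sc \<delta> \<rho> \<tau>) = {}"
| "parst Rec = {}"
| "parst (App s t) = parst s \<union> parst t"

primrec substt :: "tm \<Rightarrow> nat \<Rightarrow> ty \<Rightarrow> tm \<Rightarrow> tm" where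
  "substt (Var n \<tau>) x \<sigma> u = (if n = x \<and> \<tau> = \<sigma> then u else Var n \<tau>)"
| "substt (Par n \<tau>) x \<sigma> u = Par n \<tau>"
| "substt Zero x \<sigma> u = Zero"
| "substt Succ x \<sigma> u = Succ"
| "substt (Kc \<rho> \<tau>) x \<sigma> u = Kc \<rho> \<tau>"
| "substt (Sc \<delta> \<rho> \<tau>) x \<sigma> u = Sc \<delta> \<rho> \<tau>"
| "substt Rec x \<sigma> u = Rec"
| "substt (App s t) x \<sigma> u = App (substt s x \<sigma> u) (substt t x \<sigma> u)"

primrec wff :: "fm \<Rightarrow> bool" where
  "wff (Eq s t) = (wt s \<and> wt t \<and> tyof s = T0 \<and> tyof t = T0)"
| "wff Bot = True"
| "wff (Imp \<phi> \<psi>) = (wff \<phi> \<and> wff \<psi>)"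
| "wff (All x \<tau> \<phi>) = wff \<phi>"

primrec fv :: "fm \<Rightarrow> (nat \<times> ty) set" where
  "fv (Eq s t) = fvt s \<union> fvt t"
| "fv Bot = {}"
| "fv (Imp \<phi> \<psi>) = fv \<phi> \<union> fv \<psi>"
| "fv (All x \<tau> \<phi>) = fv \<phi> - {(x, \<tau>)}"

primrec pars :: "fm \<Rightarrow> (nat \<times> ty) set" where
  "pars (Eq s t) = parst s \<union> parst t"
| "pars Bot = {}"
| "pars (Imp \<phi> \<psi>) = pars \<phi> \<union> pars \<psi>"
| "pars (All x \<tau> \<phi>) = pars \<phi>"

text \<open>Bound variables are not renamed; below, \<open>subst\<close> is only used with \<open>u\<close> free of
  \<open>Var\<close>s or \<open>\<phi>\<close> free of quantifiers.\<close>

primrec subst :: "fm \<Rightarrow> nat \<Rightarrow> ty \<Rightarrow> tm \<Rightarrow> fm" where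
  "subst (Eq s t) x \<sigma> u = Eq (substt s x \<sigma> u) (substt t x \<sigma> u)"
| "subst Bot x \<sigma> u = Bot"
| "subst (Imp \<phi> \<psi>) x \<sigma> u = Imp (subst \<phi> x \<sigma> u) (subst \<psi> x \<sigma> u)"
| "subst (All y \<tau> \<phi>) x \<sigma> u =
     (if y = x \<and> \<tau> = \<sigma> then All y \<tau> \<phi> else All y \<tau> (subst \<phi> x \<sigma> u))"

primrec qf :: "fm \<Rightarrow> bool" where
  "qf (Eq s t) = True"
| "qf Bot = True"
| "qf (Imp \<phi> \<psi>) = (qf \<phi> \<and> qf \<psi>)"
| "qf (All x \<tau> \<phi>) = False"

definition sentence :: "fm \<Rightarrow> bool" where
  "sentence \<phi> \<longleftrightarrow> wff \<phi> \<and> fv \<phi> = {}"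

definition Neg :: "fm \<Rightarrow> fm" where "Neg \<phi> = Imp \<phi> Bot"
definition Dis :: "fm \<Rightarrow> fm \<Rightarrow> fm" where "Dis \<phi> \<psi> = Imp (Neg \<phi>) \<psi>"
definition Con :: "fm \<Rightarrow> fm \<Rightarrow> fm" where "Con \<phi> \<psi> = Neg (Imp \<phi> (Neg \<psi>))"
definition Iff :: "fm \<Rightarrow> fm \<Rightarrow> fm" where "Iff \<phi> \<psi> = Con (Imp \<phi> \<psi>) (Imp \<psi> \<phi>)"
definition Exi :: "nat \<Rightarrow> ty \<Rightarrow> fm \<Rightarrow> fm" where "Exi x \<tau> \<phi> = Neg (All x \<tau> (Neg \<phi>))"


section \<open>Classical many-sorted natural deduction\<close>

inductive derives :: "fm set \<Rightarrow> fm \<Rightarrow> bool"  (infix "\<turnstile>" 20) where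
  Assm: "\<phi> \<in> \<Gamma> \<Longrightarrow> \<Gamma> \<turnstile> \<phi>"
| ImpI: "sentence \<phi> \<Longrightarrow> insert \<phi> \<Gamma> \<turnstile> \<psi> \<Longrightarrow> \<Gamma> \<turnstile> Imp \<phi> \<psi>"
| ImpE: "\<Gamma> \<turnstile> Imp \<phi> \<psi> \<Longrightarrow> \<Gamma> \<turnstile> \<phi> \<Longrightarrow> \<Gamma> \<turnstile> \<psi>"
| Class: "sentence \<phi> \<Longrightarrow> insert (Neg \<phi>) \<Gamma> \<turnstile> Bot \<Longrightarrow> \<Gamma> \<turnstile> \<phi>"
| AllI: "\<Gamma> \<turnstile> subst \<phi> x \<tau> (Par p \<tau>) \<Longrightarrow> (p, \<tau>) \<notin> pars \<phi> \<Longrightarrow> (\<forall>\<gamma>\<in>\<Gamma>. (p, \<tau>) \<notin> pars \<gamma>)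
    \<Longrightarrow> \<Gamma> \<turnstile> All x \<tau> \<phi>"
| AllE: "\<Gamma> \<turnstile> All x \<tau> \<phi> \<Longrightarrow> wt t \<Longrightarrow> fvt t = {} \<Longrightarrow> tyof t = \<tau> \<Longrightarrow> \<Gamma> \<turnstile> subst \<phi> x \<tau> t"


section \<open>Notation for writing formulas of the object language\<close>

text \<open>An \<open>lfm\<close> is a formula awaiting the number of variable names already in use: a quantifier
  at depth \<open>d\<close> binds the variables named \<open>d\<close>. Names are therefore distinct from those of all
  enclosing quantifiers, so the macros below can be applied to arbitrary terms in scope without
  capture. The sentence denoted by a closed \<open>lfm\<close> \<open>\<phi>\<close> is \<open>\<phi> 0\<close>.\<close>

type_synonym lfm = "nat \<Rightarrow> fm"

definition lEq :: "tm \<Rightarrow> tm \<Rightarrow> lfm"  (infix "\<^bold>=" 50) where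
  "(s \<^bold>= t) = (\<lambda>d. Eq s t)"
definition lNeg :: "lfm \<Rightarrow> lfm"  ("\<^bold>\<not> _" [40] 40) where
  "(\<^bold>\<not> \<phi>) = (\<lambda>d. Neg (\<phi> d))"
definition lCon :: "lfm \<Rightarrow> lfm \<Rightarrow> lfm"  (infixr "\<^bold>\<and>" 35) where
  "(\<phi> \<^bold>\<and> \<psi>) = (\<lambda>d. Con (\<phi> d) (\<psi> d))"
definition lDis :: "lfm \<Rightarrow> lfm \<Rightarrow> lfm"  (infixr "\<^bold>\<or>" 30) where
  "(\<phi> \<^bold>\<or> \<psi>) = (\<lambda>d. Dis (\<phi> d) (\<psi> d))"
definition lImp :: "lfm \<Rightarrow> lfm \<Rightarrow> lfm"  (infixr "\<^bold>\<longrightarrow>" 25) where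
  "(\<phi> \<^bold>\<longrightarrow> \<psi>) = (\<lambda>d. Imp (\<phi> d) (\<psi> d))"
definition lIff :: "lfm \<Rightarrow> lfm \<Rightarrow> lfm"  (infixr "\<^bold>\<longleftrightarrow>" 25) where
  "(\<phi> \<^bold>\<longleftrightarrow> \<psi>) = (\<lambda>d. Iff (\<phi> d) (\<psi> d))"
definition lAll :: "ty \<Rightarrow> (tm \<Rightarrow> lfm) \<Rightarrow> lfm" where
  "lAll \<tau> F = (\<lambda>d. All d \<tau> (F (Var d \<tau>) (Suc d)))"
definition lEx :: "ty \<Rightarrow> (tm \<Rightarrow> lfm) \<Rightarrow> lfm" where
  "lEx \<tau> F = (\<lambda>d. Exi d \<tau> (F (Var d \<tau>) (Suc d)))"

syntax
  "_lAll" :: "pttrn \<Rightarrow> ty \<Rightarrow> lfm \<Rightarrow> lfm"  ("(3\<^bold>\<forall>_:_./ _)" [0, 0, 10] 10)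
  "_lEx" :: "pttrn \<Rightarrow> ty \<Rightarrow> lfm \<Rightarrow> lfm"  ("(3\<^bold>\<exists>_:_./ _)" [0, 0, 10] 10)
translations
  "\<^bold>\<forall>x:\<tau>. \<phi>" \<rightleftharpoons> "CONST lAll \<tau> (\<lambda>x. \<phi>)"
  "\<^bold>\<exists>x:\<tau>. \<phi>" \<rightleftharpoons> "CONST lEx \<tau> (\<lambda>x. \<phi>)"

text \<open>Equality at higher types is extensional equality, by recursion on the type.\<close>

primrec eqT :: "ty \<Rightarrow> tm \<Rightarrow> tm \<Rightarrow> lfm" where
  "eqT T0 = (\<lambda>s t. s \<^bold>= t)"
| "eqT (\<rho> \<leadsto> \<tau>) = (\<lambda>s t. \<^bold>\<forall>x:\<rho>. eqT \<tau> (s \<cdot> x) (t \<cdot> x))"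


section \<open>The theories RCA and ACA in all finite types\<close>

text \<open>Universal closures, with any order and any superfluous variables.\<close>

definition closures :: "fm \<Rightarrow> fm set" where
  "closures \<phi> = {foldr (\<lambda>(x, \<tau>). All x \<tau>) xs \<phi> | xs. fv \<phi> \<subseteq> set xs}"

definition eq_axioms :: "fm set" where
  "eq_axioms =
    {(\<^bold>\<forall>x:T0. x \<^bold>= x) 0,
     (\<^bold>\<forall>x:T0. \<^bold>\<forall>y:T0. x \<^bold>= y \<^bold>\<longrightarrow> y \<^bold>= x) 0,
     (\<^bold>\<forall>x:T0. \<^bold>\<forall>y:T0. \<^bold>\<forall>z:T0. x \<^bold>= y \<^bold>\<and> y \<^bold>= z \<^bold>\<longrightarrow> x \<^bold>= z) 0}"

definition succ_axioms :: "fm set" where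
  "succ_axioms =
    {(\<^bold>\<forall>x:T0. \<^bold>\<not> (Succ \<cdot> x \<^bold>= Zero)) 0,
     (\<^bold>\<forall>x:T0. \<^bold>\<forall>y:T0. Succ \<cdot> x \<^bold>= Succ \<cdot> y \<^bold>\<longrightarrow> x \<^bold>= y) 0}"

definition comb_axioms :: "fm set" where
  "comb_axioms =
    {(\<^bold>\<forall>x:\<rho>. \<^bold>\<forall>y:\<tau>. eqT \<rho> (Kc \<rho> \<tau> \<cdot> x \<cdot> y) x) 0 | \<rho> \<tau>. True} \<union>
    {(\<^bold>\<forall>x:\<delta> \<leadsto> \<rho> \<leadsto> \<tau>. \<^bold>\<forall>y:\<delta> \<leadsto> \<rho>. \<^bold>\<forall>z:\<delta>. eqT \<tau> (Sc \<delta> \<rho> \<tau> \<cdot> x \<cdot> y \<cdot> z) (x \<cdot> z \<cdot> (y \<cdot> z))) 0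
      | \<delta> \<rho> \<tau>. True}"

definition rec_axioms :: "fm set" where
  "rec_axioms =
    {(\<^bold>\<forall>y:T0. \<^bold>\<forall>z:T0 \<leadsto> T0 \<leadsto> T0. Rec \<cdot> Zero \<cdot> y \<cdot> z \<^bold>= y) 0,
     (\<^bold>\<forall>x:T0. \<^bold>\<forall>y:T0. \<^bold>\<forall>z:T0 \<leadsto> T0 \<leadsto> T0.
        Rec \<cdot> (Succ \<cdot> x) \<cdot> y \<cdot> z \<^bold>= z \<cdot> (Rec \<cdot> x \<cdot> y \<cdot> z) \<cdot> x) 0}"

definition ext_axioms :: "fm set" where
  "ext_axioms =
    {(\<^bold>\<forall>z:\<rho> \<leadsto> \<tau>. \<^bold>\<forall>x:\<rho>. \<^bold>\<forall>y:\<rho>. eqT \<rho> x y \<^bold>\<longrightarrow> eqT \<tau> (z \<cdot> x) (z \<cdot> y)) 0 | \<rho> \<tau>. True}"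

definition qf_ia :: "nat \<Rightarrow> fm \<Rightarrow> fm" where
  "qf_ia x \<phi> =
    Imp (Con (subst \<phi> x T0 Zero) (All x T0 (Imp \<phi> (subst \<phi> x T0 (Succ \<cdot> Var x T0)))))
        (All x T0 \<phi>)"

definition qf_ac :: "nat \<Rightarrow> nat \<Rightarrow> nat \<Rightarrow> fm \<Rightarrow> fm" where
  "qf_ac f n F \<phi> =
    Imp (All f T1 (Exi n T0 \<phi>))
        (Exi F T2 (All f T1 (subst \<phi> n T0 (Var F T2 \<cdot> Var f T1))))"

text \<open>In both schemata \<open>\<phi>\<close> may contain further free variables of arbitrary type.\<close>

definition qf_ia_axioms :: "fm set" where
  "qf_ia_axioms = \<Union> {closures (qf_ia x \<phi>) | x \<phi>. qf \<phi> \<and> wff \<phi> \<and> pars \<phi> = {}}"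

definition qf_ac_axioms :: "fm set" where
  "qf_ac_axioms =
    \<Union> {closures (qf_ac f n F \<phi>) | f n F \<phi>.
        qf \<phi> \<and> wff \<phi> \<and> pars \<phi> = {} \<and> (F, T2) \<notin> fv \<phi>}"

definition RCA0w :: "fm set" where
  "RCA0w = eq_axioms \<union> succ_axioms \<union> comb_axioms \<union> rec_axioms \<union> ext_axioms
           \<union> qf_ia_axioms \<union> qf_ac_axioms"

abbreviation One :: tm where "One \<equiv> Succ \<cdot> Zero"
abbreviation Two :: tm where "Two \<equiv> Succ \<cdot> One"

definition Exists2 :: lfm where
  "Exists2 = (\<^bold>\<exists>E:T2. \<^bold>\<forall>f:T1. (E \<cdot> f \<^bold>= Zero \<^bold>\<or> E \<cdot> f \<^bold>= One) \<^bold>\<and>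
                (E \<cdot> f \<^bold>= Zero \<^bold>\<longleftrightarrow> (\<^bold>\<exists>n:T0. f \<cdot> n \<^bold>= Zero)))"

definition ACA0w :: "fm set" where
  "ACA0w = insert (Exists2 0) RCA0w"


section \<open>Closed terms for primitive recursive functions\<close>

text \<open>Bracket abstraction: \<open>lam x \<sigma> t\<close> stands for \<open>\<lambda>x\<^sup>\<sigma>. t\<close>.\<close>

fun lam :: "nat \<Rightarrow> ty \<Rightarrow> tm \<Rightarrow> tm" where
  "lam x \<sigma> (App s t) =
     (if (x, \<sigma>) \<in> fvt (App s t)
      then Sc \<sigma> (tyof t) (tyof (App s t)) \<cdot> lam x \<sigma> s \<cdot> lam x \<sigma> t
      else Kc (tyof (App s t)) \<sigma> \<cdot> App s t)"
| "lam x \<sigma> t =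
     (if t = Var x \<sigma> then Sc \<sigma> (\<sigma> \<leadsto> \<sigma>) \<sigma> \<cdot> Kc \<sigma> (\<sigma> \<leadsto> \<sigma>) \<cdot> Kc \<sigma> \<sigma>
      else Kc (tyof t) \<sigma> \<cdot> t)"

abbreviation nv :: "nat \<Rightarrow> tm" where "nv n \<equiv> Var n T0"
abbreviation lam0 :: "nat \<Rightarrow> tm \<Rightarrow> tm" where "lam0 n t \<equiv> lam n T0 t"

definition AddC :: tm where
  "AddC = lam0 0 (lam0 1 (Rec \<cdot> nv 1 \<cdot> nv 0 \<cdot> lam0 2 (lam0 3 (Succ \<cdot> nv 2))))"
definition MultC :: tm where
  "MultC = lam0 0 (lam0 1 (Rec \<cdot> nv 1 \<cdot> Zero \<cdot> lam0 2 (lam0 3 (AddC \<cdot> nv 2 \<cdot> nv 0))))"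
definition PredC :: tm where
  "PredC = lam0 0 (Rec \<cdot> nv 0 \<cdot> Zero \<cdot> lam0 1 (lam0 2 (nv 2)))"
definition MonusC :: tm where  \<comment> \<open>truncated subtraction\<close>
  "MonusC = lam0 0 (lam0 1 (Rec \<cdot> nv 1 \<cdot> nv 0 \<cdot> lam0 2 (lam0 3 (PredC \<cdot> nv 2))))"
definition Pow2C :: tm where
  "Pow2C = lam0 0 (Rec \<cdot> nv 0 \<cdot> One \<cdot> lam0 1 (lam0 2 (AddC \<cdot> nv 1 \<cdot> nv 1)))"
definition TriC :: tm where  \<comment> \<open>triangular numbers \<open>n (n + 1) / 2\<close>\<close>
  "TriC = lam0 0 (Rec \<cdot> nv 0 \<cdot> Zero \<cdot> lam0 1 (lam0 2 (AddC \<cdot> nv 1 \<cdot> (Succ \<cdot> nv 2))))"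
definition RootC :: tm where  \<comment> \<open>the largest \<open>w\<close> whose triangular number is at most \<open>n\<close>\<close>
  "RootC = lam0 0 (Rec \<cdot> nv 0 \<cdot> Zero \<cdot> lam0 1 (lam0 2
     (Rec \<cdot> (MonusC \<cdot> (TriC \<cdot> (Succ \<cdot> nv 1)) \<cdot> (Succ \<cdot> nv 2))
          \<cdot> (Succ \<cdot> nv 1) \<cdot> lam0 3 (lam0 4 (nv 1)))))"

abbreviation add :: "tm \<Rightarrow> tm \<Rightarrow> tm"  (infixl "\<oplus>" 65) where "s \<oplus> t \<equiv> AddC \<cdot> s \<cdot> t"
abbreviation mult :: "tm \<Rightarrow> tm \<Rightarrow> tm"  (infixl "\<otimes>" 70) where "s \<otimes> t \<equiv> MultC \<cdot> s \<cdot> t"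
abbreviation monus :: "tm \<Rightarrow> tm \<Rightarrow> tm"  (infixl "\<ominus>" 65) where "s \<ominus> t \<equiv> MonusC \<cdot> s \<cdot> t"

text \<open>Cantor pairing and its projections.\<close>

definition PairC :: tm where
  "PairC = lam0 0 (lam0 1 (TriC \<cdot> (nv 0 \<oplus> nv 1) \<oplus> nv 1))"
definition PsndC :: tm where
  "PsndC = lam0 0 (nv 0 \<ominus> TriC \<cdot> (RootC \<cdot> nv 0))"
definition PfstC :: tm where
  "PfstC = lam0 0 (RootC \<cdot> nv 0 \<ominus> PsndC \<cdot> nv 0)"

abbreviation pair :: "tm \<Rightarrow> tm \<Rightarrow> tm" where "pair s t \<equiv> PairC \<cdot> s \<cdot> t"
abbreviation psnd :: "tm \<Rightarrow> tm" where "psnd p \<equiv> PsndC \<cdot> p"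
abbreviation pfst :: "tm \<Rightarrow> tm" where "pfst p \<equiv> PfstC \<cdot> p"

definition leN :: "tm \<Rightarrow> tm \<Rightarrow> lfm" where "leN s t = (s \<ominus> t \<^bold>= Zero)"
definition ltN :: "tm \<Rightarrow> tm \<Rightarrow> lfm" where "ltN s t = leN (Succ \<cdot> s) t"


section \<open>Rational and real numbers\<close>

text \<open>Every number is a code of a rational: \<open>pair (pair a b) c\<close> codes \<open>(a - b) / (c + 1)\<close>.\<close>

definition rat :: "tm \<Rightarrow> tm \<Rightarrow> tm \<Rightarrow> tm" where  \<comment> \<open>\<open>(a - b) / e\<close>, for positive \<open>e\<close>\<close>
  "rat a b e = pair (pair a b) (PredC \<cdot> e)"
definition pos :: "tm \<Rightarrow> tm" where "pos q = pfst (pfst q)"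
definition neg :: "tm \<Rightarrow> tm" where "neg q = psnd (pfst q)"
definition den :: "tm \<Rightarrow> tm" where "den q = Succ \<cdot> psnd q"

definition addQ :: "tm \<Rightarrow> tm \<Rightarrow> tm" where
  "addQ p q = rat (pos p \<otimes> den q \<oplus> pos q \<otimes> den p) (neg p \<otimes> den q \<oplus> neg q \<otimes> den p) (den p \<otimes> den q)"
definition subQ :: "tm \<Rightarrow> tm \<Rightarrow> tm" where
  "subQ p q = rat (pos p \<otimes> den q \<oplus> neg q \<otimes> den p) (neg p \<otimes> den q \<oplus> pos q \<otimes> den p) (den p \<otimes> den q)"
definition absQ :: "tm \<Rightarrow> tm" where
  "absQ p = rat ((pos p \<ominus> neg p) \<oplus> (neg p \<ominus> pos p)) Zero (den p)"
definition ltQ :: "tm \<Rightarrow> tm \<Rightarrow> lfm" where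
  "ltQ p q = ltN (pos p \<otimes> den q \<oplus> neg q \<otimes> den p) (pos q \<otimes> den p \<oplus> neg p \<otimes> den q)"
definition leQ :: "tm \<Rightarrow> tm \<Rightarrow> lfm" where
  "leQ p q = leN (pos p \<otimes> den q \<oplus> neg q \<otimes> den p) (pos q \<otimes> den p \<oplus> neg p \<otimes> den q)"
definition zeroQ :: tm where "zeroQ = rat Zero Zero One"
definition pow2Q :: "tm \<Rightarrow> tm" where  \<comment> \<open>\<open>2\<^sup>-\<^sup>n\<close>\<close>
  "pow2Q n = rat One Zero (Pow2C \<cdot> n)"
definition dpow2Q :: "tm \<Rightarrow> tm" where  \<comment> \<open>\<open>2\<^sup>-\<^sup>n\<^sup>+\<^sup>1\<close>\<close>
  "dpow2Q n = rat Two Zero (Pow2C \<cdot> n)"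

text \<open>A real is a type 1 object \<open>x\<close> with \<open>\<bar>x n - x (n + i)\<bar> < 2\<^sup>-\<^sup>n\<close> for all \<open>n\<close> and \<open>i\<close>.\<close>

definition isReal :: "tm \<Rightarrow> lfm" where
  "isReal x = (\<^bold>\<forall>n:T0. \<^bold>\<forall>i:T0. ltQ (absQ (subQ (x \<cdot> n) (x \<cdot> (n \<oplus> i)))) (pow2Q n))"

definition eqR :: "tm \<Rightarrow> tm \<Rightarrow> lfm"  (infix "=\<^sub>R" 50) where
  "(x =\<^sub>R y) = (\<^bold>\<forall>n:T0. leQ (absQ (subQ (x \<cdot> n) (y \<cdot> n))) (dpow2Q n))"

definition ltR :: "tm \<Rightarrow> tm \<Rightarrow> lfm"  (infix "<\<^sub>R" 50) where
  "(x <\<^sub>R y) = (\<^bold>\<exists>n:T0. ltQ (addQ (x \<cdot> n) (dpow2Q n)) (y \<cdot> n))"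

definition realQ :: "tm \<Rightarrow> tm" where  \<comment> \<open>the constant sequence\<close>
  "realQ q = Kc T0 T0 \<cdot> q"

abbreviation zeroR :: tm where "zeroR \<equiv> realQ zeroQ"

text \<open>\<open>\<bar>x - y\<bar>\<close>; the index shift makes the result converge fast again.\<close>

definition DistC :: tm where
  "DistC = lam 0 T1 (lam 1 T1 (lam 2 T0
     (absQ (subQ (Var 0 T1 \<cdot> (Succ \<cdot> Var 2 T0)) (Var 1 T1 \<cdot> (Succ \<cdot> Var 2 T0))))))"

definition inBall :: "tm \<Rightarrow> tm \<Rightarrow> tm \<Rightarrow> lfm" where  \<comment> \<open>\<open>y \<in> B(x, 2\<^sup>-\<^sup>k)\<close>\<close>
  "inBall y x k = (DistC \<cdot> x \<cdot> y <\<^sub>R realQ (pow2Q k))"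

definition AllR :: "(tm \<Rightarrow> lfm) \<Rightarrow> lfm"  (binder "\<^bold>\<forall>\<^sub>R" 10) where
  "(\<^bold>\<forall>\<^sub>Rx. \<phi> x) = (\<^bold>\<forall>x:T1. isReal x \<^bold>\<longrightarrow> \<phi> x)"
definition ExR :: "(tm \<Rightarrow> lfm) \<Rightarrow> lfm"  (binder "\<^bold>\<exists>\<^sub>R" 10) where
  "(\<^bold>\<exists>\<^sub>Rx. \<phi> x) = (\<^bold>\<exists>x:T1. isReal x \<^bold>\<and> \<phi> x)"


section \<open>Sets of reals\<close>

text \<open>\<open>A\<close> represents a set of reals: it is a function from the reals to the non-negative reals.\<close>

definition isSet :: "tm \<Rightarrow> lfm" where
  "isSet A = ((\<^bold>\<forall>\<^sub>Rx. isReal (A \<cdot> x) \<^bold>\<and> \<^bold>\<not> (A \<cdot> x <\<^sub>R zeroR)) \<^bold>\<and>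
              (\<^bold>\<forall>\<^sub>Rx. \<^bold>\<forall>\<^sub>Ry. x =\<^sub>R y \<^bold>\<longrightarrow> A \<cdot> x =\<^sub>R A \<cdot> y))"

definition AllSet :: "(tm \<Rightarrow> lfm) \<Rightarrow> lfm"  (binder "\<^bold>\<forall>\<^sub>S" 10) where
  "(\<^bold>\<forall>\<^sub>SA. \<phi> A) = (\<^bold>\<forall>A:T1 \<leadsto> T1. isSet A \<^bold>\<longrightarrow> \<phi> A)"
definition ExSet :: "(tm \<Rightarrow> lfm) \<Rightarrow> lfm"  (binder "\<^bold>\<exists>\<^sub>S" 10) where
  "(\<^bold>\<exists>\<^sub>SA. \<phi> A) = (\<^bold>\<exists>A:T1 \<leadsto> T1. isSet A \<^bold>\<and> \<phi> A)"

definition inSet :: "tm \<Rightarrow> tm \<Rightarrow> lfm" where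
  "inSet x A = (zeroR <\<^sub>R A \<cdot> x)"

definition limitPoint :: "tm \<Rightarrow> tm \<Rightarrow> lfm" where
  "limitPoint x A = (\<^bold>\<forall>k:T0. \<^bold>\<exists>\<^sub>Ry. inBall y x k \<^bold>\<and> \<^bold>\<not> (y =\<^sub>R x) \<^bold>\<and> inSet y A)"

definition inClosure :: "tm \<Rightarrow> tm \<Rightarrow> lfm" where
  "inClosure x A = (inSet x A \<^bold>\<or> limitPoint x A)"

definition inInterior :: "tm \<Rightarrow> tm \<Rightarrow> lfm" where
  "inInterior x A = (inSet x A \<^bold>\<and> (\<^bold>\<exists>N:T0. \<^bold>\<forall>\<^sub>Ry. inBall y x N \<^bold>\<longrightarrow> inSet y A))"

definition isClosureOf :: "tm \<Rightarrow> tm \<Rightarrow> lfm" where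
  "isClosureOf C X = (\<^bold>\<forall>\<^sub>Rx. inSet x C \<^bold>\<longleftrightarrow> inClosure x X)"

definition isInteriorOf :: "tm \<Rightarrow> tm \<Rightarrow> lfm" where
  "isInteriorOf U X = (\<^bold>\<forall>\<^sub>Rx. inSet x U \<^bold>\<longleftrightarrow> inInterior x X)"

abbreviation isRealSeq :: "tm \<Rightarrow> lfm" where
  "isRealSeq a \<equiv> \<^bold>\<forall>n:T0. isReal (a \<cdot> n)"

definition inCode :: "tm \<Rightarrow> tm \<Rightarrow> tm \<Rightarrow> lfm" where
  "inCode x a b = (\<^bold>\<exists>n:T0. a \<cdot> n <\<^sub>R x \<^bold>\<and> x <\<^sub>R b \<cdot> n)"

definition hasOpenCode :: "tm \<Rightarrow> lfm" where
  "hasOpenCode U = (\<^bold>\<exists>a:T0 \<leadsto> T1. \<^bold>\<exists>b:T0 \<leadsto> T1. isRealSeq a \<^bold>\<and> isRealSeq b \<^bold>\<and>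
     (\<^bold>\<forall>\<^sub>Rx. inSet x U \<^bold>\<longleftrightarrow> inCode x a b))"

definition hasClosedCode :: "tm \<Rightarrow> lfm" where
  "hasClosedCode C = (\<^bold>\<exists>a:T0 \<leadsto> T1. \<^bold>\<exists>b:T0 \<leadsto> T1. isRealSeq a \<^bold>\<and> isRealSeq b \<^bold>\<and>
     (\<^bold>\<forall>\<^sub>Rx. \<^bold>\<not> inSet x C \<^bold>\<longleftrightarrow> inCode x a b))"


section \<open>The five principles\<close>

text \<open>Subsets of the natural numbers are given by their \<open>{0,1}\<close>-valued characteristic functions.\<close>

definition BOOT :: fm where
  "BOOT = (\<^bold>\<forall>Y:T1 \<leadsto> T0 \<leadsto> T0. \<^bold>\<exists>X:T1. (\<^bold>\<forall>n:T0. X \<cdot> n \<^bold>= Zero \<^bold>\<or> X \<cdot> n \<^bold>= One) \<^bold>\<and>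
     (\<^bold>\<forall>n:T0. X \<cdot> n \<^bold>= One \<^bold>\<longleftrightarrow> (\<^bold>\<exists>f:T1. Y \<cdot> f \<cdot> n \<^bold>= Zero))) 0"

definition INTERIOR :: fm where
  "INTERIOR = (\<^bold>\<forall>\<^sub>SX. \<^bold>\<exists>\<^sub>SU. isInteriorOf U X) 0"

definition INTERIOR_CODE :: fm where
  "INTERIOR_CODE = (\<^bold>\<forall>\<^sub>SX. \<^bold>\<exists>\<^sub>SU. isInteriorOf U X \<^bold>\<and> hasOpenCode U) 0"

definition CLOSURE :: fm where
  "CLOSURE = (\<^bold>\<forall>\<^sub>SX. \<^bold>\<exists>\<^sub>SC. isClosureOf C X) 0"

definition CLOSURE_CODE :: fm where
  "CLOSURE_CODE = (\<^bold>\<forall>\<^sub>SX. \<^bold>\<exists>\<^sub>SC. isClosureOf C X \<^bold>\<and> hasClosedCode C) 0"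

end

theory Submission
  imports Defs "HOL-Library.Countable_Set" "HOL-Computational_Algebra.Fraction_Field"
begin

text \<open>By completeness it suffices to show that the principles are equivalent in every model, more
  precisely in the term model of every maximal consistent Henkin set. There a search operator,
  obtained from \<open>(\<exists>\<^sup>2)\<close> and \<open>QF-AC\<^sup>1\<^sup>,\<^sup>0\<close>, turns arithmetical formulas into terms, which gives
  arithmetical comprehension and induction; and the (possibly nonstandard) numbers generate an
  ordered field of rationals, in which estimates for reals are ordinary linear arithmetic.

  BOOT decides which rational intervals are contained in \<open>X\<close>, and the union of these intervals is
  the interior of \<open>X\<close>. The closure is the complement of the interior of the complement. For the
  reversal, given \<open>Y\<close>, let \<open>X\<close> consist of the \<open>x\<close> with \<open>Y(d(x), n) \<noteq> 0\<close> whenever \<open>n < x < n + 1\<close>,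
  where \<open>d(x)\<close> is a function read off the tail of the base-4 expansion of \<open>x\<close>. Since only the tail
  matters, every \<open>f\<close> is \<open>d(x)\<close> for some \<open>x\<close> arbitrarily close to \<open>n + 1/2\<close>. Hence \<open>n + 1/2\<close> is in
  the interior of \<open>X\<close> iff there is no \<open>f\<close> with \<open>Y(f, n) = 0\<close>.\<close>

section \<open>Completeness\<close>

text \<open>The numbers of a model may be nonstandard, so the induction and the reals of the
  metalanguage do not apply to them: every induction is run on an arithmetical formula of the object
  language, and every estimate takes place in a field that is Archimedean only relative to the
  model. Equality of numbers is a relation, not a term, so a second use of choice is made to obtain
  a functional deciding it.

  In the reversal, f is recorded through its graph: from some place k on, the digit at the place
  coding ((i, j), l) is 1 iff f(i) = j. Repeating each fact for unboundedly many l makes the tail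
  sufficient, and starting late keeps x close to n + 1/2. Membership in X must not depend on the
  Cauchy sequence representing x. Base-4 digits restricted to 0 and 1 leave gaps between the
  possible positions of x, so a digit is read off by strict rational inequalities and no ambiguous
  expansions arise. A search operator then recovers f(i); being total, it gives d(x) a value even
  when x codes no function.\<close>

instance ty :: countable by countable_datatype
instance tm :: countable by countable_datatype
instance fm :: countable by countable_datatype

definition closed_tm :: "ty \<Rightarrow> tm set" where
  "closed_tm \<tau> = {t. wt t \<and> fvt t = {} \<and> tyof t = \<tau>}"

lemma closed_tm_Par [simp]: "Par p \<tau> \<in> closed_tm \<tau>"
  by (simp add: closed_tm_def)

lemma substt_id: "(x, \<sigma>) \<notin> fvt t \<Longrightarrow> substt t x \<sigma> u = t"
  by (induction t) auto

lemma subst_id: "(x, \<sigma>) \<notin> fv \<phi> \<Longrightarrow> subst \<phi> x \<sigma> u = \<phi>"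
  by (induction \<phi>) (auto simp: substt_id)

lemma tyof_substt: "tyof u = \<sigma> \<Longrightarrow> tyof (substt t x \<sigma> u) = tyof t"
  by (induction t) auto

lemma wt_substt: "\<lbrakk>wt u; tyof u = \<sigma>; wt t\<rbrakk> \<Longrightarrow> wt (substt t x \<sigma> u)"
  by (induction t) (auto simp: tyof_substt)

lemma fvt_substt: "fvt (substt t x \<sigma> u) \<subseteq> (fvt t - {(x, \<sigma>)}) \<union> fvt u"
  by (induction t) auto

lemma wff_subst: "\<lbrakk>wt u; tyof u = \<sigma>; wff \<phi>\<rbrakk> \<Longrightarrow> wff (subst \<phi> x \<sigma> u)"
  by (induction \<phi>) (auto simp: tyof_substt wt_substt)

lemma fv_subst: "fv (subst \<phi> x \<sigma> u) \<subseteq> (fv \<phi> - {(x, \<sigma>)}) \<union> fvt u"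
proof (induction \<phi>)
  case (Eq s t)
  then show ?case using fvt_substt[of s x \<sigma> u] fvt_substt[of t x \<sigma> u] by auto
qed auto

lemma sentence_simps [simp]:
  "sentence Bot" "sentence (Imp \<phi> \<psi>) \<longleftrightarrow> sentence \<phi> \<and> sentence \<psi>"
  "sentence (Neg \<phi>) \<longleftrightarrow> sentence \<phi>"
  by (auto simp: sentence_def Neg_def)

lemma sentence_subst:
  "sentence (All x \<tau> \<phi>) \<Longrightarrow> t \<in> closed_tm \<tau> \<Longrightarrow> sentence (subst \<phi> x \<tau> t)"
  using fv_subst[of \<phi> x \<tau> t] by (fastforce simp: sentence_def wff_subst closed_tm_def)

lemma finite_parst: "finite (parst t)"
  by (induction t) auto

lemma finite_pars: "finite (pars \<phi>)"
  by (induction \<phi>) (auto simp: finite_parst)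

section \<open>Entailment from finitely many premises over a parameter-free theory\<close>

abbreviation imps :: "fm list \<Rightarrow> fm \<Rightarrow> fm" where
  "imps xs \<phi> \<equiv> foldr Imp xs \<phi>"

lemma sentence_imps [simp]: "sentence (imps xs \<phi>) \<longleftrightarrow> (\<forall>x\<in>set xs. sentence x) \<and> sentence \<phi>"
  by (induction xs) auto

lemma wff_imps [simp]: "wff (imps xs \<phi>) \<longleftrightarrow> (\<forall>x\<in>set xs. wff x) \<and> wff \<phi>"
  by (induction xs) auto

lemma fv_imps [simp]: "fv (imps xs \<phi>) = \<Union> (fv ` set xs) \<union> fv \<phi>"
  by (induction xs) auto

lemma pars_imps [simp]: "pars (imps xs \<phi>) = \<Union> (pars ` set xs) \<union> pars \<phi>"
  by (induction xs) auto

lemma subst_imps: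
  "\<forall>\<psi>\<in>set xs. sentence \<psi> \<Longrightarrow> subst (imps xs \<phi>) x \<tau> u = imps xs (subst \<phi> x \<tau> u)"
  by (induction xs) (auto simp: subst_id sentence_def)

lemma imps_intro:
  "\<forall>y\<in>set ys. sentence y \<Longrightarrow> \<Gamma> \<union> set ys \<turnstile> \<phi> \<Longrightarrow> \<Gamma> \<turnstile> imps ys \<phi>"
proof (induction ys arbitrary: \<Gamma>)
  case (Cons y ys)
  have "insert y \<Gamma> \<turnstile> imps ys \<phi>" using Cons by simp
  then show ?case using Cons.prems(1) by (simp add: ImpI)
qed simp

lemma imps_elim: "\<Gamma> \<turnstile> imps ys \<phi> \<Longrightarrow> \<forall>y\<in>set ys. \<Gamma> \<turnstile> y \<Longrightarrow> \<Gamma> \<turnstile> \<phi>"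
  by (induction ys) (auto intro: ImpE)

text \<open>Side premises are discharged and reinstated as implications, which sidesteps
  weakening (where an eigenvariable may have to be renamed).\<close>

lemma imps_cut:
  assumes "\<forall>\<alpha>\<in>set as. (T \<turnstile> \<alpha>) \<and> sentence \<alpha>" "\<forall>y\<in>set ys. sentence y" "T \<union> set as \<union> set ys \<turnstile> \<phi>"
  shows "T \<turnstile> imps ys \<phi>"
proof -
  have "T \<turnstile> imps as (imps ys \<phi>)"
    by (intro imps_intro) (use assms in auto)
  then show ?thesis by (rule imps_elim) (use assms(1) in blast)
qed

text \<open>An axiom without parameters never blocks \<open>AllI\<close>, so the eigenvariable
  condition only concerns the finitely many premises of an entailment.\<close>

locale parameter_free =
  fixes T :: "fm set"
  assumes T_pars: "\<gamma> \<in> T \<Longrightarrow> pars \<gamma> = {}" and T_sentence: "\<gamma> \<in> T \<Longrightarrow> sentence \<gamma>"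
begin

text \<open>The finite list builds compactness into the notion: an inconsistency of the union of an
  increasing chain is already one of some stage.\<close>

definition ent :: "fm set \<Rightarrow> fm \<Rightarrow> bool"  (infix "\<tturnstile>" 20) where
  "(\<Delta> \<tturnstile> \<phi>) = (\<exists>xs. set xs \<subseteq> \<Delta> \<and> (\<forall>x\<in>set xs. sentence x) \<and> (T \<turnstile> imps xs \<phi>))"

lemma ent_mono: "\<Delta> \<tturnstile> \<phi> \<Longrightarrow> \<Delta> \<subseteq> \<Delta>' \<Longrightarrow> \<Delta>' \<tturnstile> \<phi>"
  unfolding ent_def by blast

lemma ent_thm: "T \<turnstile> \<phi> \<Longrightarrow> \<Delta> \<tturnstile> \<phi>"
  unfolding ent_def by (intro exI[of _ "[]"]) simp

lemma ent_assm: "\<phi> \<in> \<Delta> \<Longrightarrow> sentence \<phi> \<Longrightarrow> \<Delta> \<tturnstile> \<phi>"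
  unfolding ent_def by (intro exI[of _ "[\<phi>]"]) (simp add: ImpI Assm)

lemma ent_mp:
  assumes "\<Delta> \<tturnstile> Imp \<phi> \<psi>" "\<Delta> \<tturnstile> \<phi>" "sentence \<phi>" "sentence \<psi>"
  shows "\<Delta> \<tturnstile> \<psi>"
proof -
  obtain xs ys where xs: "set xs \<subseteq> \<Delta>" "\<forall>x\<in>set xs. sentence x" "T \<turnstile> imps xs (Imp \<phi> \<psi>)"
    and ys: "set ys \<subseteq> \<Delta>" "\<forall>x\<in>set ys. sentence x" "T \<turnstile> imps ys \<phi>"
    using assms(1,2) unfolding ent_def by blast
  let ?as = "[imps xs (Imp \<phi> \<psi>), imps ys \<phi>]"
  let ?G = "T \<union> set ?as \<union> set (xs @ ys)"
  have "?G \<turnstile> Imp \<phi> \<psi>" by (rule imps_elim[of _ xs]) (auto intro: Assm)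
  moreover have "?G \<turnstile> \<phi>" by (rule imps_elim[of _ ys]) (auto intro: Assm)
  ultimately have "?G \<turnstile> \<psi>" by (rule ImpE)
  then have "T \<turnstile> imps (xs @ ys) \<psi>"
    by (rule imps_cut[rotated 2]) (use xs ys assms in auto)
  then show ?thesis using xs ys unfolding ent_def by (intro exI[of _ "xs @ ys"]) auto
qed

lemma ent_impI:
  assumes "insert \<phi> \<Delta> \<tturnstile> \<psi>" "sentence \<phi>" "sentence \<psi>"
  shows "\<Delta> \<tturnstile> Imp \<phi> \<psi>"
proof -
  obtain xs where xs: "set xs \<subseteq> insert \<phi> \<Delta>" "\<forall>x\<in>set xs. sentence x" "T \<turnstile> imps xs \<psi>"
    using assms unfolding ent_def by blast
  let ?ys = "filter (\<lambda>x. x \<noteq> \<phi>) xs"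
  have "insert \<phi> (T \<union> {imps xs \<psi>} \<union> set ?ys) \<turnstile> \<psi>"
    by (rule imps_elim[of _ xs]) (auto intro: Assm)
  then have "T \<union> set [imps xs \<psi>] \<union> set ?ys \<turnstile> Imp \<phi> \<psi>" using assms by (simp add: ImpI)
  then have "T \<turnstile> imps ?ys (Imp \<phi> \<psi>)"
    by (rule imps_cut[rotated 2]) (use xs assms in auto)
  then show ?thesis using xs unfolding ent_def by (intro exI[of _ ?ys]) auto
qed

lemma ent_class:
  assumes "\<Delta> \<tturnstile> Neg (Neg \<phi>)" "sentence \<phi>" shows "\<Delta> \<tturnstile> \<phi>"
proof -
  have "insert (Neg \<phi>) (insert (Neg (Neg \<phi>)) T) \<turnstile> Bot"
    by (rule ImpE[of _ "Neg \<phi>"]) (auto intro: Assm simp: Neg_def)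
  then have "T \<turnstile> Imp (Neg (Neg \<phi>)) \<phi>" using assms by (auto intro: ImpI Class)
  then show ?thesis using assms ent_mp[OF ent_thm] by simp
qed

lemma ent_allE:
  assumes "\<Delta> \<tturnstile> All x \<tau> \<phi>" "sentence (All x \<tau> \<phi>)" "t \<in> closed_tm \<tau>"
  shows "\<Delta> \<tturnstile> subst \<phi> x \<tau> t"
proof -
  have "T \<turnstile> Imp (All x \<tau> \<phi>) (subst \<phi> x \<tau> t)"
    using assms by (intro ImpI AllE Assm) (auto simp: closed_tm_def)
  then show ?thesis using assms ent_mp[OF ent_thm] sentence_subst by blast
qed

lemma ent_allI:
  assumes "\<Delta> \<tturnstile> subst \<phi> x \<tau> (Par p \<tau>)" "(p, \<tau>) \<notin> pars \<phi>" "\<forall>\<gamma>\<in>\<Delta>. (p, \<tau>) \<notin> pars \<gamma>"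
    "sentence (All x \<tau> \<phi>)"
  shows "\<Delta> \<tturnstile> All x \<tau> \<phi>"
proof -
  obtain xs where xs: "set xs \<subseteq> \<Delta>" "\<forall>x\<in>set xs. sentence x" "T \<turnstile> imps xs (subst \<phi> x \<tau> (Par p \<tau>))"
    using assms unfolding ent_def by blast
  \<comment> \<open>The cut formula is the generalised implication. The implication at the parameter
    itself may contain \<open>p\<close>, and as a premise it would violate the eigenvariable
    condition when \<open>AllI\<close> is applied again below.\<close>
  let ?a = "All x \<tau> (imps xs \<phi>)"
  have p: "(p, \<tau>) \<notin> pars (imps xs \<phi>)" using xs assms by auto
  have 1: "T \<turnstile> ?a" by (rule AllI) (use xs p T_pars in \<open>auto simp: subst_imps\<close>)
  let ?G = "T \<union> set [?a] \<union> set xs"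
  have "?G \<turnstile> subst (imps xs \<phi>) x \<tau> (Par p \<tau>)" by (rule AllE) (auto intro: Assm)
  then have "?G \<turnstile> imps xs (subst \<phi> x \<tau> (Par p \<tau>))" using xs by (simp add: subst_imps)
  then have "?G \<turnstile> subst \<phi> x \<tau> (Par p \<tau>)" by (rule imps_elim) (auto intro: Assm)
  then have "?G \<turnstile> All x \<tau> \<phi>"
    by (rule AllI) (use assms xs p T_pars in auto)
  moreover have "sentence ?a" using xs assms by (auto simp: sentence_def)
  ultimately have "T \<turnstile> imps xs (All x \<tau> \<phi>)"
    using 1 xs by (intro imps_cut[of "[?a]"]) auto
  then show ?thesis using xs unfolding ent_def by blast
qed

section \<open>The Henkin construction\<close>

definition fresh :: "fm set \<Rightarrow> nat" where
  "fresh \<Delta> = (SOME p. \<forall>\<gamma>\<in>\<Delta>. \<forall>\<tau>. (p, \<tau>) \<notin> pars \<gamma>)"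

lemma fresh:
  assumes "finite \<Delta>" "\<gamma> \<in> \<Delta>" shows "(fresh \<Delta>, \<tau>) \<notin> pars \<gamma>"
proof -
  have "finite (fst ` (\<Union> (pars ` \<Delta>)))" using assms(1) by (simp add: finite_pars)
  then obtain p where "p \<notin> fst ` (\<Union> (pars ` \<Delta>))" using ex_new_if_finite infinite_UNIV_nat by blast
  then have "\<forall>\<gamma>\<in>\<Delta>. \<forall>\<tau>. (p, \<tau>) \<notin> pars \<gamma>" by force
  then have "\<forall>\<gamma>\<in>\<Delta>. \<forall>\<tau>. (fresh \<Delta>, \<tau>) \<notin> pars \<gamma>" unfolding fresh_def by (rule someI)
  then show ?thesis using assms(2) by blast
qed

text \<open>A set rather than a formula: only a negated universal formula calls for a
  counterexample, all others contribute nothing.\<close>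

definition wit :: "fm \<Rightarrow> fm set \<Rightarrow> fm set" where
  "wit \<phi> \<Delta> = {Neg (subst \<psi> x \<tau> (Par (fresh (insert \<phi> \<Delta>)) \<tau>)) | x \<tau> \<psi>. \<phi> = Neg (All x \<tau> \<psi>)}"

text \<open>A sentence \<phi> gets its only chance at stage \<open>to_nat \<phi>\<close>. That is
  enough, since a sentence consistent with the union is consistent with that stage. The witness
  enters together with its formula, while the stage is still finite and a fresh parameter
  exists.\<close>

primrec henkin :: "fm \<Rightarrow> nat \<Rightarrow> fm set" where
  "henkin \<alpha> 0 = {\<alpha>}"
| "henkin \<alpha> (Suc n) = (let \<phi> = from_nat n in
     if sentence \<phi> \<and> \<not> (insert \<phi> (henkin \<alpha> n) \<tturnstile> Bot)
     then insert \<phi> (henkin \<alpha> n) \<union> wit \<phi> (henkin \<alpha> n) else henkin \<alpha> n)"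

lemma wit_cases: "wit \<phi> \<Delta> = {} \<or> (\<exists>x \<tau> \<psi>. \<phi> = Neg (All x \<tau> \<psi>) \<and>
    wit \<phi> \<Delta> = {Neg (subst \<psi> x \<tau> (Par (fresh (insert \<phi> \<Delta>)) \<tau>))})"
  unfolding wit_def Neg_def by auto

text \<open>If the witness caused an inconsistency, classical logic would derive the instance at the
  new parameter. Being fresh, the parameter can be generalised, which contradicts the negated
  universal formula.\<close>

lemma wit_consistent:
  assumes "finite \<Delta>" "sentence \<phi>" "\<not> (insert \<phi> \<Delta> \<tturnstile> Bot)"
  shows "\<not> (insert \<phi> \<Delta> \<union> wit \<phi> \<Delta> \<tturnstile> Bot)"
proof
  assume *: "insert \<phi> \<Delta> \<union> wit \<phi> \<Delta> \<tturnstile> Bot"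
  with assms(3) obtain x \<tau> \<psi> where \<phi>: "\<phi> = Neg (All x \<tau> \<psi>)"
    and w: "wit \<phi> \<Delta> = {Neg (subst \<psi> x \<tau> (Par (fresh (insert \<phi> \<Delta>)) \<tau>))}"
    using wit_cases[of \<phi> \<Delta>] by auto
  let ?p = "fresh (insert \<phi> \<Delta>)"
  have s: "sentence (All x \<tau> \<psi>)" using assms \<phi> by simp
  have s': "sentence (subst \<psi> x \<tau> (Par ?p \<tau>))" using s by (rule sentence_subst) simp
  have "insert (Neg (subst \<psi> x \<tau> (Par ?p \<tau>))) (insert \<phi> \<Delta>) \<tturnstile> Bot" using * w by simp
  then have "insert \<phi> \<Delta> \<tturnstile> Neg (Neg (subst \<psi> x \<tau> (Par ?p \<tau>)))"
    using s' by (subst Neg_def) (auto intro: ent_impI)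
  then have "insert \<phi> \<Delta> \<tturnstile> subst \<psi> x \<tau> (Par ?p \<tau>)" using s' by (rule ent_class)
  moreover have fr: "\<forall>\<gamma>\<in>insert \<phi> \<Delta>. (?p, \<tau>) \<notin> pars \<gamma>"
    using fresh[of "insert \<phi> \<Delta>"] assms by auto
  ultimately have "insert \<phi> \<Delta> \<tturnstile> All x \<tau> \<psi>"
    using s by (intro ent_allI) (auto simp: \<phi> Neg_def)
  moreover have "insert \<phi> \<Delta> \<tturnstile> Imp (All x \<tau> \<psi>) Bot"
    using ent_assm[of \<phi> "insert \<phi> \<Delta>"] assms(2) by (simp add: \<phi> Neg_def)
  ultimately have "insert \<phi> \<Delta> \<tturnstile> Bot" using ent_mp s by auto
  then show False using assms(3) by simp
qed

lemma henkin_finite: "finite (henkin \<alpha> n)"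
proof (induction n)
  case (Suc n)
  have "finite (wit \<phi> \<Delta>)" for \<phi> \<Delta>
    using wit_cases[of \<phi> \<Delta>] by (elim disjE exE conjE) simp_all
  then show ?case using Suc by (simp add: Let_def)
qed simp

lemma henkin_sentence:
  "sentence \<alpha> \<Longrightarrow> \<gamma> \<in> henkin \<alpha> n \<Longrightarrow> sentence \<gamma>"
  by (induction n arbitrary: \<gamma>)
    (auto simp: Let_def wit_def intro!: sentence_subst split: if_splits)

lemma henkin_consistent: "\<not> ({\<alpha>} \<tturnstile> Bot) \<Longrightarrow> \<not> (henkin \<alpha> n \<tturnstile> Bot)"
  by (induction n) (auto simp: Let_def wit_consistent henkin_finite simp del: Un_insert_left)

lemma henkin_mono: "m \<le> n \<Longrightarrow> henkin \<alpha> m \<subseteq> henkin \<alpha> n"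
  by (rule lift_Suc_mono_le) (auto simp: Let_def)

end

text \<open>Tarski's truth conditions with closed terms as the values of quantified variables, so
  membership in \<Gamma> behaves like truth in a structure of closed terms.\<close>

locale henkin_set =
  fixes \<Gamma> :: "fm set"
  assumes G_Bot: "Bot \<notin> \<Gamma>"
    and G_Imp: "sentence \<phi> \<Longrightarrow> sentence \<psi> \<Longrightarrow> Imp \<phi> \<psi> \<in> \<Gamma> \<longleftrightarrow> (\<phi> \<in> \<Gamma> \<longrightarrow> \<psi> \<in> \<Gamma>)"
    and G_All: "sentence (All x \<tau> \<phi>) \<Longrightarrow>
      All x \<tau> \<phi> \<in> \<Gamma> \<longleftrightarrow> (\<forall>t\<in>closed_tm \<tau>. subst \<phi> x \<tau> t \<in> \<Gamma>)"

lemma (in parameter_free) henkin_set_exists: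
  assumes "sentence \<alpha>" "\<not> (T \<turnstile> \<alpha>)"
  shows "\<exists>\<Gamma>. henkin_set \<Gamma> \<and> T \<subseteq> \<Gamma> \<and> \<alpha> \<notin> \<Gamma>"
proof -
  let ?a = "Neg \<alpha>"
  define \<Gamma> where "\<Gamma> = (\<Union>n. henkin ?a n)"
  have a: "\<not> ({?a} \<tturnstile> Bot)"
  proof
    assume "{?a} \<tturnstile> Bot"
    then have "{} \<tturnstile> Neg ?a" using assms(1) ent_impI[of ?a "{}" Bot] by (simp add: Neg_def)
    then have "{} \<tturnstile> \<alpha>" using assms(1) by (rule ent_class)
    then show False using assms(2) unfolding ent_def by simp
  qed
  have sent: "sentence \<gamma>" if "\<gamma> \<in> \<Gamma>" for \<gamma>
    using that assms(1) henkin_sentence[of ?a] unfolding \<Gamma>_def by auto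
  have cons: "\<not> (\<Gamma> \<tturnstile> Bot)"
  proof
    assume "\<Gamma> \<tturnstile> Bot"
    then obtain xs where xs: "set xs \<subseteq> \<Gamma>" "\<forall>x\<in>set xs. sentence x" "T \<turnstile> imps xs Bot"
      unfolding ent_def by blast
    have "\<exists>n. set xs \<subseteq> henkin ?a n" using xs(1)
    proof (induction xs)
      case (Cons x xs)
      then obtain m n where "x \<in> henkin ?a m" "set xs \<subseteq> henkin ?a n" unfolding \<Gamma>_def by auto
      then have "set (x # xs) \<subseteq> henkin ?a (max m n)"
        using henkin_mono[of m "max m n"] henkin_mono[of n "max m n"] by fastforce
      then show ?case by blast
    qed simp
    then show False using xs henkin_consistent[OF a] unfolding ent_def by blast
  qed
  have maxi: "\<phi> \<in> \<Gamma> \<and> wit \<phi> (henkin ?a (to_nat \<phi>)) \<subseteq> \<Gamma>"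
    if "sentence \<phi>" "\<not> (insert \<phi> \<Gamma> \<tturnstile> Bot)" for \<phi>
  proof -
    have "insert \<phi> (henkin ?a (to_nat \<phi>)) \<subseteq> insert \<phi> \<Gamma>" unfolding \<Gamma>_def by blast
    then have "\<not> (insert \<phi> (henkin ?a (to_nat \<phi>)) \<tturnstile> Bot)" using that(2) ent_mono by blast
    then have "insert \<phi> (wit \<phi> (henkin ?a (to_nat \<phi>))) \<subseteq> henkin ?a (Suc (to_nat \<phi>))"
      using that by (auto simp: Let_def)
    then show ?thesis unfolding \<Gamma>_def by blast
  qed
  have ded: "\<phi> \<in> \<Gamma>" if "\<Gamma> \<tturnstile> \<phi>" "sentence \<phi>" for \<phi>
  proof (rule ccontr)
    assume "\<phi> \<notin> \<Gamma>"
    then have "insert \<phi> \<Gamma> \<tturnstile> Bot" using maxi that by blast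
    then have "\<Gamma> \<tturnstile> Imp \<phi> Bot" using that by (auto intro: ent_impI)
    then show False using ent_mp that cons by auto
  qed
  have neg: "Neg \<phi> \<in> \<Gamma>" if "\<phi> \<notin> \<Gamma>" "sentence \<phi>" for \<phi>
  proof -
    have "insert \<phi> \<Gamma> \<tturnstile> Bot" using maxi that by blast
    then show ?thesis using that ded[of "Neg \<phi>"] ent_impI[of \<phi> \<Gamma> Bot] by (simp add: Neg_def)
  qed
  have nboth: False if "\<phi> \<in> \<Gamma>" "Neg \<phi> \<in> \<Gamma>" for \<phi>
    using that sent ent_assm[of \<phi> \<Gamma>] ent_assm[of "Neg \<phi>" \<Gamma>] ent_mp[of \<Gamma> \<phi> Bot] cons
    by (simp add: Neg_def)
  have "henkin_set \<Gamma>"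
  proof
    show "Bot \<notin> \<Gamma>" using cons ent_assm by auto
    fix \<phi> \<psi> assume s: "sentence \<phi>" "sentence \<psi>"
    show "Imp \<phi> \<psi> \<in> \<Gamma> \<longleftrightarrow> (\<phi> \<in> \<Gamma> \<longrightarrow> \<psi> \<in> \<Gamma>)"
    proof
      assume "Imp \<phi> \<psi> \<in> \<Gamma>"
      then show "\<phi> \<in> \<Gamma> \<longrightarrow> \<psi> \<in> \<Gamma>"
        using s ent_assm ent_mp ded sentence_simps(2) by meson
    next
      assume *: "\<phi> \<in> \<Gamma> \<longrightarrow> \<psi> \<in> \<Gamma>"
      have "insert \<phi> \<Gamma> \<tturnstile> \<psi>"
      proof (cases "\<phi> \<in> \<Gamma>")
        case True
        then show ?thesis using * s by (auto intro: ent_assm)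
      next
        case False
        then have "insert \<phi> \<Gamma> \<tturnstile> Imp \<phi> Bot" using neg s ent_assm[of "Neg \<phi>"] by (auto simp: Neg_def)
        then have "insert \<phi> \<Gamma> \<tturnstile> Bot" using ent_mp ent_assm s by (metis insertI1 sentence_simps(1))
        then have "insert (Neg \<psi>) (insert \<phi> \<Gamma>) \<tturnstile> Bot" using ent_mono by blast
        then have "insert \<phi> \<Gamma> \<tturnstile> Neg (Neg \<psi>)" using s by (subst Neg_def) (auto intro: ent_impI)
        then show ?thesis using s by (auto intro: ent_class)
      qed
      then show "Imp \<phi> \<psi> \<in> \<Gamma>" using s by (auto intro!: ded ent_impI)
    qed
  next
    fix x \<tau> \<phi> assume s: "sentence (All x \<tau> \<phi>)"
    show "All x \<tau> \<phi> \<in> \<Gamma> \<longleftrightarrow> (\<forall>t\<in>closed_tm \<tau>. subst \<phi> x \<tau> t \<in> \<Gamma>)"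
    proof
      assume "All x \<tau> \<phi> \<in> \<Gamma>"
      then have "\<Gamma> \<tturnstile> All x \<tau> \<phi>" using s by (rule ent_assm)
      then show "\<forall>t\<in>closed_tm \<tau>. subst \<phi> x \<tau> t \<in> \<Gamma>"
        using ded[OF ent_allE[OF _ s] sentence_subst[OF s]] by blast
    next
      assume *: "\<forall>t\<in>closed_tm \<tau>. subst \<phi> x \<tau> t \<in> \<Gamma>"
      show "All x \<tau> \<phi> \<in> \<Gamma>"
      proof (rule ccontr)
        assume n: "All x \<tau> \<phi> \<notin> \<Gamma>"
        let ?N = "Neg (All x \<tau> \<phi>)"
        have "?N \<in> \<Gamma>" using neg n s by blast
        then have "wit ?N (henkin ?a (to_nat ?N)) \<subseteq> \<Gamma>"
          using maxi[of ?N] cons s by (simp add: insert_absorb)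
        then have "\<exists>p. Neg (subst \<phi> x \<tau> (Par p \<tau>)) \<in> \<Gamma>" unfolding wit_def by (auto simp: Neg_def)
        then show False using * nboth closed_tm_Par by blast
      qed
    qed
  qed
  moreover have "T \<subseteq> \<Gamma>" using T_sentence ded ent_thm Assm by blast
  moreover have "\<alpha> \<notin> \<Gamma>"
  proof -
    have "?a \<in> \<Gamma>" unfolding \<Gamma>_def using henkin.simps(1) by blast
    then show ?thesis using nboth by blast
  qed
  ultimately show ?thesis by blast
qed

section \<open>The axioms are parameter-free sentences\<close>

lemmas macro_defs = lEq_def lNeg_def lCon_def lDis_def lImp_def lIff_def lAll_def lEx_def
  Exi_def Iff_def Con_def Dis_def Neg_def

lemma subst_Iff: "subst (Iff \<phi> \<psi>) x \<sigma> u = Iff (subst \<phi> x \<sigma> u) (subst \<psi> x \<sigma> u)"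
  by (simp add: Iff_def Con_def Neg_def)

lemma wff_eqT:
  "\<lbrakk>wt s; wt t; tyof s = \<tau>; tyof t = \<tau>\<rbrakk> \<Longrightarrow> wff (eqT \<tau> s t d)"
  by (induction \<tau> arbitrary: s t d) (auto simp: macro_defs)

lemma fv_eqT: "fv (eqT \<tau> s t d) \<subseteq> fvt s \<union> fvt t"
proof (induction \<tau> arbitrary: s t d)
  case (Fn \<rho> \<tau>)
  show ?case using Fn(2)[of "s \<cdot> Var d \<rho>" "t \<cdot> Var d \<rho>" "Suc d"] by (auto simp: macro_defs)
qed (simp add: macro_defs)

lemma pars_eqT: "pars (eqT \<tau> s t d) \<subseteq> parst s \<union> parst t"
proof (induction \<tau> arbitrary: s t d)
  case (Fn \<rho> \<tau>)
  show ?case using Fn(2)[of "s \<cdot> Var d \<rho>" "t \<cdot> Var d \<rho>" "Suc d"] by (auto simp: macro_defs)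
qed (simp add: macro_defs)

lemma parst_substt: "parst (substt t x \<sigma> u) \<subseteq> parst t \<union> parst u"
  by (induction t) auto

lemma pars_subst: "pars (subst \<phi> x \<sigma> u) \<subseteq> pars \<phi> \<union> parst u"
proof (induction \<phi>)
  case (Eq s t)
  then show ?case using parst_substt[of s x \<sigma> u] parst_substt[of t x \<sigma> u] by auto
qed auto

lemma closures_good:
  assumes "\<psi> \<in> closures \<phi>" "wff \<phi>" "pars \<phi> = {}"
  shows "sentence \<psi> \<and> pars \<psi> = {}"
proof -
  obtain xs where \<psi>: "\<psi> = foldr (\<lambda>(x, \<tau>). All x \<tau>) xs \<phi>" and sub: "fv \<phi> \<subseteq> set xs"
    using assms(1) unfolding closures_def by blast
  have "wff (foldr (\<lambda>(x, \<tau>). All x \<tau>) ys \<phi>) = wff \<phi> \<and>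
    fv (foldr (\<lambda>(x, \<tau>). All x \<tau>) ys \<phi>) = fv \<phi> - set ys \<and>
    pars (foldr (\<lambda>(x, \<tau>). All x \<tau>) ys \<phi>) = pars \<phi>" for ys
    by (induction ys) auto
  then show ?thesis using assms sub \<psi> by (auto simp: sentence_def)
qed

lemma axiom_good:
  assumes "\<gamma> \<in> ACA0w" shows "sentence \<gamma> \<and> pars \<gamma> = {}"
proof -
  have ia: ?thesis if A: "\<gamma> \<in> qf_ia_axioms"
  proof -
    obtain x and \<phi> :: fm where *: "\<gamma> \<in> closures (qf_ia x \<phi>)" "wff \<phi>" "pars \<phi> = {}"
      using A unfolding qf_ia_axioms_def by blast
    have "wff (qf_ia x \<phi>)" using * by (simp add: qf_ia_def Con_def Neg_def wff_subst)
    moreover have "pars (qf_ia x \<phi>) = {}"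
      using * pars_subst[of \<phi> x T0 Zero] pars_subst[of \<phi> x T0 "Succ \<cdot> Var x T0"]
      by (auto simp: qf_ia_def Con_def Neg_def)
    ultimately show ?thesis using closures_good * by blast
  qed
  have ac: ?thesis if A: "\<gamma> \<in> qf_ac_axioms"
  proof -
    obtain f n F and \<phi> :: fm where *: "\<gamma> \<in> closures (qf_ac f n F \<phi>)" "wff \<phi>" "pars \<phi> = {}"
      using A unfolding qf_ac_axioms_def by blast
    have "wff (qf_ac f n F \<phi>)" using * by (simp add: qf_ac_def Exi_def Neg_def wff_subst)
    moreover have "pars (qf_ac f n F \<phi>) = {}"
      using * pars_subst[of \<phi> n T0 "Var F T2 \<cdot> Var f T1"] by (auto simp: qf_ac_def Exi_def Neg_def)
    ultimately show ?thesis using closures_good * by blast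
  qed
  have cb: ?thesis if "\<gamma> \<in> comb_axioms \<union> ext_axioms"
  proof -
    \<comment> \<open>\<open>eqT\<close> recurses on an arbitrary type and cannot be expanded here.
      So only the quantifier prefix of each schema is made explicit, and its kernel is controlled by
      \<open>wff_eqT\<close>, \<open>fv_eqT\<close> and \<open>pars_eqT\<close>.\<close>
    have c2: "sentence (All 0 \<rho> (All 1 \<tau> \<phi>)) \<and> pars (All 0 \<rho> (All 1 \<tau> \<phi>)) = {}"
      if "wff \<phi>" "pars \<phi> = {}" "fv \<phi> \<subseteq> {(0, \<rho>), (1, \<tau>)}" for \<rho> \<tau> \<phi>
      using that by (auto simp: sentence_def)
    have c3: "sentence (All 0 \<delta> (All 1 \<rho> (All 2 \<tau> \<phi>))) \<and> pars (All 0 \<delta> (All 1 \<rho> (All 2 \<tau> \<phi>))) = {}"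
      if "wff \<phi>" "pars \<phi> = {}" "fv \<phi> \<subseteq> {(0, \<delta>), (1, \<rho>), (2, \<tau>)}" for \<delta> \<rho> \<tau> \<phi>
      using that by (auto simp: sentence_def)
    from that consider
        (K) \<rho> \<tau> where "\<gamma> = All 0 \<rho> (All 1 \<tau> (eqT \<rho> (Kc \<rho> \<tau> \<cdot> Var 0 \<rho> \<cdot> Var 1 \<tau>) (Var 0 \<rho>) 2))"
      | (S) \<delta> \<rho> \<tau> where "\<gamma> = All 0 (\<delta> \<leadsto> \<rho> \<leadsto> \<tau>) (All 1 (\<delta> \<leadsto> \<rho>) (All 2 \<delta>
          (eqT \<tau> (Sc \<delta> \<rho> \<tau> \<cdot> Var 0 (\<delta> \<leadsto> \<rho> \<leadsto> \<tau>) \<cdot> Var 1 (\<delta> \<leadsto> \<rho>) \<cdot> Var 2 \<delta>)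
            (Var 0 (\<delta> \<leadsto> \<rho> \<leadsto> \<tau>) \<cdot> Var 2 \<delta> \<cdot> (Var 1 (\<delta> \<leadsto> \<rho>) \<cdot> Var 2 \<delta>)) 3)))"
      | (E) \<rho> \<tau> where "\<gamma> = All 0 (\<rho> \<leadsto> \<tau>) (All 1 \<rho> (All 2 \<rho> (Imp (eqT \<rho> (Var 1 \<rho>) (Var 2 \<rho>) 3)
          (eqT \<tau> (Var 0 (\<rho> \<leadsto> \<tau>) \<cdot> Var 1 \<rho>) (Var 0 (\<rho> \<leadsto> \<tau>) \<cdot> Var 2 \<rho>) 3))))"
      by (auto simp: comb_axioms_def ext_axioms_def lAll_def lImp_def numeral_2_eq_2 numeral_3_eq_3)
    then show ?thesis
    proof cases
      case K: (K \<rho> \<tau>)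
      let ?s = "Kc \<rho> \<tau> \<cdot> Var 0 \<rho> \<cdot> Var 1 \<tau>" and ?t = "Var 0 \<rho>"
      show ?thesis unfolding K
        by (rule c2) (use fv_eqT[of \<rho> ?s ?t 2] pars_eqT[of \<rho> ?s ?t 2] in \<open>auto simp: wff_eqT\<close>)
    next
      case S: (S \<delta> \<rho> \<tau>)
      let ?x = "Var 0 (\<delta> \<leadsto> \<rho> \<leadsto> \<tau>)" and ?y = "Var 1 (\<delta> \<leadsto> \<rho>)" and ?z = "Var 2 \<delta>"
      let ?s = "Sc \<delta> \<rho> \<tau> \<cdot> ?x \<cdot> ?y \<cdot> ?z" and ?t = "?x \<cdot> ?z \<cdot> (?y \<cdot> ?z)"
      show ?thesis unfolding S
        by (rule c3) (use fv_eqT[of \<tau> ?s ?t 3] pars_eqT[of \<tau> ?s ?t 3] in \<open>auto simp: wff_eqT\<close>)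
    next
      case E: (E \<rho> \<tau>)
      let ?f = "Var 0 (\<rho> \<leadsto> \<tau>) \<cdot> Var 1 \<rho>" and ?g = "Var 0 (\<rho> \<leadsto> \<tau>) \<cdot> Var 2 \<rho>"
      show ?thesis unfolding E
        by (rule c3) (use fv_eqT[of \<tau> ?f ?g 3] pars_eqT[of \<tau> ?f ?g 3]
          fv_eqT[of \<rho> "Var 1 \<rho>" "Var 2 \<rho>" 3] pars_eqT[of \<rho> "Var 1 \<rho>" "Var 2 \<rho>" 3]
          in \<open>auto simp: wff_eqT\<close>)
    qed
  qed
  have "?thesis" if "\<gamma> \<in> eq_axioms \<union> succ_axioms \<union> rec_axioms \<union> {Exists2 0}"
    using that by (auto simp: eq_axioms_def succ_axioms_def rec_axioms_def Exists2_def macro_defs sentence_def)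
  then show ?thesis using assms ia ac cb by (auto simp: ACA0w_def RCA0w_def)
qed

interpretation ACA0w: parameter_free ACA0w
  by standard (use axiom_good in auto)

section \<open>Structures for the language of finite types\<close>

text \<open>A quantifier opened at depth \<open>d\<close> or deeper cannot capture a variable of
  such a term. This is the side condition under which the macros evaluate their arguments
  unchanged.\<close>

definition below :: "nat \<Rightarrow> tm \<Rightarrow> bool" where
  "below d t = (\<forall>(n, \<sigma>) \<in> fvt t. n < d)"

lemma below_simps [simp]:
  "below d (Var n \<tau>) \<longleftrightarrow> n < d" "below d (Par n \<tau>)" "below d Zero" "below d Succ"
  "below d (Kc \<rho> \<tau>)" "below d (Sc \<delta> \<rho> \<tau>)" "below d Rec"
  "below d (s \<cdot> t) \<longleftrightarrow> below d s \<and> below d t"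
  by (auto simp: below_def)

lemma below_closed: "fvt t = {} \<Longrightarrow> below d t"
  by (simp add: below_def)

lemma below_Suc [simp]: "below d t \<Longrightarrow> below (Suc d) t"
  by (auto simp: below_def)

lemma tyof_lam [simp]: "wt t \<Longrightarrow> tyof (lam x \<sigma> t) = \<sigma> \<leadsto> tyof t"
  by (induction x \<sigma> t rule: lam.induct) auto

lemma wt_lam [simp]: "wt t \<Longrightarrow> wt (lam x \<sigma> t)"
  by (induction x \<sigma> t rule: lam.induct) auto

lemma fvt_lam [simp]: "fvt (lam x \<sigma> t) = fvt t - {(x, \<sigma>)}"
  by (induction x \<sigma> t rule: lam.induct) auto

declare lam.simps [simp del]

locale ty_structure =
  fixes dom :: "ty \<Rightarrow> 'a set" and ap :: "'a \<Rightarrow> 'a \<Rightarrow> 'a"  (infixl "$" 90)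
    and I :: "tm \<Rightarrow> 'a"  \<comment> \<open>interprets the parameters and the constants\<close>
begin

primrec ev :: "(nat \<times> ty \<Rightarrow> 'a) \<Rightarrow> tm \<Rightarrow> 'a" where
  "ev e (Var n \<tau>) = e (n, \<tau>)"
| "ev e (Par n \<tau>) = I (Par n \<tau>)"
| "ev e Zero = I Zero"
| "ev e Succ = I Succ"
| "ev e (Kc \<rho> \<tau>) = I (Kc \<rho> \<tau>)"
| "ev e (Sc \<delta> \<rho> \<tau>) = I (Sc \<delta> \<rho> \<tau>)"
| "ev e Rec = I Rec"
| "ev e (App s t) = ev e s $ ev e t"

primrec sat :: "fm \<Rightarrow> (nat \<times> ty \<Rightarrow> 'a) \<Rightarrow> bool" where
  "sat (Eq s t) e \<longleftrightarrow> ev e s = ev e t"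
| "sat Bot e = False"
| "sat (Imp \<phi> \<psi>) e = (sat \<phi> e \<longrightarrow> sat \<psi> e)"
| "sat (All x \<tau> \<phi>) e = (\<forall>a\<in>dom \<tau>. sat \<phi> (e((x, \<tau>) := a)))"

lemma sat_derived [simp]:
  "sat (Neg \<phi>) e \<longleftrightarrow> \<not> sat \<phi> e"
  "sat (Con \<phi> \<psi>) e \<longleftrightarrow> sat \<phi> e \<and> sat \<psi> e"
  "sat (Dis \<phi> \<psi>) e \<longleftrightarrow> sat \<phi> e \<or> sat \<psi> e"
  "sat (Iff \<phi> \<psi>) e \<longleftrightarrow> (sat \<phi> e \<longleftrightarrow> sat \<psi> e)"
  "sat (Exi x \<tau> \<phi>) e = (\<exists>a\<in>dom \<tau>. sat \<phi> (e((x, \<tau>) := a)))"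
  by (auto simp: Neg_def Con_def Dis_def Iff_def Exi_def)

lemma sat_macros [simp]:
  "sat ((s \<^bold>= t) d) e \<longleftrightarrow> ev e s = ev e t"
  "sat ((\<^bold>\<not> P) d) e \<longleftrightarrow> \<not> sat (P d) e"
  "sat ((P \<^bold>\<and> Q) d) e \<longleftrightarrow> sat (P d) e \<and> sat (Q d) e"
  "sat ((P \<^bold>\<or> Q) d) e \<longleftrightarrow> sat (P d) e \<or> sat (Q d) e"
  "sat ((P \<^bold>\<longrightarrow> Q) d) e = (sat (P d) e \<longrightarrow> sat (Q d) e)"
  "sat ((P \<^bold>\<longleftrightarrow> Q) d) e \<longleftrightarrow> (sat (P d) e \<longleftrightarrow> sat (Q d) e)"
  "sat (lAll \<tau> F d) e = (\<forall>a\<in>dom \<tau>. sat (F (Var d \<tau>) (Suc d)) (e((d, \<tau>) := a)))"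
  "sat (lEx \<tau> F d) e = (\<exists>a\<in>dom \<tau>. sat (F (Var d \<tau>) (Suc d)) (e((d, \<tau>) := a)))"
  by (auto simp: lEq_def lNeg_def lCon_def lDis_def lImp_def lIff_def lAll_def lEx_def)

lemma ev_below [simp]: "below d t \<Longrightarrow> ev (e((d, \<sigma>) := a)) t = ev e t"
  by (induction t) auto

lemma ev_fresh [simp]: "(x, \<sigma>) \<notin> fvt t \<Longrightarrow> ev (e((x, \<sigma>) := a)) t = ev e t"
  by (induction t) auto

lemma ev_cong: "(\<And>y. y \<in> fvt t \<Longrightarrow> e y = e' y) \<Longrightarrow> ev e t = ev e' t"
  by (induction t) auto

definition good_env :: "(nat \<times> ty \<Rightarrow> 'a) \<Rightarrow> bool" where
  "good_env e = (\<forall>n \<tau>. e (n, \<tau>) \<in> dom \<tau>)"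

lemma good_env_upd [simp]: "good_env e \<Longrightarrow> a \<in> dom \<tau> \<Longrightarrow> good_env (e((n, \<tau>) := a))"
  by (simp add: good_env_def)

lemma good_envD: "good_env e \<Longrightarrow> e (n, \<tau>) \<in> dom \<tau>"
  by (simp add: good_env_def)

end

text \<open>By \<open>dom_ext\<close> the structure is extensional, so \<open>eqT\<close> at every
  type becomes genuine equality of elements.\<close>

locale typed_structure = ty_structure dom ap I
  for dom :: "ty \<Rightarrow> 'a set" and ap :: "'a \<Rightarrow> 'a \<Rightarrow> 'a"  (infixl "$" 90) and I +
  assumes ap_dom: "f \<in> dom (\<rho> \<leadsto> \<tau>) \<Longrightarrow> x \<in> dom \<rho> \<Longrightarrow> f $ x \<in> dom \<tau>"
    and I_dom: "I (Par n \<tau>) \<in> dom (tyof (Par n \<tau>))" "I Zero \<in> dom (tyof Zero)"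
      "I Succ \<in> dom (tyof Succ)" "I (Kc \<rho> \<tau>) \<in> dom (tyof (Kc \<rho> \<tau>))"
      "I (Sc \<delta> \<rho> \<tau>) \<in> dom (tyof (Sc \<delta> \<rho> \<tau>))" "I Rec \<in> dom (tyof Rec)"
    and dom_ext: "\<lbrakk>f \<in> dom (\<rho> \<leadsto> \<tau>); g \<in> dom (\<rho> \<leadsto> \<tau>); (\<And>x. x \<in> dom \<rho> \<Longrightarrow> f $ x = g $ x)\<rbrakk> \<Longrightarrow> f = g"
begin

lemma ev_dom: "good_env e \<Longrightarrow> wt t \<Longrightarrow> ev e t \<in> dom (tyof t)"
proof (induction t)
  case (App s t)
  then have "ev e s \<in> dom (tyof t \<leadsto> tyof (s \<cdot> t))" "ev e t \<in> dom (tyof t)" by (metis wt.simps(8))+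
  then show ?case using ap_dom unfolding ev.simps by blast
qed (use I_dom in \<open>auto simp: good_env_def\<close>)

lemma ev_domI: "\<lbrakk>good_env e; wt t; tyof t = \<tau>\<rbrakk> \<Longrightarrow> ev e t \<in> dom \<tau>"
  using ev_dom by blast

lemma sat_eqT [simp]:
  "\<lbrakk>good_env e; wt s; wt t; tyof s = \<tau>; tyof t = \<tau>; below d s; below d t\<rbrakk> \<Longrightarrow>
    sat (eqT \<tau> s t d) e \<longleftrightarrow> ev e s = ev e t"
proof (induction \<tau> arbitrary: s t d e)
  case (Fn \<rho> \<tau>)
  have "sat (eqT \<tau> (s \<cdot> Var d \<rho>) (t \<cdot> Var d \<rho>) (Suc d)) (e((d, \<rho>) := a)) \<longleftrightarrow>
      ev e s $ a = ev e t $ a" if "a \<in> dom \<rho>" for a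
    using Fn.prems that Fn.IH(2)[of "e((d, \<rho>) := a)" "s \<cdot> Var d \<rho>" "t \<cdot> Var d \<rho>" "Suc d"]
    by (simp del: fun_upd_apply add: fun_upd_same)
  then have "sat (eqT (\<rho> \<leadsto> \<tau>) s t d) e = (\<forall>x\<in>dom \<rho>. ev e s $ x = ev e t $ x)"
    by simp
  also have "\<dots> \<longleftrightarrow> ev e s = ev e t"
    using dom_ext[of "ev e s" \<rho> \<tau> "ev e t"] ev_dom[of e s] ev_dom[of e t] Fn by auto
  finally show ?case .
qed simp

definition default_env :: "nat \<times> ty \<Rightarrow> 'a" where
  "default_env = (\<lambda>(n, \<tau>). I (Par n \<tau>))"

lemma good_default [simp]: "good_env default_env"
  using I_dom by (simp add: good_env_def default_env_def)

end

text \<open>The semantic content of the axioms that the rest builds on: the defining equations, two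
  instances of induction (\<open>N_cases\<close> and \<open>induction_T1\<close>), and two
  consequences of choice, namely a search operator and a decider for f(0) = f(1).\<close>

locale model = typed_structure dom ap I
  for dom :: "ty \<Rightarrow> 'a set" and ap :: "'a \<Rightarrow> 'a \<Rightarrow> 'a"  (infixl "$" 90) and I +
  assumes Succ_not_Zero: "n \<in> dom T0 \<Longrightarrow> I Succ $ n \<noteq> I Zero"
    and Succ_inj: "\<lbrakk>m \<in> dom T0; n \<in> dom T0; I Succ $ m = I Succ $ n\<rbrakk> \<Longrightarrow> m = n"
    and N_cases: "n \<in> dom T0 \<Longrightarrow> n = I Zero \<or> (\<exists>m\<in>dom T0. n = I Succ $ m)"
    and K_ap: "x \<in> dom \<rho> \<Longrightarrow> y \<in> dom \<tau> \<Longrightarrow> I (Kc \<rho> \<tau>) $ x $ y = x"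
    and S_ap: "\<lbrakk>x \<in> dom (\<delta> \<leadsto> \<rho> \<leadsto> \<tau>); y \<in> dom (\<delta> \<leadsto> \<rho>); z \<in> dom \<delta>\<rbrakk> \<Longrightarrow>
      I (Sc \<delta> \<rho> \<tau>) $ x $ y $ z = x $ z $ (y $ z)"
    and Rec_Zero: "y \<in> dom T0 \<Longrightarrow> z \<in> dom (T0 \<leadsto> T0 \<leadsto> T0) \<Longrightarrow> I Rec $ I Zero $ y $ z = y"
    and Rec_Succ: "\<lbrakk>x \<in> dom T0; y \<in> dom T0; z \<in> dom (T0 \<leadsto> T0 \<leadsto> T0)\<rbrakk> \<Longrightarrow>
      I Rec $ (I Succ $ x) $ y $ z = z $ (I Rec $ x $ y $ z) $ x"
    and induction_T1: "\<lbrakk>\<chi> \<in> dom T1; \<chi> $ I Zero = I Zero;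
      (\<And>n. n \<in> dom T0 \<Longrightarrow> \<chi> $ n = I Zero \<Longrightarrow> \<chi> $ (I Succ $ n) = I Zero); n \<in> dom T0\<rbrakk> \<Longrightarrow> \<chi> $ n = I Zero"
    and mu_exists: "\<exists>\<mu>\<in>dom T2. \<forall>f\<in>dom T1. \<forall>n\<in>dom T0. f $ n = I Zero \<longrightarrow> f $ (\<mu> $ f) = I Zero"
    and eq_decider_exists: "\<exists>D\<in>dom T2. \<forall>f\<in>dom T1.
      D $ f = I Zero \<longleftrightarrow> f $ I Zero = f $ (I Succ $ I Zero)"

section \<open>The term model\<close>

primrec instt :: "(nat \<times> ty \<Rightarrow> tm) \<Rightarrow> tm \<Rightarrow> tm" where
  "instt e (Var n \<tau>) = e (n, \<tau>)"
| "instt e (Par n \<tau>) = Par n \<tau>"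
| "instt e Zero = Zero"
| "instt e Succ = Succ"
| "instt e (Kc \<rho> \<tau>) = Kc \<rho> \<tau>"
| "instt e (Sc \<delta> \<rho> \<tau>) = Sc \<delta> \<rho> \<tau>"
| "instt e Rec = Rec"
| "instt e (App s t) = App (instt e s) (instt e t)"

primrec instf :: "fm \<Rightarrow> (nat \<times> ty \<Rightarrow> tm) \<Rightarrow> fm" where
  "instf (Eq s t) e = Eq (instt e s) (instt e t)"
| "instf Bot e = Bot"
| "instf (Imp \<phi> \<psi>) e = Imp (instf \<phi> e) (instf \<psi> e)"
| "instf (All x \<tau> \<phi>) e = All x \<tau> (instf \<phi> (e((x, \<tau>) := Var x \<tau>)))"

text \<open>A binder resets its own variable to itself, so assignments of this mixed kind arise
  below quantifiers. No value contains a foreign variable, hence nothing is captured.\<close>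

definition inst_env :: "(nat \<times> ty \<Rightarrow> tm) \<Rightarrow> bool" where
  "inst_env e = (\<forall>n \<sigma>. e (n, \<sigma>) = Var n \<sigma> \<or> e (n, \<sigma>) \<in> closed_tm \<sigma>)"

definition closed_env :: "(nat \<times> ty \<Rightarrow> tm) \<Rightarrow> bool" where
  "closed_env e = (\<forall>n \<sigma>. e (n, \<sigma>) \<in> closed_tm \<sigma>)"

lemma inst_env_upd: "inst_env e \<Longrightarrow> inst_env (e((x, \<tau>) := Var x \<tau>))"
  by (simp add: inst_env_def)

lemma closed_env_upd [simp]: "closed_env e \<Longrightarrow> u \<in> closed_tm \<tau> \<Longrightarrow> closed_env (e((x, \<tau>) := u))"
  by (simp add: closed_env_def)

lemma inst_closed_env: "closed_env e \<Longrightarrow> inst_env e"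
  by (simp add: closed_env_def inst_env_def)

lemma substt_instt:
  "inst_env e \<Longrightarrow> e (x, \<tau>) = Var x \<tau> \<Longrightarrow> substt (instt e t) x \<tau> u = instt (e((x, \<tau>) := u)) t"
proof (induction t)
  case (Var n \<sigma>)
  show ?case
  proof (cases "e (n, \<sigma>) = Var n \<sigma>")
    case False
    then have "fvt (e (n, \<sigma>)) = {}" "(n, \<sigma>) \<noteq> (x, \<tau>)"
      using Var unfolding inst_env_def closed_tm_def by auto
    then show ?thesis by (auto simp: substt_id)
  qed auto
qed auto

lemma subst_instf:
  "inst_env e \<Longrightarrow> e (x, \<tau>) = Var x \<tau> \<Longrightarrow> subst (instf \<phi> e) x \<tau> u = instf \<phi> (e((x, \<tau>) := u))"
proof (induction \<phi> arbitrary: e)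
  case (All y \<sigma> \<phi>)
  let ?e = "e((y, \<sigma>) := Var y \<sigma>)"
  show ?case
  proof (cases "y = x \<and> \<sigma> = \<tau>")
    case False
    then have "subst (instf \<phi> ?e) x \<tau> u = instf \<phi> (?e((x, \<tau>) := u))"
      using All.prems by (intro All.IH inst_env_upd) auto
    moreover have "?e((x, \<tau>) := u) = (e((x, \<tau>) := u))((y, \<sigma>) := Var y \<sigma>)"
      using False by (intro fun_upd_twist) auto
    ultimately show ?thesis using False by (simp del: fun_upd_apply)
  qed (simp del: fun_upd_apply)
qed (auto simp: substt_instt)

lemma instt_id: "(\<And>n \<sigma>. (n, \<sigma>) \<in> fvt t \<Longrightarrow> e (n, \<sigma>) = Var n \<sigma>) \<Longrightarrow> instt e t = t"
  by (induction t) auto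

lemma instf_id: "(\<And>n \<sigma>. (n, \<sigma>) \<in> fv \<phi> \<Longrightarrow> e (n, \<sigma>) = Var n \<sigma>) \<Longrightarrow> instf \<phi> e = \<phi>"
  by (induction \<phi> arbitrary: e) (auto simp: instt_id)

lemma tyof_instt: "inst_env e \<Longrightarrow> tyof (instt e t) = tyof t"
  by (induction t) (auto simp: inst_env_def closed_tm_def, metis tyof.simps(1))

lemma wt_instt: "inst_env e \<Longrightarrow> wt t \<Longrightarrow> wt (instt e t)"
  by (induction t) (auto simp: inst_env_def closed_tm_def tyof_instt, metis wt.simps(1))

lemma fvt_instt: "inst_env e \<Longrightarrow> fvt (instt e t) \<subseteq> {(n, \<sigma>). e (n, \<sigma>) = Var n \<sigma>}"
  by (induction t) (auto simp: inst_env_def closed_tm_def,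
      (metis empty_iff fvt.simps(1) prod.inject singletonD)+)

lemma wff_instf: "inst_env e \<Longrightarrow> wff \<phi> \<Longrightarrow> wff (instf \<phi> e)"
  by (induction \<phi> arbitrary: e) (auto simp: tyof_instt wt_instt inst_env_upd)

lemma fv_instf: "inst_env e \<Longrightarrow> fv (instf \<phi> e) \<subseteq> {(n, \<sigma>). e (n, \<sigma>) = Var n \<sigma>}"
proof (induction \<phi> arbitrary: e)
  case (Eq s t)
  then show ?case using fvt_instt[of e s] fvt_instt[of e t] by auto
next
  case (All x \<tau> \<phi>)
  show ?case
  proof
    fix z assume "z \<in> fv (instf (All x \<tau> \<phi>) e)"
    then have "z \<in> fv (instf \<phi> (e((x, \<tau>) := Var x \<tau>)))" "z \<noteq> (x, \<tau>)" by simp_all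
    then show "z \<in> {(n, \<sigma>). e (n, \<sigma>) = Var n \<sigma>}"
      using subsetD[OF All.IH[OF inst_env_upd[OF All.prems, of x \<tau>]]] by (fastforce split: if_splits)
  qed
qed auto

lemma closed_env_not_Var: "closed_env e \<Longrightarrow> e (n, \<sigma>) \<noteq> Var n \<sigma>"
  unfolding closed_env_def closed_tm_def
  by (metis (mono_tags, lifting) fvt.simps(1) insert_not_empty mem_Collect_eq)

lemma instt_closed: "\<lbrakk>closed_env e; wt t; tyof t = \<tau>\<rbrakk> \<Longrightarrow> instt e t \<in> closed_tm \<tau>"
  using fvt_instt[of e t] closed_env_not_Var[of e]
  by (auto simp: closed_tm_def wt_instt tyof_instt inst_closed_env)

lemma sentence_instf: "closed_env e \<Longrightarrow> wff \<phi> \<Longrightarrow> sentence (instf \<phi> e)"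
  using fv_instf[of e \<phi>] closed_env_not_Var[of e]
  by (auto simp: sentence_def wff_instf inst_closed_env)

lemma instt_below [simp]: "below d t \<Longrightarrow> instt (e((d, \<sigma>) := a)) t = instt e t"
  by (induction t) auto

lemma closed_tm_App: "f \<in> closed_tm (\<rho> \<leadsto> \<tau>) \<Longrightarrow> x \<in> closed_tm \<rho> \<Longrightarrow> f \<cdot> x \<in> closed_tm \<tau>"
  by (simp add: closed_tm_def)

section \<open>The quotient of the closed terms by extensional equality\<close>

locale aca_set = henkin_set +
  assumes ACA_subset: "ACA0w \<subseteq> \<Gamma>"
begin

definition tsat :: "fm \<Rightarrow> (nat \<times> ty \<Rightarrow> tm) \<Rightarrow> bool" where
  "tsat \<phi> e \<longleftrightarrow> instf \<phi> e \<in> \<Gamma>"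

lemma tsat_simps [simp]:
  "tsat (Eq s t) e \<longleftrightarrow> Eq (instt e s) (instt e t) \<in> \<Gamma>"
  "\<not> tsat Bot e"
  "\<lbrakk>closed_env e; wff \<phi>; wff \<psi>\<rbrakk> \<Longrightarrow> tsat (Imp \<phi> \<psi>) e = (tsat \<phi> e \<longrightarrow> tsat \<psi> e)"
  using G_Bot G_Imp by (auto simp: tsat_def sentence_instf)

lemma tsat_All [simp]:
  assumes "closed_env e" "wff \<phi>"
  shows "tsat (All x \<tau> \<phi>) e = (\<forall>u\<in>closed_tm \<tau>. tsat \<phi> (e((x, \<tau>) := u)))"
proof -
  have "sentence (instf (All x \<tau> \<phi>) e)" using assms by (intro sentence_instf) auto
  then show ?thesis
    by (simp add: tsat_def G_All subst_instf inst_env_upd inst_closed_env[OF assms(1)])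
qed

primrec eqv :: "ty \<Rightarrow> tm \<Rightarrow> tm \<Rightarrow> bool" where
  "eqv T0 s t \<longleftrightarrow> Eq s t \<in> \<Gamma>"
| "eqv (\<rho> \<leadsto> \<tau>) s t = (\<forall>u\<in>closed_tm \<rho>. eqv \<tau> (s \<cdot> u) (t \<cdot> u))"

lemma tsat_eqT [simp]:
  "\<lbrakk>closed_env e; wt s; wt t; tyof s = \<tau>; tyof t = \<tau>; below d s; below d t\<rbrakk> \<Longrightarrow>
    tsat (eqT \<tau> s t d) e \<longleftrightarrow> eqv \<tau> (instt e s) (instt e t)"
proof (induction \<tau> arbitrary: s t d e)
  case (Fn \<rho> \<tau>)
  have "tsat (eqT \<tau> (s \<cdot> Var d \<rho>) (t \<cdot> Var d \<rho>) (Suc d)) (e((d, \<rho>) := a)) \<longleftrightarrow>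
      eqv \<tau> (instt e s \<cdot> a) (instt e t \<cdot> a)" if "a \<in> closed_tm \<rho>" for a
    using Fn.prems that Fn.IH(2)[of "e((d, \<rho>) := a)" "s \<cdot> Var d \<rho>" "t \<cdot> Var d \<rho>" "Suc d"]
    by (simp del: fun_upd_apply add: fun_upd_same)
  moreover have "wff (eqT \<tau> (s \<cdot> Var d \<rho>) (t \<cdot> Var d \<rho>) (Suc d))"
    using Fn.prems by (intro wff_eqT) simp_all
  ultimately show ?case using Fn.prems(1) by (simp add: lAll_def)
qed (simp add: lEq_def)

lemma axiom_tsat: "\<gamma> \<in> ACA0w \<Longrightarrow> tsat \<gamma> e"
  using ACA_subset axiom_good[of \<gamma>] instf_id[of \<gamma> e] by (auto simp: tsat_def sentence_def)

definition par_env :: "nat \<times> ty \<Rightarrow> tm" where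
  "par_env = (\<lambda>(n, \<tau>). Par n \<tau>)"

lemma closed_par_env [simp]: "closed_env par_env"
  by (simp add: closed_env_def par_env_def)

lemma Eq_refl: "s \<in> closed_tm T0 \<Longrightarrow> Eq s s \<in> \<Gamma>"
proof -
  assume s: "s \<in> closed_tm T0"
  have "(\<^bold>\<forall>x:T0. x \<^bold>= x) 0 \<in> ACA0w" by (simp add: ACA0w_def RCA0w_def eq_axioms_def)
  from axiom_tsat[OF this, of par_env] show ?thesis using s by (simp add: macro_defs)
qed

lemma Eq_sym: "\<lbrakk>s \<in> closed_tm T0; t \<in> closed_tm T0; Eq s t \<in> \<Gamma>\<rbrakk> \<Longrightarrow> Eq t s \<in> \<Gamma>"
proof -
  assume *: "s \<in> closed_tm T0" "t \<in> closed_tm T0" "Eq s t \<in> \<Gamma>"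
  have "(\<^bold>\<forall>x:T0. \<^bold>\<forall>y:T0. x \<^bold>= y \<^bold>\<longrightarrow> y \<^bold>= x) 0 \<in> ACA0w"
    by (simp add: ACA0w_def RCA0w_def eq_axioms_def)
  from axiom_tsat[OF this, of par_env]
  have "tsat (Imp (Eq (Var 0 T0) (Var 1 T0)) (Eq (Var 1 T0) (Var 0 T0)))
      (par_env((0, T0) := s, (1, T0) := t))"
    using * by (simp add: macro_defs)
  then show ?thesis using * by simp
qed

lemma Eq_trans: "\<lbrakk>s \<in> closed_tm T0; t \<in> closed_tm T0; u \<in> closed_tm T0;
    Eq s t \<in> \<Gamma>; Eq t u \<in> \<Gamma>\<rbrakk> \<Longrightarrow> Eq s u \<in> \<Gamma>"
proof -
  assume *: "s \<in> closed_tm T0" "t \<in> closed_tm T0" "u \<in> closed_tm T0" "Eq s t \<in> \<Gamma>" "Eq t u \<in> \<Gamma>"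
  have "(\<^bold>\<forall>x:T0. \<^bold>\<forall>y:T0. \<^bold>\<forall>z:T0. x \<^bold>= y \<^bold>\<and> y \<^bold>= z \<^bold>\<longrightarrow> x \<^bold>= z) 0 \<in> ACA0w"
    by (simp add: ACA0w_def RCA0w_def eq_axioms_def)
  from axiom_tsat[OF this, of par_env]
  have tr: "tsat ((\<^bold>\<forall>x:T0. \<^bold>\<forall>y:T0. \<^bold>\<forall>z:T0. x \<^bold>= y \<^bold>\<and> y \<^bold>= z \<^bold>\<longrightarrow> x \<^bold>= z) 0) par_env" .
  have "tsat ((\<^bold>\<forall>x:T0. \<^bold>\<forall>y:T0. \<^bold>\<forall>z:T0. x \<^bold>= y \<^bold>\<and> y \<^bold>= z \<^bold>\<longrightarrow> x \<^bold>= z) 0) par_env =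
      (\<forall>s\<in>closed_tm T0. \<forall>t\<in>closed_tm T0. \<forall>u\<in>closed_tm T0. Eq s t \<in> \<Gamma> \<and> Eq t u \<in> \<Gamma> \<longrightarrow> Eq s u \<in> \<Gamma>)"
    by (simp add: macro_defs del: imp_conjL cong: ball_cong)
  with tr show ?thesis using * by blast
qed

lemma eqv_refl: "s \<in> closed_tm \<tau> \<Longrightarrow> eqv \<tau> s s"
  by (induction \<tau> arbitrary: s) (auto simp: Eq_refl closed_tm_App)

lemma eqv_sym: "\<lbrakk>s \<in> closed_tm \<tau>; t \<in> closed_tm \<tau>; eqv \<tau> s t\<rbrakk> \<Longrightarrow> eqv \<tau> t s"
  by (induction \<tau> arbitrary: s t) (auto simp: Eq_sym closed_tm_App)

lemma eqv_trans: "\<lbrakk>s \<in> closed_tm \<tau>; t \<in> closed_tm \<tau>; u \<in> closed_tm \<tau>;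
    eqv \<tau> s t; eqv \<tau> t u\<rbrakk> \<Longrightarrow> eqv \<tau> s u"
proof (induction \<tau> arbitrary: s t u)
  case T0
  then show ?case using Eq_trans[of s t u] by simp
next
  case (Fn \<rho> \<tau>)
  then show ?case by (auto intro: Fn(2) closed_tm_App)
qed

lemma eqv_ext:
  assumes "f \<in> closed_tm (\<rho> \<leadsto> \<tau>)" "x \<in> closed_tm \<rho>" "y \<in> closed_tm \<rho>" "eqv \<rho> x y"
  shows "eqv \<tau> (f \<cdot> x) (f \<cdot> y)"
proof -
  let ?ax = "(\<^bold>\<forall>z:\<rho> \<leadsto> \<tau>. \<^bold>\<forall>x:\<rho>. \<^bold>\<forall>y:\<rho>. eqT \<rho> x y \<^bold>\<longrightarrow> eqT \<tau> (z \<cdot> x) (z \<cdot> y)) 0"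
  have "?ax \<in> ACA0w" unfolding ACA0w_def RCA0w_def ext_axioms_def by blast
  from axiom_tsat[OF this, of par_env]
  have "tsat (Imp (eqT \<rho> (Var 1 \<rho>) (Var 2 \<rho>) 3)
      (eqT \<tau> (Var 0 (\<rho> \<leadsto> \<tau>) \<cdot> Var 1 \<rho>) (Var 0 (\<rho> \<leadsto> \<tau>) \<cdot> Var 2 \<rho>) 3))
      (par_env((0, \<rho> \<leadsto> \<tau>) := f, (1, \<rho>) := x, (2, \<rho>) := y))"
    using assms by (simp add: lAll_def lImp_def wff_eqT numeral_2_eq_2 numeral_3_eq_3)
  then show ?thesis using assms by (simp add: wff_eqT)
qed

lemma eqv_App:
  assumes "f \<in> closed_tm (\<rho> \<leadsto> \<tau>)" "g \<in> closed_tm (\<rho> \<leadsto> \<tau>)" "x \<in> closed_tm \<rho>" "y \<in> closed_tm \<rho>"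
    "eqv (\<rho> \<leadsto> \<tau>) f g" "eqv \<rho> x y"
  shows "eqv \<tau> (f \<cdot> x) (g \<cdot> y)"
  using eqv_ext[of f \<rho> \<tau> x y] assms eqv_trans[of "f \<cdot> x" \<tau> "f \<cdot> y" "g \<cdot> y"]
  by (auto simp: closed_tm_App)

definition cl :: "tm \<Rightarrow> tm set" where
  "cl t = {s \<in> closed_tm (tyof t). eqv (tyof t) s t}"

definition cdom :: "ty \<Rightarrow> tm set set" where
  "cdom \<tau> = cl ` closed_tm \<tau>"

text \<open>The choice of representatives is harmless because application respects
  \<open>eqv\<close> in both places; in the argument place this is the extensionality axiom.\<close>

definition cap :: "tm set \<Rightarrow> tm set \<Rightarrow> tm set" where
  "cap A B = cl ((SOME a. a \<in> A) \<cdot> (SOME b. b \<in> B))"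

lemma cl_eq: "s \<in> closed_tm \<tau> \<Longrightarrow> t \<in> closed_tm \<tau> \<Longrightarrow> cl s = cl t \<longleftrightarrow> eqv \<tau> s t"
proof
  assume "s \<in> closed_tm \<tau>" "t \<in> closed_tm \<tau>" "cl s = cl t"
  then show "eqv \<tau> s t" using eqv_refl[of s \<tau>] by (auto simp: cl_def closed_tm_def)
next
  assume *: "s \<in> closed_tm \<tau>" "t \<in> closed_tm \<tau>" "eqv \<tau> s t"
  have "tyof s = \<tau>" "tyof t = \<tau>" using * by (auto simp: closed_tm_def)
  moreover have "eqv \<tau> u s \<longleftrightarrow> eqv \<tau> u t" if "u \<in> closed_tm \<tau>" for u
    using * that eqv_trans[of u \<tau> s t] eqv_trans[of u \<tau> t s] eqv_sym[of s \<tau> t] by blast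
  ultimately show "cl s = cl t" by (auto simp: cl_def)
qed

lemma cl_choice:
  assumes "t \<in> closed_tm \<tau>"
  shows "(SOME s. s \<in> cl t) \<in> closed_tm \<tau> \<and> eqv \<tau> (SOME s. s \<in> cl t) t"
proof -
  have "t \<in> cl t" using assms eqv_refl[OF assms] by (auto simp: cl_def closed_tm_def)
  then have "(SOME s. s \<in> cl t) \<in> cl t" by (rule someI)
  then show ?thesis using assms by (auto simp: cl_def closed_tm_def)
qed

lemma cap_cl:
  assumes "f \<in> closed_tm (\<rho> \<leadsto> \<tau>)" "x \<in> closed_tm \<rho>"
  shows "cap (cl f) (cl x) = cl (f \<cdot> x)"
  unfolding cap_def
  using cl_choice[OF assms(1)] cl_choice[OF assms(2)] assms
  by (subst cl_eq[of _ \<tau>]) (blast intro: closed_tm_App eqv_App)+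

sublocale ty_structure cdom cap cl .

lemma ev_cl: "closed_env e \<Longrightarrow> wt t \<Longrightarrow> ev (cl \<circ> e) t = cl (instt e t)"
proof (induction t)
  case (App s t)
  then show ?case
    using cap_cl[of "instt e s" "tyof t" "tyof (s \<cdot> t)" "instt e t"] instt_closed by simp
qed auto

text \<open>Truth lemma. The quantifier case works because every element of
  \<open>cdom \<tau>\<close> is the class of a closed term, and these are exactly the instances
  controlled by \<open>G_All\<close>.\<close>

lemma sat_cl: "closed_env e \<Longrightarrow> wff \<phi> \<Longrightarrow> sat \<phi> (cl \<circ> e) \<longleftrightarrow> tsat \<phi> e"
proof (induction \<phi> arbitrary: e)
  case (Eq s t)
  then show ?case using cl_eq[of "instt e s" T0 "instt e t"] ev_cl[of e s] ev_cl[of e t]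
    by (simp add: instt_closed del: o_apply)
next
  case (All x \<tau> \<phi>)
  have "sat \<phi> ((cl \<circ> e)((x, \<tau>) := cl u)) \<longleftrightarrow> tsat \<phi> (e((x, \<tau>) := u))" if "u \<in> closed_tm \<tau>" for u
    using All.IH[OF closed_env_upd[OF All.prems(1) that]] All.prems(2)
    by (simp flip: fun_upd_comp del: o_apply fun_upd_apply)
  moreover have "(\<forall>a\<in>cdom \<tau>. P a) = (\<forall>u\<in>closed_tm \<tau>. P (cl u))" for P
    by (simp add: cdom_def)
  ultimately show ?case using All.prems by (simp del: o_apply fun_upd_apply)
qed auto

sublocale typed_structure cdom cap cl
proof
  fix f \<rho> \<tau> x assume "f \<in> cdom (\<rho> \<leadsto> \<tau>)" "x \<in> cdom \<rho>"
  then show "cap f x \<in> cdom \<tau>" by (auto simp: cdom_def cap_cl intro: closed_tm_App)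
next
  fix f g \<rho> \<tau> assume "f \<in> cdom (\<rho> \<leadsto> \<tau>)" "g \<in> cdom (\<rho> \<leadsto> \<tau>)"
    and *: "\<And>x. x \<in> cdom \<rho> \<Longrightarrow> cap f x = cap g x"
  then obtain s t where st: "f = cl s" "g = cl t" "s \<in> closed_tm (\<rho> \<leadsto> \<tau>)" "t \<in> closed_tm (\<rho> \<leadsto> \<tau>)"
    by (auto simp: cdom_def)
  have "eqv \<tau> (s \<cdot> u) (t \<cdot> u)" if "u \<in> closed_tm \<rho>" for u
    using *[of "cl u"] st that cl_eq[of "s \<cdot> u" \<tau> "t \<cdot> u"]
    by (simp add: cdom_def cap_cl closed_tm_App)
  then show "f = g" using st cl_eq by auto
qed (auto simp: cdom_def closed_tm_def)

lemma truth: "sentence \<phi> \<Longrightarrow> sat \<phi> default_env \<longleftrightarrow> \<phi> \<in> \<Gamma>"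
proof -
  assume s: "sentence \<phi>"
  have "default_env = cl \<circ> par_env" by (auto simp: default_env_def par_env_def)
  then show ?thesis using s sat_cl[of par_env \<phi>]
      instf_id[of \<phi> par_env] by (simp add: sentence_def tsat_def)
qed

lemma axiom_sat: "\<gamma> \<in> ACA0w \<Longrightarrow> sat \<gamma> default_env"
  using truth axiom_good ACA_subset by blast

sublocale model cdom cap cl
proof
  fix n assume "n \<in> cdom T0"
  moreover have "(\<^bold>\<forall>x:T0. \<^bold>\<not> (Succ \<cdot> x \<^bold>= Zero)) 0 \<in> ACA0w"
    by (simp add: ACA0w_def RCA0w_def succ_axioms_def)
  ultimately show "cap (cl Succ) n \<noteq> cl Zero" using axiom_sat by fastforce
next
  fix m n assume *: "m \<in> cdom T0" "n \<in> cdom T0" "cap (cl Succ) m = cap (cl Succ) n"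
  have "(\<^bold>\<forall>x:T0. \<^bold>\<forall>y:T0. Succ \<cdot> x \<^bold>= Succ \<cdot> y \<^bold>\<longrightarrow> x \<^bold>= y) 0 \<in> ACA0w"
    by (simp add: ACA0w_def RCA0w_def succ_axioms_def)
  from axiom_sat[OF this] show "m = n" using * by simp
next
  fix n assume n: "n \<in> cdom T0"
  \<comment> \<open>Induction on m for the formula m \<noteq> n with n fixed: if n were neither zero
    nor a successor, the formula would be inductive, yet it fails at n itself.\<close>
  let ?\<phi> = "Neg (Eq (Var 0 T0) (Var 1 T0))"
  have "All 1 T0 (qf_ia 0 ?\<phi>) \<in> closures (qf_ia 0 ?\<phi>)"
    unfolding closures_def by (rule CollectI, rule exI[of _ "[(1, T0)]"]) (auto simp: qf_ia_def Con_def Neg_def)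
  moreover have "qf ?\<phi> \<and> wff ?\<phi> \<and> pars ?\<phi> = {}" by (simp add: Neg_def)
  ultimately have "All 1 T0 (qf_ia 0 ?\<phi>) \<in> ACA0w"
    unfolding ACA0w_def RCA0w_def qf_ia_axioms_def by blast
  from axiom_sat[OF this] have "sat (qf_ia 0 ?\<phi>) (default_env((1, T0) := n))"
    using n unfolding sat.simps by blast
  moreover have "sat (qf_ia 0 ?\<phi>) (default_env((1, T0) := n)) =
      (cl Zero \<noteq> n \<and> (\<forall>m\<in>cdom T0. m \<noteq> n \<longrightarrow> cap (cl Succ) m \<noteq> n) \<longrightarrow> (\<forall>m\<in>cdom T0. m \<noteq> n))"
    by (simp add: qf_ia_def Neg_def del: imp_conjL)
  ultimately show "n = cl Zero \<or> (\<exists>m\<in>cdom T0. n = cap (cl Succ) m)" using n by blast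
next
  fix x y \<rho> \<tau> assume *: "x \<in> cdom \<rho>" "y \<in> cdom \<tau>"
  have "(\<^bold>\<forall>x:\<rho>. \<^bold>\<forall>y:\<tau>. eqT \<rho> (Kc \<rho> \<tau> \<cdot> x \<cdot> y) x) 0 \<in> ACA0w"
    unfolding ACA0w_def RCA0w_def comb_axioms_def by blast
  from axiom_sat[OF this] show "cap (cap (cl (Kc \<rho> \<tau>)) x) y = x" using * by (simp cong: ball_cong)
next
  fix x y z \<delta> \<rho> \<tau> assume *: "x \<in> cdom (\<delta> \<leadsto> \<rho> \<leadsto> \<tau>)" "y \<in> cdom (\<delta> \<leadsto> \<rho>)" "z \<in> cdom \<delta>"
  have "(\<^bold>\<forall>x:\<delta> \<leadsto> \<rho> \<leadsto> \<tau>. \<^bold>\<forall>y:\<delta> \<leadsto> \<rho>. \<^bold>\<forall>z:\<delta>. eqT \<tau> (Sc \<delta> \<rho> \<tau> \<cdot> x \<cdot> y \<cdot> z) (x \<cdot> z \<cdot> (y \<cdot> z))) 0 \<in> ACA0w"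
    unfolding ACA0w_def RCA0w_def comb_axioms_def by blast
  from axiom_sat[OF this] show "cap (cap (cap (cl (Sc \<delta> \<rho> \<tau>)) x) y) z = cap (cap x z) (cap y z)"
    using * by (simp cong: ball_cong)
next
  fix y z assume *: "y \<in> cdom T0" "z \<in> cdom (T0 \<leadsto> T0 \<leadsto> T0)"
  have "(\<^bold>\<forall>y:T0. \<^bold>\<forall>z:T0 \<leadsto> T0 \<leadsto> T0. Rec \<cdot> Zero \<cdot> y \<cdot> z \<^bold>= y) 0 \<in> ACA0w"
    by (simp add: ACA0w_def RCA0w_def rec_axioms_def)
  from axiom_sat[OF this] show "cap (cap (cap (cl Rec) (cl Zero)) y) z = y" using * by simp
next
  fix x y z assume *: "x \<in> cdom T0" "y \<in> cdom T0" "z \<in> cdom (T0 \<leadsto> T0 \<leadsto> T0)"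
  have "(\<^bold>\<forall>x:T0. \<^bold>\<forall>y:T0. \<^bold>\<forall>z:T0 \<leadsto> T0 \<leadsto> T0.
        Rec \<cdot> (Succ \<cdot> x) \<cdot> y \<cdot> z \<^bold>= z \<cdot> (Rec \<cdot> x \<cdot> y \<cdot> z) \<cdot> x) 0 \<in> ACA0w"
    by (simp add: ACA0w_def RCA0w_def rec_axioms_def)
  from axiom_sat[OF this]
  show "cap (cap (cap (cl Rec) (cap (cl Succ) x)) y) z = cap (cap z (cap (cap (cap (cl Rec) x) y) z)) x"
    using * by simp
next
  fix \<chi> n assume *: "\<chi> \<in> cdom T1" "cap \<chi> (cl Zero) = cl Zero" "n \<in> cdom T0"
    "\<And>n. n \<in> cdom T0 \<Longrightarrow> cap \<chi> n = cl Zero \<Longrightarrow> cap \<chi> (cap (cl Succ) n) = cl Zero"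
  let ?\<phi> = "Eq (Var 0 T1 \<cdot> Var 1 T0) Zero"
  have "All 0 T1 (qf_ia 1 ?\<phi>) \<in> closures (qf_ia 1 ?\<phi>)"
    unfolding closures_def by (rule CollectI, rule exI[of _ "[(0, T1)]"]) (auto simp: qf_ia_def Con_def Neg_def)
  moreover have "qf ?\<phi> \<and> wff ?\<phi> \<and> pars ?\<phi> = {}" by simp
  ultimately have "All 0 T1 (qf_ia 1 ?\<phi>) \<in> ACA0w"
    unfolding ACA0w_def RCA0w_def qf_ia_axioms_def by blast
  from axiom_sat[OF this] have "sat (qf_ia 1 ?\<phi>) (default_env((0, T1) := \<chi>))"
    using *(1) unfolding sat.simps by blast
  moreover have "sat (qf_ia 1 ?\<phi>) (default_env((0, T1) := \<chi>)) = (cap \<chi> (cl Zero) = cl Zero \<and>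
      (\<forall>n\<in>cdom T0. cap \<chi> n = cl Zero \<longrightarrow> cap \<chi> (cap (cl Succ) n) = cl Zero) \<longrightarrow>
      (\<forall>n\<in>cdom T0. cap \<chi> n = cl Zero))"
    by (simp add: qf_ia_def del: imp_conjL ball_simps)
  ultimately show "cap \<chi> n = cl Zero" using * by blast
next
  \<comment> \<open>With the functional E of \<open>Exists2\<close> as a parameter, "if f has a zero
    then f(n) = 0" is quantifier-free, so choice turns it into a search operator.\<close>
  let ?\<phi> = "Imp (Eq (Var 0 T2 \<cdot> Var 0 T1) Zero) (Eq (Var 0 T1 \<cdot> Var 0 T0) Zero)"
  have "All 0 T2 (qf_ac 0 0 1 ?\<phi>) \<in> closures (qf_ac 0 0 1 ?\<phi>)"
    unfolding closures_def by (rule CollectI, rule exI[of _ "[(0, T2)]"]) (auto simp: qf_ac_def Exi_def Neg_def)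
  moreover have "qf ?\<phi> \<and> wff ?\<phi> \<and> pars ?\<phi> = {} \<and> (1, T2) \<notin> fv ?\<phi>" by simp
  ultimately have "All 0 T2 (qf_ac 0 0 1 ?\<phi>) \<in> ACA0w"
    unfolding ACA0w_def RCA0w_def qf_ac_axioms_def by blast
  from axiom_sat[OF this] have ac: "\<And>E. E \<in> cdom T2 \<Longrightarrow> \<forall>f\<in>cdom T1. \<exists>n\<in>cdom T0. cap E f = cl Zero \<longrightarrow> cap f n = cl Zero \<Longrightarrow>
      \<exists>\<mu>\<in>cdom T2. \<forall>f\<in>cdom T1. cap E f = cl Zero \<longrightarrow> cap f (cap \<mu> f) = cl Zero"
    unfolding qf_ac_def by simp
  have "Exists2 0 \<in> ACA0w" by (simp add: ACA0w_def)
  from axiom_sat[OF this] obtain E where E: "E \<in> cdom T2"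
    "\<forall>f\<in>cdom T1. cap E f = cl Zero \<longleftrightarrow> (\<exists>n\<in>cdom T0. cap f n = cl Zero)"
    by (auto simp: Exists2_def)
  have "cl Zero \<in> cdom T0" by (auto simp: cdom_def closed_tm_def)
  then show "\<exists>\<mu>\<in>cdom T2. \<forall>f\<in>cdom T1. \<forall>n\<in>cdom T0. cap f n = cl Zero \<longrightarrow> cap f (cap \<mu> f) = cl Zero"
    using ac[OF E(1)] E(2) by (metis (no_types, lifting))
next
  let ?e = "Eq (Var 0 T1 \<cdot> Zero) (Var 0 T1 \<cdot> One)"
  \<comment> \<open>Choice picks a number that is zero iff f(0) = f(1); for each f either 0 or 1
    will do. This internalises equality of numbers as the value of a functional.\<close>
  let ?\<phi> = "Iff (Eq (Var 0 T0) Zero) ?e"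
  have "qf_ac 0 0 0 ?\<phi> \<in> closures (qf_ac 0 0 0 ?\<phi>)"
    unfolding closures_def by (rule CollectI, rule exI[of _ "[]"]) (auto simp: qf_ac_def Exi_def Iff_def Con_def Neg_def)
  moreover have "qf ?\<phi> \<and> wff ?\<phi> \<and> pars ?\<phi> = {} \<and> (0, T2) \<notin> fv ?\<phi>" by (simp add: Iff_def Con_def Neg_def)
  ultimately have "qf_ac 0 0 0 ?\<phi> \<in> ACA0w"
    unfolding ACA0w_def RCA0w_def qf_ac_axioms_def by blast
  from axiom_sat[OF this]
  moreover have "sat (qf_ac 0 0 0 ?\<phi>) default_env \<longleftrightarrow>
    ((\<forall>f\<in>cdom T1. \<exists>n\<in>cdom T0. n = cl Zero \<longleftrightarrow> cap f (cl Zero) = cap f (cap (cl Succ) (cl Zero))) \<longrightarrow>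
     (\<exists>D\<in>cdom T2. \<forall>f\<in>cdom T1. cap D f = cl Zero \<longleftrightarrow> cap f (cl Zero) = cap f (cap (cl Succ) (cl Zero))))"
    by (simp add: qf_ac_def subst_Iff)
  ultimately have ac: "(\<forall>f\<in>cdom T1. \<exists>n\<in>cdom T0. n = cl Zero \<longleftrightarrow> cap f (cl Zero) = cap f (cap (cl Succ) (cl Zero))) \<Longrightarrow>
     \<exists>D\<in>cdom T2. \<forall>f\<in>cdom T1. cap D f = cl Zero \<longleftrightarrow> cap f (cl Zero) = cap f (cap (cl Succ) (cl Zero))"
    by blast
  have "(\<^bold>\<forall>x:T0. \<^bold>\<not> (Succ \<cdot> x \<^bold>= Zero)) 0 \<in> ACA0w"
    by (simp add: ACA0w_def RCA0w_def succ_axioms_def)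
  from axiom_sat[OF this] have S: "\<forall>n\<in>cdom T0. cap (cl Succ) n \<noteq> cl Zero" by simp
  have "cl Zero \<in> cdom T0" "cap (cl Succ) (cl Zero) \<in> cdom T0"
    using I_dom ap_dom[of "cl Succ" T0 T0] by auto
  then show "\<exists>D\<in>cdom T2. \<forall>f\<in>cdom T1. cap D f = cl Zero \<longleftrightarrow> cap f (cl Zero) = cap f (cap (cl Succ) (cl Zero))"
    using S by (intro ac) metis
qed

end

section \<open>Arithmetical comprehension and induction in a model\<close>

primrec arith :: "fm \<Rightarrow> bool" where
  "arith (Eq s t) = True"
| "arith Bot = True"
| "arith (Imp \<phi> \<psi>) = (arith \<phi> \<and> arith \<psi>)"
| "arith (All x \<tau> \<phi>) = (\<tau> = T0 \<and> arith \<phi>)"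

lemma arith_derived [simp]:
  "arith (Neg \<phi>) = arith \<phi>" "arith (Con \<phi> \<psi>) = (arith \<phi> \<and> arith \<psi>)"
  "arith (Dis \<phi> \<psi>) = (arith \<phi> \<and> arith \<psi>)" "arith (Iff \<phi> \<psi>) = (arith \<phi> \<and> arith \<psi>)"
  "arith (Exi x \<tau> \<phi>) = (\<tau> = T0 \<and> arith \<phi>)"
  by (auto simp: Neg_def Con_def Dis_def Iff_def Exi_def)

lemma wff_derived [simp]:
  "wff (Neg \<phi>) = wff \<phi>" "wff (Con \<phi> \<psi>) = (wff \<phi> \<and> wff \<psi>)"
  "wff (Dis \<phi> \<psi>) = (wff \<phi> \<and> wff \<psi>)" "wff (Iff \<phi> \<psi>) = (wff \<phi> \<and> wff \<psi>)"
  "wff (Exi x \<tau> \<phi>) = wff \<phi>"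
  by (auto simp: Neg_def Con_def Dis_def Iff_def Exi_def)

definition CaseC :: tm where  \<comment> \<open>\<open>if a = 0 then b else c\<close>\<close>
  "CaseC = lam0 0 (lam0 1 (lam0 2 (Rec \<cdot> nv 0 \<cdot> nv 1 \<cdot> lam0 3 (lam0 4 (nv 2)))))"

lemma CaseC_term [simp]: "wt CaseC" "tyof CaseC = T0 \<leadsto> T0 \<leadsto> T0 \<leadsto> T0" "fvt CaseC = {}" "below d CaseC"
  by (auto simp: CaseC_def below_def)

definition ChoiceC :: tm where  \<comment> \<open>\<open>\<lambda>b c a. if a = 0 then b else c\<close>\<close>
  "ChoiceC = lam0 0 (lam0 1 (lam0 2 (CaseC \<cdot> nv 2 \<cdot> nv 0 \<cdot> nv 1)))"

lemma ChoiceC_term [simp]: "wt ChoiceC" "tyof ChoiceC = T0 \<leadsto> T0 \<leadsto> T1" "fvt ChoiceC = {}"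
  by (auto simp: ChoiceC_def)

text \<open>A term that vanishes exactly when the arithmetical formula holds. The variables
  \<open>Var 0 T2\<close> and \<open>Var 1 T2\<close> stand for a search operator and for a decider of equality.\<close>

primrec charterm :: "fm \<Rightarrow> tm" where
  "charterm (Eq s t) = Var 1 T2 \<cdot> (ChoiceC \<cdot> s \<cdot> t)"
| "charterm Bot = One"
| "charterm (Imp \<phi> \<psi>) = CaseC \<cdot> charterm \<phi> \<cdot> charterm \<psi> \<cdot> Zero"
| "charterm (All x \<tau> \<phi>) = (let f = lam x T0 (CaseC \<cdot> charterm \<phi> \<cdot> One \<cdot> Zero) in
     CaseC \<cdot> (f \<cdot> (Var 0 T2 \<cdot> f)) \<cdot> One \<cdot> Zero)"

lemma charterm_wt [simp]: "wff \<phi> \<Longrightarrow> wt (charterm \<phi>)" "wff \<phi> \<Longrightarrow> tyof (charterm \<phi>) = T0"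
proof -
  have "wff \<phi> \<Longrightarrow> wt (charterm \<phi>) \<and> tyof (charterm \<phi>) = T0"
    by (induction \<phi>) (auto simp: Let_def)
  then show "wff \<phi> \<Longrightarrow> wt (charterm \<phi>)" "wff \<phi> \<Longrightarrow> tyof (charterm \<phi>) = T0" by auto
qed

lemma closed_arith_terms [simp]:
  "fvt AddC = {}" "fvt MultC = {}" "fvt PredC = {}" "fvt MonusC = {}" "fvt Pow2C = {}"
  "fvt TriC = {}" "fvt RootC = {}" "fvt PairC = {}" "fvt PsndC = {}" "fvt PfstC = {}"
proof -
  show *: "fvt AddC = {}" "fvt PredC = {}" by (auto simp: AddC_def PredC_def)
  show **: "fvt MultC = {}" "fvt MonusC = {}" "fvt Pow2C = {}" "fvt TriC = {}"
    by (auto simp: MultC_def MonusC_def Pow2C_def TriC_def *)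
  show "fvt RootC = {}" by (auto simp: RootC_def **)
  then show ***: "fvt PairC = {}" "fvt PsndC = {}" by (auto simp: PairC_def PsndC_def * **)
  show "fvt PfstC = {}" using \<open>fvt RootC = {}\<close> by (auto simp: PfstC_def ** ***)
qed

lemma AddC_term [simp]: "wt AddC" "tyof AddC = T0 \<leadsto> T0 \<leadsto> T0"
  by (simp_all add: AddC_def)

lemma MultC_term [simp]: "wt MultC" "tyof MultC = T0 \<leadsto> T0 \<leadsto> T0"
  by (simp_all add: MultC_def)

lemma PredC_term [simp]: "wt PredC" "tyof PredC = T1"
  by (simp_all add: PredC_def)

lemma MonusC_term [simp]: "wt MonusC" "tyof MonusC = T0 \<leadsto> T0 \<leadsto> T0"
  by (simp_all add: MonusC_def)

lemma Pow2C_term [simp]: "wt Pow2C" "tyof Pow2C = T1"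
  by (simp_all add: Pow2C_def)

lemma TriC_term [simp]: "wt TriC" "tyof TriC = T1"
  by (simp_all add: TriC_def)

lemma RootC_term [simp]: "wt RootC" "tyof RootC = T1"
  by (simp_all add: RootC_def)

lemma PairC_term [simp]: "wt PairC" "tyof PairC = T0 \<leadsto> T0 \<leadsto> T0"
  by (simp_all add: PairC_def)

lemma PsndC_term [simp]: "wt PsndC" "tyof PsndC = T1"
  by (simp_all add: PsndC_def)

lemma PfstC_term [simp]: "wt PfstC" "tyof PfstC = T1"
  by (simp_all add: PfstC_def)

lemma below_arith_terms [simp]:
  "below d AddC" "below d MultC" "below d PredC" "below d MonusC" "below d Pow2C"
  "below d TriC" "below d RootC" "below d PairC" "below d PsndC" "below d PfstC"
  by (simp_all add: below_closed)

lemma (in ty_structure) ev_closed: "fvt t = {} \<Longrightarrow> ev e t = ev e' t"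
  by (rule ev_cong) simp

context model
begin

abbreviation (input) N :: "'a set" where "N \<equiv> dom T0"
abbreviation ze :: 'a where "ze \<equiv> I Zero"
definition su :: "'a \<Rightarrow> 'a" where "su n = I Succ $ n"

lemma Succ_ap [simp]: "I Succ $ n = su n"
  by (simp add: su_def)

lemma ze_dom [simp, intro]: "ze \<in> dom T0"
  using I_dom by simp

lemma su_dom [simp, intro]: "n \<in> dom T0 \<Longrightarrow> su n \<in> dom T0"
  using I_dom(3) ap_dom unfolding su_def by (metis tyof.simps(4))

lemmas su_not_ze [simp] = Succ_not_Zero[unfolded Succ_ap]
lemmas su_not_ze' [simp] = su_not_ze[THEN not_sym]
lemmas N_casesE = N_cases[unfolded Succ_ap]

lemma su_inj [simp]: "m \<in> dom T0 \<Longrightarrow> n \<in> dom T0 \<Longrightarrow> su m = su n \<longleftrightarrow> m = n"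
  using Succ_inj unfolding su_def by blast

text \<open>The step function has the form \<open>ev e z\<close> so that its membership in the
  domain follows from the syntactic type of \<open>z\<close>, which the simplifier can
  compute.\<close>

lemma Rec_simps [simp]:
  assumes "wt z" "tyof z = T0 \<leadsto> T0 \<leadsto> T0" "good_env e" "y \<in> dom T0"
  shows "I Rec $ ze $ y $ ev e z = y"
    and "x \<in> dom T0 \<Longrightarrow> I Rec $ su x $ y $ ev e z = ev e z $ (I Rec $ x $ y $ ev e z) $ x"
    and "x \<in> dom T0 \<Longrightarrow> I Rec $ x $ y $ ev e z \<in> dom T0"
proof -
  have z: "ev e z \<in> dom (T0 \<leadsto> T0 \<leadsto> T0)" using assms by (intro ev_domI) auto
  show "I Rec $ ze $ y $ ev e z = y" using Rec_Zero[OF assms(4) z] .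
  show "x \<in> dom T0 \<Longrightarrow> I Rec $ su x $ y $ ev e z = ev e z $ (I Rec $ x $ y $ ev e z) $ x"
    using Rec_Succ[OF _ assms(4) z] by simp
  show "x \<in> dom T0 \<Longrightarrow> I Rec $ x $ y $ ev e z \<in> dom T0"
    using I_dom(6) z assms(4) ap_dom unfolding tyof.simps by blast
qed

lemma ev_lam [simp]:
  "\<lbrakk>good_env e; wt t; a \<in> dom \<sigma>\<rbrakk> \<Longrightarrow> ev e (lam x \<sigma> t) $ a = ev (e((x, \<sigma>) := a)) t"
proof (induction x \<sigma> t rule: lam.induct)
  case (1 x \<sigma> s t)
  show ?case
  proof (cases "(x, \<sigma>) \<in> fvt (s \<cdot> t)")
    case True
    have "ev e (lam x \<sigma> s) \<in> dom (\<sigma> \<leadsto> tyof t \<leadsto> tyof (s \<cdot> t))" "ev e (lam x \<sigma> t) \<in> dom (\<sigma> \<leadsto> tyof t)"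
      using 1 by (auto intro!: ev_domI)
    then show ?thesis using 1 True by (simp add: S_ap lam.simps)
  next
    case False
    then have "ev (e((x, \<sigma>) := a)) (s \<cdot> t) = ev e (s \<cdot> t)" by (intro ev_cong) auto
    moreover have "ev e (s \<cdot> t) \<in> dom (tyof (s \<cdot> t))" using 1 by (intro ev_domI) auto
    then have "I (Kc (tyof (s \<cdot> t)) \<sigma>) $ ev e (s \<cdot> t) $ a = ev e (s \<cdot> t)" using 1 by (intro K_ap)
    ultimately show ?thesis using False
      by (simp add: lam.simps del: tyof.simps fun_upd_apply)
  qed
next
  case ("2_1" x \<sigma> n \<tau>)
  have K: "I (Kc \<sigma> (\<sigma> \<leadsto> \<sigma>)) \<in> dom (\<sigma> \<leadsto> (\<sigma> \<leadsto> \<sigma>) \<leadsto> \<sigma>)" "I (Kc \<sigma> \<sigma>) \<in> dom (\<sigma> \<leadsto> \<sigma> \<leadsto> \<sigma>)" using I_dom by auto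
  then have "I (Kc \<sigma> \<sigma>) $ a \<in> dom (\<sigma> \<leadsto> \<sigma>)" using "2_1" ap_dom by blast
  then show ?case using "2_1" K by (auto simp: lam.simps S_ap K_ap good_envD)
qed (use I_dom in \<open>auto simp: lam.simps K_ap\<close>)

lemma ev_lam_dom: "\<lbrakk>good_env e; wt t; tyof t = \<tau>\<rbrakk> \<Longrightarrow> ev e (lam x \<sigma> t) \<in> dom (\<sigma> \<leadsto> \<tau>)"
  by (intro ev_domI) auto

lemma CaseC_ev [simp]:
  "\<lbrakk>a \<in> N; b \<in> N; c \<in> N\<rbrakk> \<Longrightarrow> ev e CaseC $ a $ b $ c = (if a = ze then b else c)"
  unfolding ev_closed[OF CaseC_term(3), of e default_env]
  using N_casesE[of a] by (auto simp: CaseC_def)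

definition MU :: 'a where
  "MU = (SOME \<mu>. \<mu> \<in> dom T2 \<and> (\<forall>f\<in>dom T1. \<forall>n\<in>dom T0. f $ n = I Zero \<longrightarrow> f $ (\<mu> $ f) = I Zero))"

definition EQD :: 'a where
  "EQD = (SOME D. D \<in> dom T2 \<and> (\<forall>f\<in>dom T1. D $ f = I Zero \<longleftrightarrow> f $ I Zero = f $ (I Succ $ I Zero)))"

lemma MU: "MU \<in> dom T2" "\<lbrakk>f \<in> dom T1; n \<in> dom T0; f $ n = ze\<rbrakk> \<Longrightarrow> f $ (MU $ f) = ze"
proof -
  have "\<exists>\<mu>. \<mu> \<in> dom T2 \<and> (\<forall>f\<in>dom T1. \<forall>n\<in>dom T0. f $ n = I Zero \<longrightarrow> f $ (\<mu> $ f) = I Zero)"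
    using mu_exists by blast
  from someI_ex[OF this]
  show "MU \<in> dom T2" "\<lbrakk>f \<in> dom T1; n \<in> dom T0; f $ n = ze\<rbrakk> \<Longrightarrow> f $ (MU $ f) = ze"
    unfolding MU_def by blast+
qed

lemma EQD: "EQD \<in> dom T2" "f \<in> dom T1 \<Longrightarrow> EQD $ f = ze \<longleftrightarrow> f $ ze = f $ su ze"
proof -
  have "\<exists>D. D \<in> dom T2 \<and> (\<forall>f\<in>dom T1. D $ f = I Zero \<longleftrightarrow> f $ I Zero = f $ (I Succ $ I Zero))"
    using eq_decider_exists by blast
  from someI_ex[OF this]
  show "EQD \<in> dom T2" "f \<in> dom T1 \<Longrightarrow> EQD $ f = ze \<longleftrightarrow> f $ ze = f $ su ze"
    unfolding EQD_def[symmetric] by auto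
qed

definition std_env :: "(nat \<times> ty \<Rightarrow> 'a) \<Rightarrow> bool" where
  "std_env e \<longleftrightarrow> good_env e \<and> e (0, T2) = MU \<and> e (1, T2) = EQD"

definition env0 :: "nat \<times> ty \<Rightarrow> 'a" where
  "env0 = default_env((0, T2) := MU, (1, T2) := EQD)"

lemma std_env0 [simp]: "std_env env0"
  using MU(1) EQD(1) by (simp add: std_env_def env0_def)

lemma std_good [simp]: "std_env e \<Longrightarrow> good_env e"
  by (simp add: std_env_def)

lemma std_upd [simp]: "\<lbrakk>std_env e; \<tau> \<noteq> T2; a \<in> dom \<tau>\<rbrakk> \<Longrightarrow> std_env (e((x, \<tau>) := a))"
  by (simp add: std_env_def)

lemma charterm:
  "\<lbrakk>arith \<phi>; wff \<phi>; std_env e\<rbrakk> \<Longrightarrow> ev e (charterm \<phi>) = ze \<longleftrightarrow> sat \<phi> e"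
proof (induction \<phi> arbitrary: e)
  case (Eq s t)
  let ?f = "ChoiceC \<cdot> s \<cdot> t"
  have f: "ev e ?f \<in> dom T1" using Eq by (intro ev_domI) auto
  have st: "ev e s \<in> dom T0" "ev e t \<in> dom T0" using Eq by (auto intro: ev_domI)
  have "ev e ChoiceC $ b $ c $ a = (if a = ze then b else c)" if "a \<in> N" "b \<in> N" "c \<in> N" for a b c
    unfolding ev_closed[OF ChoiceC_term(3), of e default_env] using that by (simp add: ChoiceC_def)
  then have "ev e ?f $ ze = ev e s" "ev e ?f $ su ze = ev e t"
    using st by auto
  then show ?case using EQD(2)[OF f] Eq.prems by (simp add: std_env_def)
next
  case (Imp \<phi> \<psi>)
  have "ev e (charterm \<phi>) \<in> dom T0" "ev e (charterm \<psi>) \<in> dom T0"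
    using Imp by (auto intro!: ev_domI)
  then show ?case using Imp by simp
next
  case (All x \<tau> \<phi>)
  have T0: "\<tau> = T0" using All by simp
  \<comment> \<open>\<open>?f\<close> vanishes exactly at the counterexamples to \<phi>, so its
    value at the number found by the search operator decides the universal formula.\<close>
  let ?f = "lam x T0 (CaseC \<cdot> charterm \<phi> \<cdot> One \<cdot> Zero)"
  have f: "ev e ?f \<in> dom T1" using All by (intro ev_lam_dom) auto
  have fn: "ev e ?f $ n = ze \<longleftrightarrow> \<not> sat \<phi> (e((x, T0) := n))" if "n \<in> dom T0" for n
  proof -
    have "std_env (e((x, T0) := n))" using All.prems that by simp
    moreover from this have "ev (e((x, T0) := n)) (charterm \<phi>) \<in> dom T0"
      using All.prems that by (intro ev_domI) auto
    ultimately show ?thesis using All.IH[of "e((x, T0) := n)"] All.prems that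
      by (simp del: fun_upd_apply)
  qed
  have w: "MU $ ev e ?f \<in> dom T0" using MU(1) f ap_dom by blast
  then have fw: "ev e ?f $ (MU $ ev e ?f) \<in> dom T0" using f ap_dom by blast
  have "ev e (charterm (All x \<tau> \<phi>)) = (if ev e ?f $ (MU $ ev e ?f) = ze then su ze else ze)"
    using All.prems fw by (simp add: Let_def std_env_def del: ev_lam)
  moreover have "ev e ?f $ (MU $ ev e ?f) = ze \<longleftrightarrow> (\<exists>n\<in>dom T0. ev e ?f $ n = ze)"
    using MU(2)[OF f] w by blast
  ultimately show ?case using fn by (auto simp: T0)
qed simp

text \<open>The characteristic term makes an arithmetical formula into a type 1 function, to which
  quantifier-free induction applies. The predicate \<open>P\<close> is kept apart from its formula
  so that later claims can be stated in the metalanguage, including its ordered field.\<close>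

lemma arith_induct:
  assumes "arith \<phi>" "wff \<phi>" "std_env e" "\<And>n. n \<in> N \<Longrightarrow> P n \<longleftrightarrow> sat \<phi> (e((x, T0) := n))"
    and "P ze" "\<And>n. n \<in> N \<Longrightarrow> P n \<Longrightarrow> P (su n)" "n \<in> N"
  shows "P n"
proof -
  let ?\<chi> = "ev e (lam x T0 (charterm \<phi>))"
  have \<chi>: "?\<chi> $ m = ze \<longleftrightarrow> P m" if "m \<in> N" for m
    using that assms(1-4) charterm[of \<phi> "e((x, T0) := m)"] by simp
  have "?\<chi> $ n = ze"
    by (rule induction_T1) (use assms \<chi> in \<open>auto intro!: ev_lam_dom\<close>)
  then show ?thesis using \<chi> assms by blast
qed

section \<open>Arithmetic in a model\<close>

definition pl :: "'a \<Rightarrow> 'a \<Rightarrow> 'a" where "pl a b = ev env0 AddC $ a $ b"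
definition ti :: "'a \<Rightarrow> 'a \<Rightarrow> 'a" where "ti a b = ev env0 MultC $ a $ b"
definition pd :: "'a \<Rightarrow> 'a" where "pd a = ev env0 PredC $ a"
definition mo :: "'a \<Rightarrow> 'a \<Rightarrow> 'a" where "mo a b = ev env0 MonusC $ a $ b"
definition po :: "'a \<Rightarrow> 'a" where "po a = ev env0 Pow2C $ a"
definition tri :: "'a \<Rightarrow> 'a" where "tri a = ev env0 TriC $ a"
definition rt :: "'a \<Rightarrow> 'a" where "rt a = ev env0 RootC $ a"
definition pr :: "'a \<Rightarrow> 'a \<Rightarrow> 'a" where "pr a b = ev env0 PairC $ a $ b"
definition p1 :: "'a \<Rightarrow> 'a" where "p1 a = ev env0 PfstC $ a"
definition p2 :: "'a \<Rightarrow> 'a" where "p2 a = ev env0 PsndC $ a"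

lemma ev_arith [simp]:
  "ev e AddC $ a $ b = pl a b" "ev e MultC $ a $ b = ti a b" "ev e PredC $ a = pd a"
  "ev e MonusC $ a $ b = mo a b" "ev e Pow2C $ a = po a" "ev e TriC $ a = tri a"
  "ev e RootC $ a = rt a" "ev e PairC $ a $ b = pr a b" "ev e PfstC $ a = p1 a" "ev e PsndC $ a = p2 a"
  using ev_closed[of _ e env0]
  by (auto simp: pl_def ti_def pd_def mo_def po_def tri_def rt_def pr_def p1_def p2_def)

lemma arith_dom [simp, intro]:
  assumes "a \<in> N"
  shows "pd a \<in> N" "po a \<in> N" "tri a \<in> N" "rt a \<in> N" "p1 a \<in> N" "p2 a \<in> N"
    and "b \<in> N \<Longrightarrow> pl a b \<in> N" "b \<in> N \<Longrightarrow> ti a b \<in> N" "b \<in> N \<Longrightarrow> mo a b \<in> N" "b \<in> N \<Longrightarrow> pr a b \<in> N"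
proof -
  have 1: "ev env0 t \<in> dom T1 \<Longrightarrow> ev env0 t $ a \<in> N" for t using ap_dom assms by blast
  show "pd a \<in> N" "po a \<in> N" "tri a \<in> N" "rt a \<in> N" "p1 a \<in> N" "p2 a \<in> N"
    unfolding pd_def po_def tri_def rt_def p1_def p2_def by (rule 1, rule ev_domI, simp, simp, simp)+
  have 2: "ev env0 t \<in> dom (T0 \<leadsto> T0 \<leadsto> T0) \<Longrightarrow> b \<in> N \<Longrightarrow> ev env0 t $ a $ b \<in> N" for t
    using ap_dom assms by blast
  show "b \<in> N \<Longrightarrow> pl a b \<in> N" "b \<in> N \<Longrightarrow> ti a b \<in> N" "b \<in> N \<Longrightarrow> mo a b \<in> N" "b \<in> N \<Longrightarrow> pr a b \<in> N"
    unfolding pl_def ti_def mo_def pr_def by (rule 2, rule ev_domI, simp, simp, simp, simp)+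
qed

lemma pl_rec [simp]: "a \<in> N \<Longrightarrow> pl a ze = a" "a \<in> N \<Longrightarrow> b \<in> N \<Longrightarrow> pl a (su b) = su (pl a b)"
  unfolding pl_def AddC_def by simp_all

lemma ti_rec [simp]: "a \<in> N \<Longrightarrow> ti a ze = ze" "a \<in> N \<Longrightarrow> b \<in> N \<Longrightarrow> ti a (su b) = pl (ti a b) a"
  unfolding ti_def MultC_def by simp_all

lemma pd_rec [simp]: "pd ze = ze" "a \<in> N \<Longrightarrow> pd (su a) = a"
  unfolding pd_def PredC_def by simp_all

lemma mo_rec [simp]: "a \<in> N \<Longrightarrow> mo a ze = a" "a \<in> N \<Longrightarrow> b \<in> N \<Longrightarrow> mo a (su b) = pd (mo a b)"
  unfolding mo_def MonusC_def by simp_all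

lemma po_rec [simp]: "po ze = su ze" "a \<in> N \<Longrightarrow> po (su a) = pl (po a) (po a)"
  unfolding po_def Pow2C_def by simp_all

lemma tri_rec [simp]: "tri ze = ze" "a \<in> N \<Longrightarrow> tri (su a) = pl (tri a) (su a)"
  unfolding tri_def TriC_def by simp_all

lemma rt_rec [simp]: "rt ze = ze"
  "a \<in> N \<Longrightarrow> rt (su a) = (if mo (tri (su (rt a))) (su a) = ze then su (rt a) else rt a)"
proof -
  show "rt ze = ze" unfolding rt_def RootC_def by simp
  assume a: "a \<in> N"
  have "I Rec $ c $ b $ ev e (lam0 3 (lam0 4 (nv (Suc 0)))) = (if c = ze then b else e (Suc 0, T0))"
    if "c \<in> N" "b \<in> N" "good_env e" for b c e
    using N_casesE[of c] that by (auto simp: good_envD)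
  then show "rt (su a) = (if mo (tri (su (rt a))) (su a) = ze then su (rt a) else rt a)"
    unfolding rt_def RootC_def using a by simp
qed

lemma pr_eq: "a \<in> N \<Longrightarrow> b \<in> N \<Longrightarrow> pr a b = pl (tri (pl a b)) b"
  unfolding pr_def PairC_def by simp

lemma p2_eq: "a \<in> N \<Longrightarrow> p2 a = mo a (tri (rt a))"
  unfolding p2_def PsndC_def by simp

lemma p1_eq: "a \<in> N \<Longrightarrow> p1 a = mo (rt a) (p2 a)"
  unfolding p1_def PfstC_def by simp

section \<open>Laws of addition, multiplication and truncated subtraction\<close>

lemma pl_ze [simp]: "n \<in> N \<Longrightarrow> pl ze n = n"
  by (rule arith_induct[where \<phi> = "Eq (Zero \<oplus> nv 0) (nv 0)" and e = env0 and x = 0]) auto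

lemma pl_su [simp]: "a \<in> N \<Longrightarrow> n \<in> N \<Longrightarrow> pl (su a) n = su (pl a n)"
  by (rule arith_induct[where \<phi> = "Eq (Succ \<cdot> nv 1 \<oplus> nv 0) (Succ \<cdot> (nv 1 \<oplus> nv 0))"
      and e = "env0((1, T0) := a)" and x = 0]) auto

lemma pl_comm: "a \<in> N \<Longrightarrow> n \<in> N \<Longrightarrow> pl a n = pl n a"
  by (rule arith_induct[where \<phi> = "Eq (nv 1 \<oplus> nv 0) (nv 0 \<oplus> nv 1)"
      and e = "env0((1, T0) := a)" and x = 0]) auto

lemma pl_assoc: "\<lbrakk>a \<in> N; b \<in> N; n \<in> N\<rbrakk> \<Longrightarrow> pl (pl a b) n = pl a (pl b n)"
  by (rule arith_induct[where \<phi> = "Eq (nv 1 \<oplus> nv 2 \<oplus> nv 0) (nv 1 \<oplus> (nv 2 \<oplus> nv 0))"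
      and e = "env0((1, T0) := a, (2, T0) := b)" and x = 0]) auto

lemma pl_lcomm: "\<lbrakk>a \<in> N; b \<in> N; n \<in> N\<rbrakk> \<Longrightarrow> pl a (pl b n) = pl b (pl a n)"
  using pl_assoc[of a b n] pl_assoc[of b a n] pl_comm[of a b] by simp

lemma ti_ze [simp]: "n \<in> N \<Longrightarrow> ti ze n = ze"
  by (rule arith_induct[where \<phi> = "Eq (Zero \<otimes> nv 0) Zero" and e = env0 and x = 0]) auto

lemma ti_su [simp]: "a \<in> N \<Longrightarrow> n \<in> N \<Longrightarrow> ti (su a) n = pl (ti a n) n"
  by (rule arith_induct[where \<phi> = "Eq (Succ \<cdot> nv 1 \<otimes> nv 0) (nv 1 \<otimes> nv 0 \<oplus> nv 0)"
      and e = "env0((1, T0) := a)" and x = 0 and P = "\<lambda>n. ti (su a) n = pl (ti a n) n"])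
    (auto simp: pl_assoc pl_comm pl_lcomm)

lemma ti_comm: "a \<in> N \<Longrightarrow> n \<in> N \<Longrightarrow> ti a n = ti n a"
  by (rule arith_induct[where \<phi> = "Eq (nv 1 \<otimes> nv 0) (nv 0 \<otimes> nv 1)"
      and e = "env0((1, T0) := a)" and x = 0]) auto

lemma ti_distrib: "\<lbrakk>a \<in> N; b \<in> N; n \<in> N\<rbrakk> \<Longrightarrow> ti (pl a b) n = pl (ti a n) (ti b n)"
  by (rule arith_induct[where \<phi> = "Eq ((nv 1 \<oplus> nv 2) \<otimes> nv 0) (nv 1 \<otimes> nv 0 \<oplus> nv 2 \<otimes> nv 0)"
      and e = "env0((1, T0) := a, (2, T0) := b)" and x = 0]) (auto simp: pl_assoc pl_comm pl_lcomm)

lemma ti_assoc: "\<lbrakk>a \<in> N; b \<in> N; n \<in> N\<rbrakk> \<Longrightarrow> ti (ti n a) b = ti n (ti a b)"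
  by (rule arith_induct[where \<phi> = "Eq (nv 0 \<otimes> nv 1 \<otimes> nv 2) (nv 0 \<otimes> (nv 1 \<otimes> nv 2))"
      and e = "env0((1, T0) := a, (2, T0) := b)" and x = 0]) (auto simp: ti_distrib)

lemma mo_su: "a \<in> N \<Longrightarrow> n \<in> N \<Longrightarrow> mo (su a) (su n) = mo a n"
  by (rule arith_induct[where \<phi> = "Eq (Succ \<cdot> nv 1 \<ominus> Succ \<cdot> nv 0) (nv 1 \<ominus> nv 0)"
      and e = "env0((1, T0) := a)" and x = 0]) auto

lemma mo_ze [simp]: "n \<in> N \<Longrightarrow> mo ze n = ze"
  by (rule arith_induct[where \<phi> = "Eq (Zero \<ominus> nv 0) Zero" and e = env0 and x = 0]) auto

lemma mo_pl: "a \<in> N \<Longrightarrow> n \<in> N \<Longrightarrow> mo (pl n a) n = a"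
  by (rule arith_induct[where \<phi> = "Eq ((nv 0 \<oplus> nv 1) \<ominus> nv 0) (nv 1)"
      and e = "env0((1, T0) := a)" and x = 0]) (auto simp: mo_su simp del: mo_rec(2))

lemma mo_le: "a \<in> N \<Longrightarrow> n \<in> N \<Longrightarrow> mo n (pl n a) = ze"
  by (rule arith_induct[where \<phi> = "Eq (nv 0 \<ominus> (nv 0 \<oplus> nv 1)) Zero"
      and e = "env0((1, T0) := a)" and x = 0]) (auto simp: mo_su simp del: mo_rec(2))

lemma pl_cancel: "\<lbrakk>a \<in> N; b \<in> N; c \<in> N; pl c a = pl c b\<rbrakk> \<Longrightarrow> a = b"
  by (metis mo_pl)

text \<open>Truncated subtraction supplies the difference explicitly, so comparability becomes a
  quantifier-free formula and can be proved by induction.\<close>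

lemma pl_total:
  assumes "b \<in> N" "n \<in> N"
  shows "pl n (mo b n) = b \<or> pl b (mo n b) = n"
proof (rule arith_induct[where \<phi> = "Dis (Eq (nv 0 \<oplus> (nv 1 \<ominus> nv 0)) (nv 1)) (Eq (nv 1 \<oplus> (nv 0 \<ominus> nv 1)) (nv 0))"
      and e = "env0((1, T0) := b)" and x = 0 and n = n])
  fix n assume n: "n \<in> N" and IH: "pl n (mo b n) = b \<or> pl b (mo n b) = n"
  from IH show "pl (su n) (mo b (su n)) = b \<or> pl b (mo (su n) b) = su n"
  proof
    assume b: "pl n (mo b n) = b"
    have "mo b n \<in> N" using assms n by auto
    from N_casesE[OF this] show ?thesis
    proof
      assume "mo b n = ze"
      then have "b = n" using b n by simp
      then show ?thesis using mo_pl[of "su ze" n] n by simp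
    qed (use b n assms in auto)
  next
    assume "pl b (mo n b) = n"
    then have "su n = pl b (su (mo n b))" using n assms by simp
    then show ?thesis using mo_pl[of "su (mo n b)" b] n assms by simp
  qed
qed (use assms in auto)

lemma pl_eq_ze: "\<lbrakk>a \<in> N; b \<in> N; pl a b = ze\<rbrakk> \<Longrightarrow> a = ze"
  using N_casesE[of a] by auto

lemma ti_eq_ze: "\<lbrakk>a \<in> N; b \<in> N; ti a b = ze\<rbrakk> \<Longrightarrow> a = ze \<or> b = ze"
  using N_casesE[of a] N_casesE[of b] by auto

end

section \<open>An ordered field for the rationals of a model\<close>

type_synonym nat_ops = "(nat \<Rightarrow> nat \<Rightarrow> nat) \<times> (nat \<Rightarrow> nat \<Rightarrow> nat) \<times> nat \<times> nat"

text \<open>Addition will define the order: \<open>cancel\<close> and \<open>sum_z\<close> make it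
  antisymmetric, \<open>total\<close> makes it linear, and \<open>prod_z\<close> makes
  multiplication by a nonzero number strictly monotone.\<close>

locale num_ops =
  fixes p t :: "nat \<Rightarrow> nat \<Rightarrow> nat" and z u :: nat
  assumes p_assoc: "p (p a b) c = p a (p b c)" and p_comm: "p a b = p b a" and p_z: "p z a = a"
    and t_assoc: "t (t a b) c = t a (t b c)" and t_comm: "t a b = t b a" and t_u: "t u a = a"
    and t_z: "t z a = z" and distrib: "t (p a b) c = p (t a c) (t b c)" and z_u: "z \<noteq> u"
    and cancel: "p c a = p c b \<Longrightarrow> a = b" and total: "\<exists>c. p a c = b \<or> p b c = a"
    and sum_z: "p a b = z \<Longrightarrow> a = z" and prod_z: "t a b = z \<Longrightarrow> a = z \<or> b = z"

definition is_num_ops :: "nat_ops \<Rightarrow> bool" where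
  "is_num_ops = (\<lambda>(p, t, z, u). num_ops p t z u)"

lemma num_ops_standard: "is_num_ops ((+), (*), 0, 1)"
  unfolding is_num_ops_def prod.case by unfold_locales (auto simp: algebra_simps, presburger)

definition principles :: "fm set" where
  "principles = {BOOT, INTERIOR, INTERIOR_CODE, CLOSURE, CLOSURE_CODE}"

text \<open>The numbers of a term model form a countably infinite set and can be renamed by
  \<open>nat\<close>. Operations on \<open>nat\<close> belong to one fixed type, so a type
  definition outside any model can refer to them.\<close>

definition numbering :: "fm set \<Rightarrow> nat_ops \<Rightarrow> (tm set \<Rightarrow> nat) \<Rightarrow> bool" where
  "numbering \<Gamma> = (\<lambda>(p, t, z, u) h. bij_betw h (aca_set.cdom \<Gamma> T0) UNIV \<and>
     h (aca_set.cl \<Gamma> Zero) = z \<and> u = h (aca_set.cap \<Gamma> (aca_set.cl \<Gamma> Succ) (aca_set.cl \<Gamma> Zero)) \<and>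
     (\<forall>a\<in>aca_set.cdom \<Gamma> T0. \<forall>b\<in>aca_set.cdom \<Gamma> T0.
        h (model.pl (aca_set.cdom \<Gamma>) (aca_set.cap \<Gamma>) (aca_set.cl \<Gamma>) a b) = p (h a) (h b) \<and>
        h (model.ti (aca_set.cdom \<Gamma>) (aca_set.cap \<Gamma>) (aca_set.cl \<Gamma>) a b) = t (h a) (h b)))"

definition refuting :: "nat_ops \<Rightarrow> bool" where
  "refuting s \<longleftrightarrow> is_num_ops s \<and> (\<exists>\<Gamma> h. aca_set \<Gamma> \<and> numbering \<Gamma> s h \<and>
     (\<exists>\<phi>\<in>principles. \<exists>\<psi>\<in>principles. Iff \<phi> \<psi> \<notin> \<Gamma>))"

text \<open>A type cannot depend on a hypothetical model. So the operations are those of the numbers of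
  some model refuting the theorem if there is one, and otherwise any with the same laws, such as the
  standard ones. The type built from them is then an ordered field unconditionally.\<close>

definition the_ops :: nat_ops where
  "the_ops = (SOME s. is_num_ops s \<and> ((\<exists>s'. refuting s') \<longrightarrow> refuting s))"

lemma the_ops: "is_num_ops the_ops" "refuting s \<Longrightarrow> refuting the_ops"
proof -
  have "\<exists>s. is_num_ops s \<and> ((\<exists>s'. refuting s') \<longrightarrow> refuting s)"
    using num_ops_standard unfolding refuting_def by blast
  from someI_ex[OF this] show "is_num_ops the_ops" "refuting s \<Longrightarrow> refuting the_ops"
    unfolding the_ops_def by blast+
qed

section \<open>The numbers as an ordered semidomain\<close>

definition Pl :: "nat \<Rightarrow> nat \<Rightarrow> nat" where "Pl = fst the_ops"
definition Ti :: "nat \<Rightarrow> nat \<Rightarrow> nat" where "Ti = fst (snd the_ops)"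
definition Ze :: nat where "Ze = fst (snd (snd the_ops))"
definition Wn :: nat where "Wn = snd (snd (snd the_ops))"

lemma the_ops_eq: "the_ops = (Pl, Ti, Ze, Wn)"
  by (simp add: Pl_def Ti_def Ze_def Wn_def)

interpretation num_ops Pl Ti Ze Wn
  using the_ops(1) unfolding the_ops_eq is_num_ops_def by simp

text \<open>A copy of \<open>nat\<close>, because \<open>nat\<close> itself already carries its
  standard operations as class instances.\<close>

typedef pnum = "UNIV :: nat set" ..
setup_lifting type_definition_pnum

instantiation pnum :: comm_semiring_1
begin
lift_definition zero_pnum :: pnum is Ze .
lift_definition one_pnum :: pnum is Wn .
lift_definition plus_pnum :: "pnum \<Rightarrow> pnum \<Rightarrow> pnum" is Pl .
lift_definition times_pnum :: "pnum \<Rightarrow> pnum \<Rightarrow> pnum" is Ti .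
instance
  by standard (transfer; metis p_assoc p_comm p_z t_assoc t_comm t_u t_z distrib z_u)+
end

lemma num_cancel: "(c :: pnum) + a = c + b \<Longrightarrow> a = b"
  by transfer (rule cancel)
lemma num_total: "\<exists>c. (a :: pnum) + c = b \<or> b + c = a"
  by transfer (rule total)
lemma num_sum_zero: "(a :: pnum) + b = 0 \<Longrightarrow> a = 0"
  by transfer (rule sum_z)
lemma num_prod_zero: "(a :: pnum) * b = 0 \<Longrightarrow> a = 0 \<or> b = 0"
  by transfer (rule prod_z)

instantiation pnum :: "{ord, minus}"
begin
definition less_eq_pnum :: "pnum \<Rightarrow> pnum \<Rightarrow> bool" where "(a :: pnum) \<le> b \<longleftrightarrow> (\<exists>c. b = a + c)"
definition less_pnum :: "pnum \<Rightarrow> pnum \<Rightarrow> bool" where "(a :: pnum) < b \<longleftrightarrow> (\<exists>c. c \<noteq> 0 \<and> b = a + c)"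
text \<open>Truncation to 0 matches the subtraction of \<open>linordered_semidom\<close>, in which a
  - b - c = a - (b + c) holds without side conditions.\<close>

definition minus_pnum :: "pnum \<Rightarrow> pnum \<Rightarrow> pnum" where
  "(a :: pnum) - b = (if b \<le> a then THE c. a = b + c else 0)"
instance ..
end

lemma num_diff: "(a + b) - a = (b :: pnum)"
proof -
  have "a \<le> a + b" unfolding less_eq_pnum_def by blast
  moreover have "(THE c. a + b = a + c) = b" using num_cancel by (intro the_equality) auto
  ultimately show ?thesis unfolding minus_pnum_def by simp
qed

lemma num_diff_zero: "\<not> b \<le> a \<Longrightarrow> a - b = (0 :: pnum)"
  by (simp add: minus_pnum_def)

instance pnum :: linordered_semidom
proof
  fix a b c d :: pnum
  have anti: "x = y" if *: "x \<le> y" "y \<le> x" for x y :: pnum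
  proof -
    obtain u v where "y = x + u" "x = y + v" using * unfolding less_eq_pnum_def by blast
    then have "x + (u + v) = x + 0" by (simp add: algebra_simps)
    then have "u + v = 0" by (rule num_cancel)
    then have "u = 0" by (rule num_sum_zero)
    then show ?thesis using \<open>y = x + u\<close> by simp
  qed
  have refl: "x \<le> x" for x :: pnum unfolding less_eq_pnum_def by (metis add_0_right)
  have less: "x < y \<longleftrightarrow> x \<le> y \<and> x \<noteq> y" for x y :: pnum
    unfolding less_eq_pnum_def less_pnum_def using num_cancel[of x _ 0] by (metis add_0_right)
  show "a < b \<longleftrightarrow> a \<le> b \<and> \<not> b \<le> a" using anti[of a b] refl[of a] less[of a b] by auto
  show "a \<le> a" by (rule refl)
  show "a \<le> b \<Longrightarrow> b \<le> c \<Longrightarrow> a \<le> c" unfolding less_eq_pnum_def by (metis add.assoc)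
  show "a \<le> b \<Longrightarrow> b \<le> a \<Longrightarrow> a = b" by (rule anti)
  show "a \<le> b \<or> b \<le> a" unfolding less_eq_pnum_def using num_total by metis
  show "a + b - a = b" by (rule num_diff)
  show "a - b - c = a - (b + c)"
  proof (cases "b + c \<le> a")
    case True
    then obtain x where "a = b + (c + x)" unfolding less_eq_pnum_def by (metis add.assoc)
    then show ?thesis using num_diff by (metis add.assoc)
  next
    case False
    have "\<not> c \<le> a - b \<or> a - b - c = 0"
    proof (cases "b \<le> a")
      case True
      then obtain y where y: "a = b + y" unfolding less_eq_pnum_def by blast
      have "\<not> c \<le> y" using False y unfolding less_eq_pnum_def by (metis add.assoc)
      then show ?thesis using y num_diff by simp
    next
      case False
      then have "a - b = 0" by (rule num_diff_zero)
      then show ?thesis using num_diff num_diff_zero unfolding less_eq_pnum_def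
        by (metis add_0_left num_sum_zero)
    qed
    then show ?thesis using False num_diff_zero by metis
  qed
  show "a \<le> b \<Longrightarrow> c + a \<le> c + b" unfolding less_eq_pnum_def by (metis add.assoc)
  show "a * (b - c) = a * b - a * c"
  proof (cases "c \<le> b")
    case True
    then obtain x where "b = c + x" unfolding less_eq_pnum_def by blast
    then show ?thesis using num_diff by (simp add: distrib_left)
  next
    case False
    then obtain x where x: "c = b + x" using num_total unfolding less_eq_pnum_def by metis
    have "a * b - a * c = 0"
    proof (cases "a * c \<le> a * b")
      case True
      then have "a * b = a * c" using anti x unfolding less_eq_pnum_def by (metis distrib_left)
      then show ?thesis using num_diff[of "a * b" 0] by simp
    qed (rule num_diff_zero)
    then show ?thesis using False num_diff_zero by simp
  qed
  show "a \<noteq> 0 \<Longrightarrow> b \<noteq> 0 \<Longrightarrow> a * b \<noteq> 0" using num_prod_zero by blast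
  show "a < b \<Longrightarrow> 0 < c \<Longrightarrow> c * a < c * b"
    unfolding less_pnum_def using num_prod_zero by (metis add_0_left distrib_left)
  show "(0 :: pnum) < 1" unfolding less_pnum_def by (metis add_0_left zero_neq_one)
  show "b \<le> a \<Longrightarrow> a - b + b = a" unfolding less_eq_pnum_def using num_diff by (metis add.commute)
qed

lemma num_zero_le: "0 \<le> (a :: pnum)"
  unfolding less_eq_pnum_def by (metis add_0_left)

lifting_forget pnum.lifting

section \<open>The integers as differences of numbers, and their field of fractions\<close>

definition diff_rel :: "pnum \<times> pnum \<Rightarrow> pnum \<times> pnum \<Rightarrow> bool" where
  "diff_rel = (\<lambda>(x, y) (u, v). x + v = u + y)"

quotient_type diff = "pnum \<times> pnum" / diff_rel
  morphisms Rep_Diff Abs_Diff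
proof (rule equivpI)
  show "reflp diff_rel" by (auto simp: reflp_def diff_rel_def)
  show "symp diff_rel" by (auto simp: symp_def diff_rel_def)
  show "transp diff_rel"
  proof (rule transpI, clarsimp simp: diff_rel_def)
    fix a b c d e f :: pnum
    assume "a + d = c + b" "c + f = e + d"
    then have "(a + d) + (c + f) = (c + b) + (e + d)" by simp
    then have "(c + d) + (a + f) = (c + d) + (e + b)" by (simp only: ac_simps)
    then show "a + f = e + b" by (rule num_cancel)
  qed
qed

instantiation diff :: comm_ring_1
begin
lift_definition zero_diff :: diff is "(0, 0)" .
lift_definition one_diff :: diff is "(1, 0)" .
lift_definition plus_diff :: "diff \<Rightarrow> diff \<Rightarrow> diff" is "\<lambda>(x, y) (u, v). (x + u, y + v)"
  by (clarsimp simp: diff_rel_def) (metis (no_types, opaque_lifting) add.commute add.left_commute)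
lift_definition uminus_diff :: "diff \<Rightarrow> diff" is "\<lambda>(x, y). (y, x)"
  by (clarsimp simp: diff_rel_def) (metis add.commute)
lift_definition minus_diff :: "diff \<Rightarrow> diff \<Rightarrow> diff" is "\<lambda>(x, y) (u, v). (x + v, y + u)"
  by (clarsimp simp: diff_rel_def) (metis (no_types, opaque_lifting) add.commute add.left_commute)
lift_definition times_diff :: "diff \<Rightarrow> diff \<Rightarrow> diff" is "\<lambda>(x, y) (u, v). (x*u + y*v, x*v + y*u)"
proof (clarsimp simp: diff_rel_def)
  fix s t u v w x y z :: pnum
  assume "s + v = u + t" and "w + z = y + x"
  \<comment> \<open>Multiples of the two equations are added. After expansion both sides of the goal
    appear next to a common summand, which cancels.\<close>
  then have "(s + v) * w + (u + t) * x + u * (w + z) + v * (y + x) =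
      (u + t) * w + (s + v) * x + u * (y + x) + v * (w + z)"
    by simp
  then have "(u * w + u * x + v * w + v * x) + ((s * w + t * x) + (u * z + v * y)) =
      (u * w + u * x + v * w + v * x) + ((u * y + v * z) + (s * x + t * w))"
    by (simp only: distrib_left distrib_right ac_simps)
  then show "(s * w + t * x) + (u * z + v * y) = (u * y + v * z) + (s * x + t * w)"
    by (rule num_cancel)
qed
instance
  by standard (transfer; clarsimp simp: diff_rel_def algebra_simps)+
end

instantiation diff :: linordered_idom
begin
lift_definition less_eq_diff :: "diff \<Rightarrow> diff \<Rightarrow> bool" is "\<lambda>(x, y) (u, v). x + v \<le> u + y"
proof (clarsimp simp: diff_rel_def)
  fix s t u v w x y z :: pnum
  assume *: "s + v = u + t" "w + z = y + x"
  have "s + x \<le> w + t \<longleftrightarrow> (s + x) + (v + y) \<le> (w + t) + (v + y)" by simp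
  also have "\<dots> \<longleftrightarrow> (s + v) + (y + x) \<le> (w + v) + (y + t)" by (simp only: ac_simps)
  also have "\<dots> \<longleftrightarrow> (u + t) + (w + z) \<le> (w + v) + (y + t)" using * by simp
  also have "\<dots> \<longleftrightarrow> (u + z) + (w + t) \<le> (y + v) + (w + t)" by (simp only: ac_simps)
  finally show "s + x \<le> w + t \<longleftrightarrow> u + z \<le> y + v" by simp
qed
definition less_diff :: "diff \<Rightarrow> diff \<Rightarrow> bool" where "a < b \<longleftrightarrow> a \<le> b \<and> a \<noteq> (b :: diff)"
definition abs_diff :: "diff \<Rightarrow> diff" where "\<bar>i :: diff\<bar> = (if i < 0 then - i else i)"
definition sgn_diff :: "diff \<Rightarrow> diff" where "sgn (i :: diff) = (if i = 0 then 0 else if 0 < i then 1 else - 1)"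

lemma diff_mult_nonneg: "0 \<le> a \<Longrightarrow> 0 \<le> b \<Longrightarrow> 0 \<le> a * (b :: diff)"
proof (transfer, clarsimp)
  fix x y u v :: pnum
  assume "y \<le> x" "v \<le> u"
  then obtain p q where "x = y + p" "u = v + q" unfolding less_eq_pnum_def by blast
  then show "x * v + y * u \<le> x * u + y * v" by (simp add: algebra_simps num_zero_le)
qed

lemma diff_trans: "a \<le> b \<Longrightarrow> b \<le> c \<Longrightarrow> a \<le> (c :: diff)"
  proof (transfer, clarsimp)
    fix a b c d e f :: pnum
    assume "a + d \<le> c + b" "c + f \<le> e + d"
    then have "(a + d) + (c + f) \<le> (c + b) + (e + d)" by (rule add_mono)
    then have "(a + f) + (c + d) \<le> (e + b) + (c + d)" by (simp only: ac_simps)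
    then show "a + f \<le> e + b" by simp
  qed

text \<open>Writing the larger of each pair as the smaller plus a difference, with differences p and
  q, reduces the equation to p * q = 0 in each of the four cases.\<close>

lemma pnum_no_zero_div:
  fixes x y u v :: pnum
  assumes "x * u + y * v = x * v + y * u"
  shows "x = y \<or> u = v"
proof -
  consider p q where "x = y + p" "u = v + q" | p q where "x = y + p" "v = u + q"
    | p q where "y = x + p" "u = v + q" | p q where "y = x + p" "v = u + q"
    using num_total by metis
  then show ?thesis using assms by cases (auto simp: algebra_simps)
qed

lemma diff_no_zero_div: "a * b = 0 \<Longrightarrow> a = 0 \<or> b = (0 :: diff)"
  by transfer (clarsimp simp: diff_rel_def, metis pnum_no_zero_div)

instance
proof
  fix a b c :: diff
  have anti: "x = y" if "x \<le> y" "y \<le> x" for x y :: diff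
    using that by transfer (auto simp: diff_rel_def)
  have tot: "x \<le> y \<or> y \<le> x" for x y :: diff
    by transfer auto
  have sub: "x \<le> y \<longleftrightarrow> 0 \<le> y - x" for x y :: diff
    by transfer (auto simp: algebra_simps)
  show "a < b \<longleftrightarrow> a \<le> b \<and> \<not> b \<le> a" using anti tot less_diff_def by metis
  show "a \<le> a" using tot[of a a] by simp
  show "a \<le> b \<Longrightarrow> b \<le> c \<Longrightarrow> a \<le> c" by (rule diff_trans)
  show "a \<le> b \<Longrightarrow> b \<le> a \<Longrightarrow> a = b" by (rule anti)
  show "a \<le> b \<or> b \<le> a" by (rule tot)
  show "a \<le> b \<Longrightarrow> c + a \<le> c + b" using sub[of a b] sub[of "c + a" "c + b"] by simp
  show "a < b \<Longrightarrow> 0 < c \<Longrightarrow> c * a < c * b"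
  proof -
    assume "a < b" "0 < c"
    then have "0 \<le> c * (b - a)" "c * (b - a) \<noteq> 0"
      using sub[of a b] diff_mult_nonneg[of c "b - a"] diff_no_zero_div[of c "b - a"]
      unfolding less_diff_def by auto
    then show "c * a < c * b" using sub[of "c * a" "c * b"] unfolding less_diff_def
      by (auto simp: right_diff_distrib)
  qed
  show "\<bar>a\<bar> = (if a < 0 then - a else a)" by (rule abs_diff_def)
  show "sgn a = (if a = 0 then 0 else if 0 < a then 1 else - 1)" by (rule sgn_diff_def)
qed
end

lift_definition diff_of_pnum :: "pnum \<Rightarrow> diff" is "\<lambda>x. (x, 0)" .

definition field_of_nat :: "nat \<Rightarrow> diff fract" where
  "field_of_nat n = Fract (diff_of_pnum (Abs_pnum n)) 1"

lemma diff_of_pnum: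
  "diff_of_pnum 0 = 0" "diff_of_pnum 1 = 1" "diff_of_pnum (a + b) = diff_of_pnum a + diff_of_pnum b"
  "diff_of_pnum (a * b) = diff_of_pnum a * diff_of_pnum b" "0 \<le> diff_of_pnum a"
  "diff_of_pnum a = diff_of_pnum b \<longleftrightarrow> a = b"
  by (transfer; auto simp: diff_rel_def less_eq_pnum_def)+

lemma field_of_nat:
  "field_of_nat Ze = 0" "field_of_nat Wn = 1"
  "field_of_nat (Pl a b) = field_of_nat a + field_of_nat b"
  "field_of_nat (Ti a b) = field_of_nat a * field_of_nat b"
  "0 \<le> field_of_nat a" "field_of_nat a = field_of_nat b \<longleftrightarrow> a = b"
proof -
  have *: "Abs_pnum Ze = 0" "Abs_pnum Wn = 1" "Abs_pnum (Pl a b) = Abs_pnum a + Abs_pnum b"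
    "Abs_pnum (Ti a b) = Abs_pnum a * Abs_pnum b"
    by (simp_all add: zero_pnum_def one_pnum_def plus_pnum.abs_eq times_pnum.abs_eq eq_onp_def)
  show "field_of_nat Ze = 0" "field_of_nat Wn = 1"
    "field_of_nat (Pl a b) = field_of_nat a + field_of_nat b"
    "field_of_nat (Ti a b) = field_of_nat a * field_of_nat b"
    by (simp_all add: field_of_nat_def * diff_of_pnum Zero_fract_def One_fract_def)
  show "0 \<le> field_of_nat a" by (simp add: field_of_nat_def zero_le_Fract_iff diff_of_pnum)
  show "field_of_nat a = field_of_nat b \<longleftrightarrow> a = b"
    by (simp add: field_of_nat_def eq_fract diff_of_pnum Abs_pnum_inject)
qed

text \<open>An integer is a difference of numbers, and after a change of signs the denominator is
  positive, hence itself a number. Thus the field contains nothing beyond the rationals of the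
  model.\<close>

lemma field_of_nat_fraction:
  "\<exists>a b c. c \<noteq> Ze \<and> r = (field_of_nat a - field_of_nat b) / field_of_nat c"
proof -
  have diff: "\<exists>a b. x = diff_of_pnum a - diff_of_pnum b" for x
    by transfer (auto simp: diff_rel_def)
  have pos: "\<exists>c. x = diff_of_pnum c" if "0 < x" for x
  proof -
    obtain a b where x: "x = diff_of_pnum a - diff_of_pnum b" using diff by blast
    consider c where "a = b + c" | c where "b = a + c" using num_total by metis
    then show ?thesis
    proof cases
      case 2
      then have "x = - diff_of_pnum c" using x by (simp add: diff_of_pnum)
      then show ?thesis using that diff_of_pnum(5)[of c] by simp
    qed (use x in \<open>auto simp: diff_of_pnum\<close>)
  qed
  obtain x0 y0 where r0: "r = Fract x0 y0" "y0 \<noteq> 0" by (cases r rule: Fract_cases)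
  define x y where "x = (if 0 < y0 then x0 else - x0)" and "y = (if 0 < y0 then y0 else - y0)"
  have r: "r = Fract x y" "0 < y" using r0 unfolding x_def y_def by (auto simp: minus_fract_cancel)
  obtain a b c where x: "x = diff_of_pnum a - diff_of_pnum b" and y: "y = diff_of_pnum c"
    using diff pos[OF r(2)] by blast
  obtain a' b' c' where abs: "a = Abs_pnum a'" "b = Abs_pnum b'" "c = Abs_pnum c'"
    by (metis Abs_pnum_cases)
  have "c' \<noteq> Ze" using r(2) y abs(3) field_of_nat(1)
    by (auto simp: diff_of_pnum zero_pnum_def[symmetric])
  moreover have "r = (field_of_nat a' - field_of_nat b') / field_of_nat c'"
    using r x y abs by (simp add: field_of_nat_def)
  ultimately show ?thesis by blast
qed

text \<open>\<open>val\<close> embeds the numbers into an ordered field that consists of their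
  fractions. From \<open>val_fraction\<close> come both a code for every field element and the
  Archimedean property relative to the model's own numbers.\<close>

locale valued_model = model dom ap I
  for dom :: "ty \<Rightarrow> 'a set" and ap :: "'a \<Rightarrow> 'a \<Rightarrow> 'a"  (infixl "$" 90) and I +
  fixes val :: "'a \<Rightarrow> 'q :: linordered_field"
  assumes val_ze [simp]: "val ze = 0" and val_one: "val (su ze) = 1"
    and val_pl [simp]: "a \<in> N \<Longrightarrow> b \<in> N \<Longrightarrow> val (pl a b) = val a + val b"
    and val_ti [simp]: "a \<in> N \<Longrightarrow> b \<in> N \<Longrightarrow> val (ti a b) = val a * val b"
    and val_nonneg [simp]: "a \<in> N \<Longrightarrow> 0 \<le> val a"
    and val_fraction: "\<exists>a\<in>N. \<exists>b\<in>N. \<exists>c\<in>N. c \<noteq> ze \<and> r = (val a - val b) / val c"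
    and val_inj: "a \<in> N \<Longrightarrow> b \<in> N \<Longrightarrow> val a = val b \<longleftrightarrow> a = b"

lemma (in model) infinite_N: "infinite (dom T0)"
proof -
  let ?f = "\<lambda>n. (su ^^ n) ze"
  have d: "?f n \<in> dom T0" for n by (induction n) auto
  have "?f m = ?f n \<Longrightarrow> m = n" for m n
  proof (induction m arbitrary: n)
    case 0
    then show ?case using su_not_ze'[OF d] by (cases n) auto
  next
    case (Suc m)
    then show ?case using d su_not_ze[OF d] by (cases n) auto
  qed
  then have "inj ?f" by (rule injI)
  then show ?thesis using d infinite_iff_countable_subset by blast
qed

lemma (in aca_set) refuting_exists:
  assumes "\<phi> \<in> principles" "\<psi> \<in> principles" "Iff \<phi> \<psi> \<notin> \<Gamma>"
  shows "\<exists>s. refuting s"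
proof -
  have "countable (cdom T0)" unfolding cdom_def by (simp add: countable_image)
  then obtain h :: "tm set \<Rightarrow> nat" where h: "bij_betw h (cdom T0) UNIV"
    using infinite_N countableE_infinite by blast
  define g where "g = inv_into (cdom T0) h"
  have hg [simp]: "h (g n) = n" for n
    unfolding g_def using h by (simp add: bij_betw_def f_inv_into_f)
  have gN [simp]: "g n \<in> cdom T0" for n
    unfolding g_def using h by (metis UNIV_I bij_betw_def inv_into_into)
  have gh [simp]: "a \<in> cdom T0 \<Longrightarrow> g (h a) = a" for a
    unfolding g_def using h by (simp add: bij_betw_def inv_into_f_f)
  have hinj: "\<lbrakk>h a = h b; a \<in> cdom T0; b \<in> cdom T0\<rbrakk> \<Longrightarrow> a = b" for a b
    by (metis gh)
  let ?p = "\<lambda>m n. h (pl (g m) (g n))" and ?t = "\<lambda>m n. h (ti (g m) (g n))"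
  let ?s = "(?p, ?t, h ze, h (su ze))"
  have "is_num_ops ?s"
    unfolding is_num_ops_def prod.case
  proof
    fix a b c
    show "h ze \<noteq> h (su ze)" using hinj su_not_ze by (metis su_dom ze_dom)
    show "?p a b = ?p b a" "?t a b = ?t b a" by (simp_all add: pl_comm ti_comm)
    show "\<exists>c. ?p a c = b \<or> ?p b c = a"
    proof -
      have "pl (g b) (mo (g a) (g b)) = g a \<or> pl (g a) (mo (g b) (g a)) = g b"
        using pl_total[of "g a" "g b"] by simp
      then show ?thesis by (metis arith_dom(9) gN gh hg)
    qed
    show "?p c a = ?p c b \<Longrightarrow> a = b"
      using pl_cancel[of "g a" "g b" "g c"] hinj[of "pl (g c) (g a)" "pl (g c) (g b)"]
      by (metis arith_dom(7) gN hg)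
    show "?p a b = h ze \<Longrightarrow> a = h ze"
      using pl_eq_ze[of "g a" "g b"] hinj[of "pl (g a) (g b)" ze] by (metis arith_dom(7) gN hg ze_dom)
    show "?t a b = h ze \<Longrightarrow> a = h ze \<or> b = h ze"
      using ti_eq_ze[of "g a" "g b"] hinj[of "ti (g a) (g b)" ze] by (metis arith_dom(8) gN hg ze_dom)
  qed (simp_all add: pl_assoc ti_assoc ti_distrib)
  moreover have "numbering \<Gamma> ?s h"
    unfolding numbering_def using h by (simp flip: Succ_ap)
  ultimately show ?thesis using assms aca_set_axioms unfolding refuting_def by blast
qed

text \<open>The model behind \<open>the_ops\<close> need not be the given one. Hence \<Gamma>,
  \<phi> and \<psi> are all replaced: a refuting model is traded for one whose numbers are those
  built into the type \<open>diff fract\<close>.\<close>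

theorem refuting_valued_model:
  assumes "aca_set \<Gamma>" "\<phi> \<in> principles" "\<psi> \<in> principles" "Iff \<phi> \<psi> \<notin> \<Gamma>"
  shows "\<exists>\<Gamma> val \<phi> \<psi>. aca_set \<Gamma> \<and> \<phi> \<in> principles \<and> \<psi> \<in> principles \<and> Iff \<phi> \<psi> \<notin> \<Gamma> \<and>
    valued_model (aca_set.cdom \<Gamma>) (aca_set.cap \<Gamma>) (aca_set.cl \<Gamma>) (val :: tm set \<Rightarrow> diff fract)"
proof -
  have "refuting the_ops"
    using aca_set.refuting_exists[OF assms] the_ops(2) by blast
  then obtain \<Gamma> h \<phi> \<psi> where *: "aca_set \<Gamma>" "\<phi> \<in> principles" "\<psi> \<in> principles" "Iff \<phi> \<psi> \<notin> \<Gamma>"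
    and nums: "numbering \<Gamma> (Pl, Ti, Ze, Wn) h"
    unfolding refuting_def the_ops_eq by blast
  interpret aca_set \<Gamma> by fact
  have "valued_model cdom cap cl (\<lambda>a. field_of_nat (h a))"
  proof
    have "inj_on h (cdom T0)" using nums by (auto simp: numbering_def bij_betw_def)
    then show "field_of_nat (h a) = field_of_nat (h b) \<longleftrightarrow> a = b" if "a \<in> cdom T0" "b \<in> cdom T0" for a b
      using that by (auto simp: field_of_nat inj_on_def)
    have *: "\<exists>a\<in>cdom T0. h a = n" for n using nums unfolding numbering_def prod.case bij_betw_def by (metis imageE UNIV_I)
    fix r
    obtain a b c where "c \<noteq> Ze" "r = (field_of_nat a - field_of_nat b) / field_of_nat c"
      using field_of_nat_fraction by blast
    moreover obtain a' b' c' where "a' \<in> cdom T0" "h a' = a" "b' \<in> cdom T0" "h b' = b" "c' \<in> cdom T0" "h c' = c"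
      using * by metis
    moreover have "h ze = Ze" using nums by (simp add: numbering_def)
    ultimately show "\<exists>a\<in>cdom T0. \<exists>b\<in>cdom T0. \<exists>c\<in>cdom T0. c \<noteq> ze \<and>
        r = (field_of_nat (h a) - field_of_nat (h b)) / field_of_nat (h c)"
      by (intro bexI[of _ a'] bexI[of _ b'] bexI[of _ c'] conjI) auto
  qed (use nums in \<open>auto simp: numbering_def field_of_nat simp flip: Succ_ap\<close>)
  then show ?thesis using * by blast
qed

section \<open>Rationals and reals of a model\<close>

lemma frac_less_iff:
  fixes a b :: "'q :: linordered_field"
  shows "0 < c \<Longrightarrow> 0 < d \<Longrightarrow> a / c < b / d \<longleftrightarrow> a * d < b * c"
  by (simp add: field_simps)

lemma frac_le_iff:
  fixes a b :: "'q :: linordered_field"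
  shows "0 < c \<Longrightarrow> 0 < d \<Longrightarrow> a / c \<le> b / d \<longleftrightarrow> a * d \<le> b * c"
  by (simp add: field_simps)

lemma below_Q [simp]:
  "below d (rat a b c) \<longleftrightarrow> below d a \<and> below d b \<and> below d c"
  "below d (absQ p) = below d p" "below d (subQ p q) \<longleftrightarrow> below d p \<and> below d q"
  "below d (pow2Q p) = below d p" "below d (realQ p) = below d p" "below d zeroQ"
  by (auto simp: rat_def absQ_def subQ_def pow2Q_def realQ_def pos_def neg_def den_def zeroQ_def)

lemma wt_Q [simp]:
  "wt p \<Longrightarrow> tyof p = T0 \<Longrightarrow> wt (absQ p)" "tyof (absQ p) = T0"
  "\<lbrakk>wt p; wt q; tyof p = T0; tyof q = T0\<rbrakk> \<Longrightarrow> wt (subQ p q)" "tyof (subQ p q) = T0"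
  "\<lbrakk>wt p; wt q; tyof p = T0; tyof q = T0\<rbrakk> \<Longrightarrow> wt (addQ p q)" "tyof (addQ p q) = T0"
  "wt p \<Longrightarrow> tyof p = T0 \<Longrightarrow> wt (pow2Q p)" "tyof (pow2Q p) = T0"
  "wt p \<Longrightarrow> tyof p = T0 \<Longrightarrow> wt (dpow2Q p)" "tyof (dpow2Q p) = T0"
  "wt zeroQ" "tyof zeroQ = T0"
  "wt p \<Longrightarrow> tyof p = T0 \<Longrightarrow> wt (realQ p)" "tyof (realQ p) = T1"
  by (simp_all add: absQ_def subQ_def addQ_def pow2Q_def dpow2Q_def zeroQ_def realQ_def rat_def pos_def neg_def den_def)

lemma fvt_DistC: "fvt DistC = {}"
  by (auto simp: DistC_def absQ_def subQ_def rat_def pos_def neg_def den_def)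

lemma below_DistC [simp]: "below d DistC"
  by (simp add: below_closed fvt_DistC)

lemma DistC_term [simp]: "wt DistC" "tyof DistC = T1 \<leadsto> T1 \<leadsto> T1"
  by (simp_all add: DistC_def)

lemma arith_macros [simp]:
  "arith ((s \<^bold>= t) d)" "arith ((\<^bold>\<not> P) d) = arith (P d)" "arith ((P \<^bold>\<and> Q) d) \<longleftrightarrow> arith (P d) \<and> arith (Q d)"
  "arith ((P \<^bold>\<longrightarrow> Q) d) \<longleftrightarrow> arith (P d) \<and> arith (Q d)"
  "arith (lAll \<tau> F d) \<longleftrightarrow> \<tau> = T0 \<and> arith (F (Var d \<tau>) (Suc d))"
  "arith (lEx \<tau> F d) \<longleftrightarrow> \<tau> = T0 \<and> arith (F (Var d \<tau>) (Suc d))"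
  by (auto simp: lEq_def lNeg_def lCon_def lImp_def lAll_def lEx_def)

lemma wff_macros [simp]:
  "wff ((s \<^bold>= t) d) \<longleftrightarrow> wt s \<and> wt t \<and> tyof s = T0 \<and> tyof t = T0"
  "wff ((\<^bold>\<not> P) d) = wff (P d)" "wff ((P \<^bold>\<and> Q) d) \<longleftrightarrow> wff (P d) \<and> wff (Q d)"
  "wff ((P \<^bold>\<longrightarrow> Q) d) \<longleftrightarrow> wff (P d) \<and> wff (Q d)"
  "wff (lAll \<tau> F d) = wff (F (Var d \<tau>) (Suc d))" "wff (lEx \<tau> F d) = wff (F (Var d \<tau>) (Suc d))"
  by (auto simp: lEq_def lNeg_def lCon_def lImp_def lAll_def lEx_def)

lemma arith_analysis [simp]:
  "arith (ltQ p q d)" "arith (leQ p q d)" "arith (leN s t d)" "arith (isReal x d)"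
  "arith ((x <\<^sub>R y) d)" "arith (inSet x A d)" "arith (inCode x a b d)"
  by (auto simp: ltQ_def leQ_def ltN_def leN_def isReal_def ltR_def inSet_def inCode_def)

lemma wt_Q_parts [simp]:
  "wt q \<Longrightarrow> tyof q = T0 \<Longrightarrow> wt (pos q)" "wt q \<Longrightarrow> tyof q = T0 \<Longrightarrow> wt (neg q)"
  "wt q \<Longrightarrow> tyof q = T0 \<Longrightarrow> wt (den q)" "tyof (pos q) = T0" "tyof (neg q) = T0" "tyof (den q) = T0"
  "\<lbrakk>wt a; wt b; wt c; tyof a = T0; tyof b = T0; tyof c = T0\<rbrakk> \<Longrightarrow> wt (rat a b c)"
  "tyof (rat a b c) = T0"
  by (simp_all add: pos_def neg_def den_def rat_def)

lemma wff_analysis [simp]: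
  "\<lbrakk>wt p; wt q; tyof p = T0; tyof q = T0\<rbrakk> \<Longrightarrow> wff (ltQ p q d)"
  "\<lbrakk>wt p; wt q; tyof p = T0; tyof q = T0\<rbrakk> \<Longrightarrow> wff (leQ p q d)"
  "\<lbrakk>wt p; wt q; tyof p = T0; tyof q = T0\<rbrakk> \<Longrightarrow> wff (leN p q d)"
  "wt x \<Longrightarrow> tyof x = T1 \<Longrightarrow> wff (isReal x d)"
  "\<lbrakk>wt x; wt y; tyof x = T1; tyof y = T1\<rbrakk> \<Longrightarrow> wff ((x <\<^sub>R y) d)"
  "\<lbrakk>wt x; wt A; tyof x = T1; tyof A = T1 \<leadsto> T1\<rbrakk> \<Longrightarrow> wff (inSet x A d)"
  "\<lbrakk>wt x; wt a; wt b; tyof x = T1; tyof a = T0 \<leadsto> T1; tyof b = T0 \<leadsto> T1\<rbrakk> \<Longrightarrow>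
    wff (inCode x a b d)"
  by (simp_all add: ltQ_def leQ_def ltN_def leN_def isReal_def ltR_def inSet_def inCode_def)

section \<open>Order, pairing and powers of two through the valuation\<close>

context valued_model
begin

lemma ti_distrib2: "\<lbrakk>a \<in> N; b \<in> N; n \<in> N\<rbrakk> \<Longrightarrow> ti n (pl a b) = pl (ti n a) (ti n b)"
  using ti_distrib[of a b n] ti_comm[of n] by simp

lemma val_su [simp]: "n \<in> N \<Longrightarrow> val (su n) = val n + 1"
proof -
  assume n: "n \<in> N"
  have "val (pl n (su ze)) = val n + val (su ze)" by (rule val_pl) (use n in auto)
  then show ?thesis using n by (simp add: val_one)
qed

lemma mo_ze_iff [simp]:
  assumes "a \<in> N" "b \<in> N" shows "mo a b = ze \<longleftrightarrow> val a \<le> val b"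
  using pl_total[of b a]
proof
  assume *: "pl a (mo b a) = b"
  then have "val a + val (mo b a) = val b" using assms by (metis arith_dom(9) val_pl)
  moreover have "0 \<le> val (mo b a)" using assms by simp
  moreover have "mo a b = ze" using mo_le[of "mo b a" a] * assms by simp
  ultimately show ?thesis by simp
next
  assume *: "pl b (mo a b) = a"
  then have "val b + val (mo a b) = val a" using assms by (metis arith_dom(9) val_pl)
  moreover have "0 \<le> val (mo a b)" "mo a b = ze \<longleftrightarrow> val (mo a b) = 0"
    using assms val_inj[of "mo a b" ze] by auto
  ultimately show ?thesis by auto
qed (use assms in auto)

lemma val_mo:
  assumes "a \<in> N" "b \<in> N" shows "val (mo a b) = (if val b \<le> val a then val a - val b else 0)"
proof (cases "val a \<le> val b")
  case True
  then have "mo a b = ze" using assms by simp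
  then show ?thesis using True by simp
next
  case False
  then have "pl b (mo a b) = a" using pl_total[of b a] assms
    by (metis arith_dom(9) le_add_same_cancel1 val_nonneg val_pl)
  then have "val b + val (mo a b) = val a" using assms by (metis arith_dom(9) val_pl)
  then show ?thesis using False by auto
qed

text \<open>The order is discrete: the difference \<open>mo b a\<close> is not zero, hence a
  successor, hence of value at least 1.\<close>

lemma val_less:
  assumes "a \<in> N" "b \<in> N" shows "val a + 1 \<le> val b \<longleftrightarrow> val a < val b"
proof
  assume *: "val a < val b"
  then have 1: "pl a (mo b a) = b" using pl_total[of b a] assms
    by (metis arith_dom(9) le_add_same_cancel1 val_nonneg val_pl not_le)
  then have 2: "val a + val (mo b a) = val b" using assms by (metis arith_dom(9) val_pl)
  have "mo b a \<in> N" using assms by simp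
  from N_casesE[OF this] show "val a + 1 \<le> val b"
  proof
    assume "\<exists>m\<in>N. mo b a = su m"
    then obtain m where "m \<in> N" "mo b a = su m" by blast
    then have "val a + (val m + 1) = val b" "0 \<le> val m" using 2 by simp_all
    then show ?thesis by linarith
  qed (use 2 * in auto)
qed auto

lemma val_pos: "n \<in> N \<Longrightarrow> n \<noteq> ze \<Longrightarrow> 0 < val n"
  using val_inj[of n ze] by (simp add: less_le)

lemma val_pd: "n \<in> N \<Longrightarrow> n \<noteq> ze \<Longrightarrow> val (pd n) = val n - 1"
  using N_casesE[of n] by auto

text \<open>The induction needs a formula of the model, which cannot mention the field. Injectivity
  of \<open>val\<close> exchanges the field identity for an equation between numbers.\<close>

lemma val_tri: "n \<in> N \<Longrightarrow> 2 * val (tri n) = val n * (val n + 1)"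
proof (rule arith_induct[where \<phi> = "Eq (Two \<otimes> (TriC \<cdot> nv 0)) (nv 0 \<otimes> (Succ \<cdot> nv 0))"
      and e = env0 and x = 0 and n = n and P = "\<lambda>n. 2 * val (tri n) = val n * (val n + 1)"])
  fix n assume n: "n \<in> N"
  have "ti (su (su ze)) (tri n) = ti n (su n) \<longleftrightarrow>
      val (ti (su (su ze)) (tri n)) = val (ti n (su n))"
    using n by (intro val_inj[symmetric]) auto
  also have "\<dots> \<longleftrightarrow> 2 * val (tri n) = val n * (val n + 1)"
    using n by (simp add: algebra_simps)
  finally show "2 * val (tri n) = val n * (val n + 1) \<longleftrightarrow>
      sat (Eq (Two \<otimes> (TriC \<cdot> nv 0)) (nv 0 \<otimes> (Succ \<cdot> nv 0))) (env0((0, T0) := n))"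
    by (simp del: ti_rec ti_su)
next
  fix n assume "n \<in> N" "2 * val (tri n) = val n * (val n + 1)"
  then show "2 * val (tri (su n)) = val (su n) * (val (su n) + 1)" by (simp add: algebra_simps)
qed auto

lemma tri_mono: "\<lbrakk>a \<in> N; b \<in> N; val a \<le> val b\<rbrakk> \<Longrightarrow> val (tri a) \<le> val (tri b)"
  using val_tri[of a] val_tri[of b] mult_mono[of "val a" "val b" "val a + 1" "val b + 1"] by simp

lemma val_rt: "n \<in> N \<Longrightarrow> val (tri (rt n)) \<le> val n \<and> val n < val (tri (su (rt n)))"
proof (rule arith_induct[where \<phi> = "Con (Eq (TriC \<cdot> (RootC \<cdot> nv 0) \<ominus> nv 0) Zero)
        (Eq (Succ \<cdot> nv 0 \<ominus> TriC \<cdot> (Succ \<cdot> (RootC \<cdot> nv 0))) Zero)"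
      and e = env0 and x = 0 and n = n
      and P = "\<lambda>n. val (tri (rt n)) \<le> val n \<and> val n < val (tri (su (rt n)))"])
  fix n assume n: "n \<in> N"
  then show "(val (tri (rt n)) \<le> val n \<and> val n < val (tri (su (rt n)))) =
      sat (Con (Eq (TriC \<cdot> (RootC \<cdot> nv 0) \<ominus> nv 0) Zero)
        (Eq (Succ \<cdot> nv 0 \<ominus> TriC \<cdot> (Succ \<cdot> (RootC \<cdot> nv 0))) Zero)) (env0((0, T0) := n))"
    using val_less[of n "tri (su (rt n))"] by (simp del: tri_rec)
next
  fix n assume n: "n \<in> N" and IH: "val (tri (rt n)) \<le> val n \<and> val n < val (tri (su (rt n)))"
  \<comment> \<open>The number n + 1 is at most the next triangular number and so stays below the
    one after it; raising the root by at most one therefore suffices.\<close>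
  have *: "val n + 1 \<le> val (tri (su (rt n)))" using IH n val_less[of n "tri (su (rt n))"] by simp
  have **: "val (tri (su (su (rt n)))) > val (tri (su (rt n)))" using n val_nonneg[of "rt n"]
    by (simp add: less_le_not_le add_increasing2 del: val_nonneg)
  show "val (tri (rt (su n))) \<le> val (su n) \<and> val (su n) < val (tri (su (rt (su n))))"
  proof (cases "mo (tri (su (rt n))) (su n) = ze")
    case True
    then have "val (tri (su (rt n))) \<le> val n + 1" using n by (simp del: tri_rec mo_rec)
    then show ?thesis using True * ** n by (simp del: tri_rec mo_rec mo_ze_iff)
  next
    case False
    then have "\<not> val (tri (su (rt n))) \<le> val n + 1" using n by (simp del: tri_rec mo_rec)
    then show ?thesis using False IH n by (simp del: tri_rec mo_rec mo_ze_iff)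
  qed
qed auto

text \<open>With w = a + b, the bound b \<le> w places the code between the triangular numbers of w
  and w + 1. Monotonicity then forces the root to be w, from which b and a are recovered by
  subtraction.\<close>

lemma pairing [simp]:
  assumes "a \<in> N" "b \<in> N" shows "p1 (pr a b) = a" "p2 (pr a b) = b"
proof -
  let ?w = "pl a b" and ?n = "pr a b"
  have n: "?n = pl (tri ?w) b" "?n \<in> N" using assms by (auto simp: pr_eq)
  let ?r = "rt ?n"
  have r: "?r \<in> N" using n by auto
  have w: "val (tri ?w) \<le> val ?n" "val ?n < val (tri (su ?w))"
    using assms n val_nonneg[of a] val_nonneg[of b] by (simp_all del: val_nonneg)
  have "val ?r = val ?w"
  proof (rule linorder_cases[of "val ?r" "val ?w"])
    assume "val ?r < val ?w"
    then have "val (su ?r) \<le> val ?w" using val_less[of ?r ?w] r assms by simp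
    then have "val (tri (su ?r)) \<le> val (tri ?w)" using r assms by (intro tri_mono) auto
    then show ?thesis using w val_rt[of ?n] n by linarith
  next
    assume "val ?w < val ?r"
    then have "val (su ?w) \<le> val ?r" using val_less[of ?w ?r] r assms by simp
    then have "val (tri (su ?w)) \<le> val (tri ?r)" using r assms by (intro tri_mono) auto
    then show ?thesis using w val_rt[of ?n] n by linarith
  qed
  then have rw: "?r = ?w" using val_inj[of ?r ?w] r assms by (simp del: val_pl)
  then show p2: "p2 ?n = b" using assms n mo_pl[of b "tri ?w"] by (simp add: p2_eq)
  show "p1 ?n = a" using assms n p2 rw mo_pl[of a b] by (simp add: p1_eq pl_comm)
qed

text \<open>The value of \<open>pow2Q n\<close>, that is 2 to the power -n, where n may be
  nonstandard.\<close>

definition hp :: "'a \<Rightarrow> 'q" where "hp n = inverse (val (po n))"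

lemma val_po: "n \<in> N \<Longrightarrow> val n < val (po n)"
proof (rule arith_induct[where \<phi> = "Eq (Succ \<cdot> nv 0 \<ominus> Pow2C \<cdot> nv 0) Zero"
      and e = env0 and x = 0 and n = n and P = "\<lambda>n. val n < val (po n)"])
  fix n assume n: "n \<in> N"
  then show "val n < val (po n) \<longleftrightarrow> sat (Eq (Succ \<cdot> nv 0 \<ominus> Pow2C \<cdot> nv 0) Zero) (env0((0, T0) := n))"
    using val_less[of n "po n"] by simp
next
  fix n assume n: "n \<in> N" "val n < val (po n)"
  then have "val n + 1 \<le> val (po n)" using val_less[of n "po n"] by simp
  then show "val (su n) < val (po (su n))" using n val_nonneg[of n] by (simp del: val_nonneg)
qed auto

lemma hp_pos [simp]: "n \<in> N \<Longrightarrow> 0 < hp n"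
  using val_po[of n] val_nonneg[of n] by (simp add: hp_def del: val_nonneg)

lemma po_ne_ze [simp]: "n \<in> N \<Longrightarrow> po n \<noteq> ze"
  using val_po[of n] val_nonneg[of n] by (auto simp del: val_nonneg)

lemma hp_ze [simp]: "hp ze = 1"
  by (simp add: hp_def val_one)

lemma hp_su [simp]: "n \<in> N \<Longrightarrow> hp (su n) = hp n / 2"
  by (simp add: hp_def field_simps)

lemma po_pl: "m \<in> N \<Longrightarrow> n \<in> N \<Longrightarrow> po (pl m n) = ti (po m) (po n)"
  by (rule arith_induct[where \<phi> = "Eq (Pow2C \<cdot> (nv 1 \<oplus> nv 0)) (Pow2C \<cdot> nv 1 \<otimes> Pow2C \<cdot> nv 0)"
      and e = "env0((1, T0) := m)" and x = 0 and P = "\<lambda>n. po (pl m n) = ti (po m) (po n)"])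
    (auto simp: ti_distrib2 ti_comm)

lemma hp_pl: "m \<in> N \<Longrightarrow> n \<in> N \<Longrightarrow> hp (pl m n) = hp m * hp n"
  by (simp add: hp_def po_pl)

lemma po_ge_one: "n \<in> N \<Longrightarrow> 1 \<le> val (po n)"
  using val_less[of ze "po n"] val_pos[of "po n"] by simp

lemma hp_le_one: "n \<in> N \<Longrightarrow> hp n \<le> 1"
  using po_ge_one[of n] by (simp add: hp_def inverse_le_1_iff)

lemma hp_mono: "m \<in> N \<Longrightarrow> n \<in> N \<Longrightarrow> hp (pl m n) \<le> hp m"
  using hp_le_one[of n] hp_pos[of m] by (simp add: hp_pl mult_left_le)

text \<open>A positive fraction with denominator c is at least 1/c, because its numerator is at
  least 1 by discreteness, and 1/c exceeds 2 to the power -c.\<close>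

lemma archimedean:
  assumes "0 < r" shows "\<exists>k\<in>N. hp k < r"
proof -
  obtain a b c where *: "a \<in> N" "b \<in> N" "c \<in> N" "c \<noteq> ze" and r: "r = (val a - val b) / val c"
    using val_fraction[of r] by blast
  have c: "0 < val c" using * val_pos by blast
  have "val b < val a" using assms c r by (simp add: zero_less_divide_iff)
  then have "1 / val c \<le> r" using val_less[of b a] * c r by (simp add: divide_right_mono)
  moreover have "hp c < 1 / val c" using val_po[of c] * c
    unfolding hp_def inverse_eq_divide by (intro divide_strict_left_mono) (auto intro!: mult_pos_pos)
  ultimately show ?thesis using * by (intro bexI[of _ c]) auto
qed

section \<open>Codes of rationals and approximations of reals evaluated in the field\<close>

definition qv :: "'a \<Rightarrow> 'q" where
  "qv c = (val (p1 (p1 c)) - val (p2 (p1 c))) / (val (p2 c) + 1)"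

definition qcode :: "'a \<Rightarrow> 'a \<Rightarrow> 'a \<Rightarrow> 'a" where
  "qcode a b c = pr (pr a b) (pd c)"

lemma qcode_dom [simp]: "\<lbrakk>a \<in> N; b \<in> N; c \<in> N\<rbrakk> \<Longrightarrow> qcode a b c \<in> N"
  by (simp add: qcode_def)

lemma qv_qcode: "\<lbrakk>a \<in> N; b \<in> N; c \<in> N; c \<noteq> ze\<rbrakk> \<Longrightarrow> qv (qcode a b c) = (val a - val b) / val c"
  by (simp add: qv_def qcode_def val_pd)

lemma qv_surj: "\<exists>c\<in>N. qv c = r"
  using val_fraction[of r] qv_qcode qcode_dom by metis

lemma val_add_one_pos [simp]:
  assumes "n \<in> N"
  shows "0 < val n + 1" "0 < 1 + val n" "val n + 1 \<noteq> 0" "1 + val n \<noteq> 0"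
proof -
  have "0 \<le> val n" using assms by simp
  then show "0 < val n + 1" "0 < 1 + val n" "val n + 1 \<noteq> 0" "1 + val n \<noteq> 0" by linarith+
qed

lemma ev_rat [simp]: "ev e (rat a b c) = qcode (ev e a) (ev e b) (ev e c)"
  by (simp add: rat_def qcode_def)

lemma ev_parts [simp]:
  "ev e (pos q) = p1 (p1 (ev e q))" "ev e (neg q) = p2 (p1 (ev e q))" "ev e (den q) = su (p2 (ev e q))"
  by (simp_all add: pos_def neg_def den_def)

lemma sat_ltQ [simp]:
  assumes "ev e p \<in> N" "ev e q \<in> N"
  shows "sat (ltQ p q d) e \<longleftrightarrow> qv (ev e p) < qv (ev e q)"
proof -
  define P Q where "P = ev e p" and "Q = ev e q"
  define A B where "A = pl (ti (p1 (p1 P)) (su (p2 Q))) (ti (p2 (p1 Q)) (su (p2 P)))"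
    and "B = pl (ti (p1 (p1 Q)) (su (p2 P))) (ti (p2 (p1 P)) (su (p2 Q)))"
  have N: "P \<in> N" "Q \<in> N" "A \<in> N" "B \<in> N" using assms by (simp_all add: P_def Q_def A_def B_def)
  have "sat (ltQ p q d) e \<longleftrightarrow> mo (su A) B = ze"
    by (simp add: ltQ_def ltN_def leN_def A_def B_def P_def Q_def del: mo_ze_iff)
  also have "\<dots> \<longleftrightarrow> val A < val B" using N by (simp add: val_less)
  also have "\<dots> \<longleftrightarrow> qv P < qv Q"
    unfolding qv_def using N by (subst frac_less_iff) (auto simp: A_def B_def algebra_simps)
  finally show ?thesis by (simp add: P_def Q_def)
qed

lemma sat_leQ [simp]:
  assumes "ev e p \<in> N" "ev e q \<in> N"
  shows "sat (leQ p q d) e \<longleftrightarrow> qv (ev e p) \<le> qv (ev e q)"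
  unfolding qv_def using assms by (subst frac_le_iff) (auto simp: leQ_def leN_def algebra_simps)

lemma ev_addQ [simp]:
  assumes "ev e p \<in> N" "ev e q \<in> N"
  shows "ev e (addQ p q) \<in> N" "qv (ev e (addQ p q)) = qv (ev e p) + qv (ev e q)"
  using assms by (simp_all add: addQ_def qv_qcode) (simp add: qv_def add_frac_eq algebra_simps)

lemma ev_subQ [simp]:
  assumes "ev e p \<in> N" "ev e q \<in> N"
  shows "ev e (subQ p q) \<in> N" "qv (ev e (subQ p q)) = qv (ev e p) - qv (ev e q)"
  using assms by (simp_all add: subQ_def qv_qcode) (simp add: qv_def diff_frac_eq algebra_simps)

lemma ev_absQ [simp]:
  assumes "ev e p \<in> N"
  shows "ev e (absQ p) \<in> N" "qv (ev e (absQ p)) = \<bar>qv (ev e p)\<bar>"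
  using assms by (simp_all add: absQ_def qv_qcode) (simp add: qv_def val_mo abs_divide)

lemma ev_consts [simp]:
  "ev e zeroQ \<in> N" "qv (ev e zeroQ) = 0"
  "ev e n \<in> N \<Longrightarrow> ev e (pow2Q n) \<in> N" "ev e n \<in> N \<Longrightarrow> qv (ev e (pow2Q n)) = hp (ev e n)"
  "ev e n \<in> N \<Longrightarrow> ev e (dpow2Q n) \<in> N" "ev e n \<in> N \<Longrightarrow> qv (ev e (dpow2Q n)) = 2 * hp (ev e n)"
  by (simp_all add: zeroQ_def pow2Q_def dpow2Q_def qv_qcode hp_def field_simps)

definition rv :: "'a \<Rightarrow> 'a \<Rightarrow> 'q" where "rv x n = qv (x $ n)"

lemma T1_ap [simp]: "x \<in> dom T1 \<Longrightarrow> n \<in> N \<Longrightarrow> x $ n \<in> N"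
  using ap_dom by blast

definition Real :: "'a \<Rightarrow> bool" where
  "Real x \<longleftrightarrow> x \<in> dom T1 \<and> (\<forall>n\<in>N. \<forall>i\<in>N. \<bar>rv x n - rv x (pl n i)\<bar> < hp n)"
lemma Real_dom [simp]: "Real x \<Longrightarrow> x \<in> dom T1"
  by (simp add: Real_def)

lemma ball_Real [simp]: "(\<forall>x\<in>dom T1. Real x \<longrightarrow> P x) = (\<forall>x. Real x \<longrightarrow> P x)"
  and bex_Real [simp]: "(\<exists>x\<in>dom T1. Real x \<and> P x) = (\<exists>x. Real x \<and> P x)"
  using Real_dom by blast+

definition EqR :: "'a \<Rightarrow> 'a \<Rightarrow> bool" where
  "EqR x y = (\<forall>n\<in>N. \<bar>rv x n - rv y n\<bar> \<le> 2 * hp n)"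
definition LtR :: "'a \<Rightarrow> 'a \<Rightarrow> bool" where
  "LtR x y = (\<exists>n\<in>N. rv x n + 2 * hp n < rv y n)"
text \<open>\<open>LtR\<close> unfolded for the distance: the index \<open>su n\<close> is the shift
  in \<open>DistC\<close>, and the error 2 * \<open>hp n\<close> belongs to the comparison.\<close>

definition InBall :: "'a \<Rightarrow> 'a \<Rightarrow> 'a \<Rightarrow> bool" where
  "InBall y x k = (\<exists>n\<in>N. \<bar>rv x (su n) - rv y (su n)\<bar> + 2 * hp n < hp k)"

lemma sat_isReal [simp]:
  "below d x \<Longrightarrow> ev e x \<in> dom T1 \<Longrightarrow> sat (isReal x d) e = Real (ev e x)"
  by (simp add: isReal_def Real_def rv_def cong: ball_cong)

lemma sat_eqR [simp]:
  "\<lbrakk>below d x; below d y; ev e x \<in> dom T1; ev e y \<in> dom T1\<rbrakk> \<Longrightarrow>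
    sat ((x =\<^sub>R y) d) e = EqR (ev e x) (ev e y)"
  by (simp add: eqR_def EqR_def rv_def cong: ball_cong)

lemma sat_ltR [simp]:
  "\<lbrakk>below d x; below d y; ev e x \<in> dom T1; ev e y \<in> dom T1\<rbrakk> \<Longrightarrow>
    sat ((x <\<^sub>R y) d) e = LtR (ev e x) (ev e y)"
  by (simp add: ltR_def LtR_def rv_def cong: bex_cong)

lemma ev_DistC [simp]:
  assumes "x \<in> dom T1" "y \<in> dom T1"
  shows "ev e DistC $ x $ y \<in> dom T1" "n \<in> N \<Longrightarrow> rv (ev e DistC $ x $ y) n = \<bar>rv x (su n) - rv y (su n)\<bar>"
proof -
  have e: "ev e DistC = ev env0 DistC" by (rule ev_closed[OF fvt_DistC])
  have "ev env0 DistC \<in> dom (T1 \<leadsto> T1 \<leadsto> T1)" by (intro ev_domI) auto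
  then show "ev e DistC $ x $ y \<in> dom T1" using assms ap_dom e by metis
  show "n \<in> N \<Longrightarrow> rv (ev e DistC $ x $ y) n = \<bar>rv x (su n) - rv y (su n)\<bar>"
    unfolding e unfolding DistC_def rv_def using assms by simp
qed

lemma realQ_dom: "ev e q \<in> N \<Longrightarrow> ev e (realQ q) \<in> dom T1"
proof -
  assume "ev e q \<in> N"
  moreover have "I (Kc T0 T0) \<in> dom (T0 \<leadsto> T1)" using I_dom(4)[of T0 T0] by simp
  ultimately show ?thesis using ap_dom unfolding realQ_def ev.simps by blast
qed

lemma ev_realQ [simp]:
  "ev e q \<in> N \<Longrightarrow> ev e (realQ q) \<in> dom T1"
  "ev e q \<in> N \<Longrightarrow> n \<in> N \<Longrightarrow> ev e (realQ q) $ n = ev e q"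
  "ev e q \<in> N \<Longrightarrow> n \<in> N \<Longrightarrow> rv (ev e (realQ q)) n = qv (ev e q)"
  using realQ_dom by (simp_all add: realQ_def rv_def K_ap)

lemma sat_inBall [simp]:
  assumes "below d x" "below d y" "below d k" "ev e x \<in> dom T1" "ev e y \<in> dom T1" "ev e k \<in> N"
  shows "sat (inBall y x k d) e = InBall (ev e y) (ev e x) (ev e k)"
  unfolding inBall_def using assms by (subst sat_ltR) (simp_all add: LtR_def InBall_def cong: bex_cong)

end

section \<open>Rational bounds for reals, intervals and balls\<close>

context valued_model
begin

text \<open>The rational bound is an element of the field instead of a code, so that bounds can be
  computed with; \<open>LtR_realQ\<close> translates back.\<close>

definition Gt :: "'q \<Rightarrow> 'a \<Rightarrow> bool" where "Gt q x = (\<exists>n\<in>N. q + 2 * hp n < rv x n)"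
definition Lt :: "'a \<Rightarrow> 'q \<Rightarrow> bool" where "Lt x q = (\<exists>n\<in>N. rv x n + 2 * hp n < q)"

lemma Real_cauchy:
  assumes "Real x" "m \<in> N" "n \<in> N"
  shows "\<bar>rv x m - rv x n\<bar> < hp m + hp n"
proof -
  have *: "\<bar>rv x m - rv x (pl m i)\<bar> < hp m + hp (pl m i)" if "m \<in> N" "i \<in> N" for m i
    using assms(1) that hp_pos[of "pl m i"] unfolding Real_def by (metis add.right_neutral add_strict_mono arith_dom(7))
  from pl_total[of n m] assms show ?thesis
    using *[of m "mo n m"] *[of n "mo m n"] by (auto simp: abs_minus_commute add.commute simp del: hp_pos)
qed

lemma archimedean_hp:
  assumes "0 < r" "0 < c" obtains k where "k \<in> N" "c * hp k < (r :: 'q)"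
proof -
  obtain k where "k \<in> N" "hp k < r / c" using archimedean[of "r / c"] assms by auto
  then show ?thesis using that assms by (simp add: pos_less_divide_eq mult.commute)
qed

text \<open>The slack of 3 errors covers one from the Cauchy condition (as in
  \<open>Gt_elim\<close>) and two from equality of reals (as in \<open>EqR\<close>). Adding the two
  in the definition of \<open>Gt\<close> gives the constant 5.\<close>

lemma Gt_intro:
  assumes "0 < \<epsilon>" "\<And>j. j \<in> N \<Longrightarrow> q + \<epsilon> - 3 * hp j \<le> rv x j" shows "Gt q x"
proof -
  obtain k where "k \<in> N" "5 * hp k < \<epsilon>" using archimedean_hp[of \<epsilon> 5] assms(1) by auto
  then show ?thesis using assms(2)[of k] unfolding Gt_def by (intro bexI[of _ k]) auto
qed

lemma Lt_intro:
  assumes "0 < \<epsilon>" "\<And>j. j \<in> N \<Longrightarrow> rv x j \<le> q - \<epsilon> + 3 * hp j" shows "Lt x q"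
proof -
  obtain k where "k \<in> N" "5 * hp k < \<epsilon>" using archimedean_hp[of \<epsilon> 5] assms(1) by auto
  then show ?thesis using assms(2)[of k] unfolding Lt_def by (intro bexI[of _ k]) auto
qed

text \<open>A strict inequality at one index spreads, by the Cauchy condition, to a uniform positive
  margin at all indices up to the error \<open>hp j\<close>. Bounds of this shape combine by linear
  arithmetic.\<close>

lemma Gt_elim:
  assumes "Gt q x" "Real x"
  obtains \<epsilon> where "0 < \<epsilon>" "\<And>j. j \<in> N \<Longrightarrow> q + \<epsilon> - hp j \<le> rv x j"
proof -
  obtain n where n: "n \<in> N" "q + 2 * hp n < rv x n" using assms(1) unfolding Gt_def by blast
  have "q + (rv x n - 2 * hp n - q) - hp j \<le> rv x j" if "j \<in> N" for j
    using Real_cauchy[OF assms(2) n(1) that] hp_pos[OF n(1)] by (simp add: abs_less_iff del: hp_pos)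
  then show ?thesis using n(2) by (intro that[of "rv x n - 2 * hp n - q"]) auto
qed

lemma Lt_elim:
  assumes "Lt x q" "Real x"
  obtains \<epsilon> where "0 < \<epsilon>" "\<And>j. j \<in> N \<Longrightarrow> rv x j \<le> q - \<epsilon> + hp j"
proof -
  obtain n where n: "n \<in> N" "rv x n + 2 * hp n < q" using assms(1) unfolding Lt_def by blast
  have "rv x j \<le> q - (q - rv x n - 2 * hp n) + hp j" if "j \<in> N" for j
    using Real_cauchy[OF assms(2) n(1) that] hp_pos[OF n(1)] by (simp add: abs_less_iff del: hp_pos)
  then show ?thesis using n(2) by (intro that[of "q - rv x n - 2 * hp n"]) auto
qed

lemma Gt_Lt_less:
  assumes "Gt q x" "Lt x r" "Real x" shows "q < r"
proof -
  obtain \<epsilon> where e: "0 < \<epsilon>" "\<And>j. j \<in> N \<Longrightarrow> q + \<epsilon> - hp j \<le> rv x j" using Gt_elim assms by blast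
  obtain \<delta> where d: "0 < \<delta>" "\<And>j. j \<in> N \<Longrightarrow> rv x j \<le> r - \<delta> + hp j" using Lt_elim assms by blast
  obtain k where "k \<in> N" "2 * hp k < \<epsilon>" using archimedean_hp[of \<epsilon> 2] e(1) by auto
  then show ?thesis using e(2)[of k] d(2)[of k] d(1) by linarith
qed

lemma Gt_EqR:
  assumes "Gt q x" "EqR x y" "Real x" shows "Gt q y"
proof -
  obtain \<epsilon> where e: "0 < \<epsilon>" "\<And>j. j \<in> N \<Longrightarrow> q + \<epsilon> - hp j \<le> rv x j" using Gt_elim assms by blast
  have "q + \<epsilon> - 3 * hp j \<le> rv y j" if "j \<in> N" for j
  proof -
    have "\<bar>rv x j - rv y j\<bar> \<le> 2 * hp j" using assms(2) that unfolding EqR_def by blast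
    then show ?thesis using e(2)[OF that] by linarith
  qed
  then show ?thesis using e(1) by (intro Gt_intro)
qed

lemma Lt_EqR:
  assumes "Lt x q" "EqR x y" "Real x" shows "Lt y q"
proof -
  obtain \<epsilon> where e: "0 < \<epsilon>" "\<And>j. j \<in> N \<Longrightarrow> rv x j \<le> q - \<epsilon> + hp j" using Lt_elim assms by blast
  have "rv y j \<le> q - \<epsilon> + 3 * hp j" if "j \<in> N" for j
  proof -
    have "\<bar>rv x j - rv y j\<bar> \<le> 2 * hp j" using assms(2) that unfolding EqR_def by blast
    then show ?thesis using e(2)[OF that] by linarith
  qed
  then show ?thesis using e(1) by (intro Lt_intro)
qed

lemma EqR_sym: "EqR x y \<Longrightarrow> EqR y x"
  by (simp add: EqR_def abs_minus_commute)

lemma interval_in_ball: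
  assumes "Real x" "K \<in> N"
  obtains a b where "Gt a x" "Lt x b" "\<And>y. \<lbrakk>Real y; Gt a y; Lt y b\<rbrakk> \<Longrightarrow> InBall y x K"
proof -
  \<comment> \<open>Three extra places: for y between \<open>?a\<close> and \<open>?b\<close> the
    approximations at \<open>su m\<close> differ by less than (3/2 + 3 + 1/2) * \<open>hp m\<close>,
    and with the error 2 * \<open>hp m\<close> the total 7 * \<open>hp m\<close> is below 8 *
    \<open>hp m\<close>, the radius.\<close>
  define m where "m = su (su (su K))"
  have m: "m \<in> N" "8 * hp m = hp K" using assms(2) by (auto simp: m_def)
  have p: "0 < hp m" using m by simp
  let ?a = "rv x m - 3 * hp m" and ?b = "rv x m + 3 * hp m"
  have c: "\<bar>rv x m - rv x j\<bar> < hp m + hp j" if "j \<in> N" for j using Real_cauchy assms(1) m(1) that .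
  have "Gt ?a x"
  proof (rule Gt_intro[of "hp m"])
    fix j assume j: "j \<in> N"
    then show "?a + hp m - 3 * hp j \<le> rv x j" using c[OF j] hp_pos[OF j] p by linarith
  qed (rule p)
  moreover have "Lt x ?b"
  proof (rule Lt_intro[of "hp m"])
    fix j assume j: "j \<in> N"
    then show "rv x j \<le> ?b - hp m + 3 * hp j" using c[OF j] hp_pos[OF j] p by linarith
  qed (rule p)
  moreover have "InBall y x K" if y: "Real y" "Gt ?a y" "Lt y ?b" for y
  proof -
    obtain \<epsilon> where e: "0 < \<epsilon>" "\<And>j. j \<in> N \<Longrightarrow> ?a + \<epsilon> - hp j \<le> rv y j" using Gt_elim y by blast
    obtain \<delta> where d: "0 < \<delta>" "\<And>j. j \<in> N \<Longrightarrow> rv y j \<le> ?b - \<delta> + hp j" using Lt_elim y by blast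
    have h: "hp (su m) = hp m / 2" using m by simp
    have "rv x m - rv x (su m) < hp m + hp (su m)" "rv x (su m) - rv x m < hp m + hp (su m)"
      using c[of "su m"] m by (auto simp: abs_less_iff simp del: hp_su)
    then have "rv x (su m) - rv y (su m) + 2 * hp m < hp K" "rv y (su m) - rv x (su m) + 2 * hp m < hp K"
      using e(1) e(2)[OF su_dom[OF m(1)]] d(1) d(2)[OF su_dom[OF m(1)]] h m(2) p by linarith+
    then have "\<bar>rv x (su m) - rv y (su m)\<bar> + 2 * hp m < hp K" by (simp add: abs_if)
    then show ?thesis using m unfolding InBall_def by blast
  qed
  ultimately show ?thesis by (rule that)
qed

lemma ball_in_interval:
  assumes "Real x" "Gt a x" "Lt x b"
  shows "\<exists>K\<in>N. \<forall>y. Real y \<longrightarrow> InBall y x K \<longrightarrow> Gt a y \<and> Lt y b"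
proof -
  obtain \<epsilon> where e: "0 < \<epsilon>" "\<And>j. j \<in> N \<Longrightarrow> a + \<epsilon> - hp j \<le> rv x j" using Gt_elim assms by blast
  obtain \<delta> where d: "0 < \<delta>" "\<And>j. j \<in> N \<Longrightarrow> rv x j \<le> b - \<delta> + hp j" using Lt_elim assms by blast
  \<comment> \<open>Moving by less than \<open>hp K\<close> costs at most half of either margin; the
    other half keeps the inequalities strict.\<close>
  obtain K where K: "K \<in> N" "2 * hp K < min \<epsilon> \<delta>" using archimedean_hp[of "min \<epsilon> \<delta>" 2] e d by auto
  have "Gt a y \<and> Lt y b" if y: "Real y" "InBall y x K" for y
  proof -
    obtain n where n: "n \<in> N" "\<bar>rv x (su n) - rv y (su n)\<bar> + 2 * hp n < hp K"
      using y(2) unfolding InBall_def by blast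
    have h: "hp (su n) = hp n / 2" "0 < hp n" "0 < hp K" using n K by simp_all
    have "a + \<epsilon> / 2 - 3 * hp j \<le> rv y j \<and> rv y j \<le> b - \<delta> / 2 + 3 * hp j" if j: "j \<in> N" for j
      using Real_cauchy[OF y(1) j su_dom[OF n(1)]] n h K(2) e(2)[OF su_dom[OF n(1)]]
        d(2)[OF su_dom[OF n(1)]] hp_pos[OF j] by (simp add: abs_less_iff abs_if del: hp_su hp_pos split: if_splits)
    then show ?thesis using e(1) d(1) Gt_intro[of "\<epsilon> / 2" a y] Lt_intro[of "\<delta> / 2" y b] by auto
  qed
  then show ?thesis using K by blast
qed

section \<open>The five principles in a model\<close>

definition IsSet :: "'a \<Rightarrow> bool" where
  "IsSet A \<longleftrightarrow> A \<in> dom (T1 \<leadsto> T1) \<and> (\<forall>x. Real x \<longrightarrow> Real (A $ x) \<and> \<not> Lt (A $ x) 0) \<and>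
     (\<forall>x. Real x \<longrightarrow> (\<forall>y. Real y \<longrightarrow> EqR x y \<longrightarrow> EqR (A $ x) (A $ y)))"
definition InSet :: "'a \<Rightarrow> 'a \<Rightarrow> bool" where
  "InSet x A = Gt 0 (A $ x)"
definition InInt :: "'a \<Rightarrow> 'a \<Rightarrow> bool" where
  "InInt x A \<longleftrightarrow> InSet x A \<and> (\<exists>k\<in>N. \<forall>y. Real y \<longrightarrow> InBall y x k \<longrightarrow> InSet y A)"
definition InCl :: "'a \<Rightarrow> 'a \<Rightarrow> bool" where
  "InCl x A \<longleftrightarrow> InSet x A \<or>
     (\<forall>k\<in>N. \<exists>y. Real y \<and> InBall y x k \<and> \<not> EqR y x \<and> InSet y A)"
definition InCode :: "'a \<Rightarrow> 'a \<Rightarrow> 'a \<Rightarrow> bool" where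
  "InCode x a b = (\<exists>n\<in>N. LtR (a $ n) x \<and> LtR x (b $ n))"
definition Code :: "'a \<Rightarrow> 'a \<Rightarrow> bool" where
  "Code a b \<longleftrightarrow> (\<forall>n\<in>N. Real (a $ n)) \<and> (\<forall>n\<in>N. Real (b $ n))"

lemma IsSet_dom [simp]: "IsSet A \<Longrightarrow> A \<in> dom (T1 \<leadsto> T1)"
  by (simp add: IsSet_def)

lemma ball_IsSet [simp]: "(\<forall>A\<in>dom (T1 \<leadsto> T1). IsSet A \<longrightarrow> P A) = (\<forall>A. IsSet A \<longrightarrow> P A)"
  and bex_IsSet [simp]: "(\<exists>A\<in>dom (T1 \<leadsto> T1). IsSet A \<and> P A) = (\<exists>A. IsSet A \<and> P A)"
  using IsSet_dom by blast+

lemma T1T1_ap [simp]: "A \<in> dom (T1 \<leadsto> T1) \<Longrightarrow> x \<in> dom T1 \<Longrightarrow> A $ x \<in> dom T1"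
  and T0T1_ap [simp]: "a \<in> dom (T0 \<leadsto> T1) \<Longrightarrow> n \<in> N \<Longrightarrow> a $ n \<in> dom T1"
  using ap_dom by blast+

lemma LtR_realQ [simp]:
  "ev e q \<in> N \<Longrightarrow> LtR (ev e (realQ q)) x = Gt (qv (ev e q)) x"
  "ev e q \<in> N \<Longrightarrow> LtR x (ev e (realQ q)) = Lt x (qv (ev e q))"
  by (simp_all add: LtR_def Gt_def Lt_def cong: bex_cong)

lemma sat_isSet [simp]:
  "below d A \<Longrightarrow> ev e A \<in> dom (T1 \<leadsto> T1) \<Longrightarrow> sat (isSet A d) e = IsSet (ev e A)"
  by (simp add: isSet_def IsSet_def AllR_def cong: ball_cong)

lemma sat_inSet [simp]:
  "\<lbrakk>below d A; below d x; ev e A \<in> dom (T1 \<leadsto> T1); ev e x \<in> dom T1\<rbrakk> \<Longrightarrow>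
    sat (inSet x A d) e = InSet (ev e x) (ev e A)"
  by (simp add: inSet_def InSet_def)

lemma sat_inInterior [simp]:
  "\<lbrakk>below d A; below d x; ev e A \<in> dom (T1 \<leadsto> T1); ev e x \<in> dom T1\<rbrakk> \<Longrightarrow>
    sat (inInterior x A d) e = InInt (ev e x) (ev e A)"
  by (simp add: inInterior_def InInt_def AllR_def cong: ball_cong bex_cong)

lemma sat_inClosure [simp]:
  "\<lbrakk>below d A; below d x; ev e A \<in> dom (T1 \<leadsto> T1); ev e x \<in> dom T1\<rbrakk> \<Longrightarrow>
    sat (inClosure x A d) e = InCl (ev e x) (ev e A)"
  by (simp add: inClosure_def limitPoint_def InCl_def ExR_def cong: ball_cong bex_cong)

lemma sat_inCode [simp]:
  "\<lbrakk>below d a; below d b; below d x; ev e a \<in> dom (T0 \<leadsto> T1); ev e b \<in> dom (T0 \<leadsto> T1);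
    ev e x \<in> dom T1\<rbrakk> \<Longrightarrow> sat (inCode x a b d) e = InCode (ev e x) (ev e a) (ev e b)"
  by (simp add: inCode_def InCode_def cong: bex_cong)

definition OpenCode :: "'a \<Rightarrow> bool" where
  "OpenCode U = (\<exists>a\<in>dom (T0 \<leadsto> T1). \<exists>b\<in>dom (T0 \<leadsto> T1). Code a b \<and>
     (\<forall>x. Real x \<longrightarrow> InSet x U = InCode x a b))"
definition ClosedCode :: "'a \<Rightarrow> bool" where
  "ClosedCode C = (\<exists>a\<in>dom (T0 \<leadsto> T1). \<exists>b\<in>dom (T0 \<leadsto> T1). Code a b \<and>
     (\<forall>x. Real x \<longrightarrow> (\<not> InSet x C) = InCode x a b))"
definition Interior :: "'a \<Rightarrow> 'a \<Rightarrow> bool" where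
  "Interior U X \<longleftrightarrow> IsSet U \<and> (\<forall>x. Real x \<longrightarrow> InSet x U = InInt x X)"
definition Closure :: "'a \<Rightarrow> 'a \<Rightarrow> bool" where
  "Closure C X \<longleftrightarrow> IsSet C \<and> (\<forall>x. Real x \<longrightarrow> InSet x C = InCl x X)"

text \<open>The flag lets the passage between interior and closure be proved once for the plain and
  the coded versions.\<close>

definition InteriorP :: "bool \<Rightarrow> bool" where
  "InteriorP coded = (\<forall>X. IsSet X \<longrightarrow> (\<exists>U. Interior U X \<and> (coded \<longrightarrow> OpenCode U)))"
definition ClosureP :: "bool \<Rightarrow> bool" where
  "ClosureP coded = (\<forall>X. IsSet X \<longrightarrow> (\<exists>C. Closure C X \<and> (coded \<longrightarrow> ClosedCode C)))"

lemma sat_hasOpenCode [simp]: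
  "below d U \<Longrightarrow> ev e U \<in> dom (T1 \<leadsto> T1) \<Longrightarrow> sat (hasOpenCode U d) e = OpenCode (ev e U)"
  by (simp add: hasOpenCode_def OpenCode_def Code_def AllR_def conj_assoc cong: ball_cong bex_cong)

lemma sat_hasClosedCode [simp]:
  "below d U \<Longrightarrow> ev e U \<in> dom (T1 \<leadsto> T1) \<Longrightarrow> sat (hasClosedCode U d) e = ClosedCode (ev e U)"
  by (simp add: hasClosedCode_def ClosedCode_def Code_def AllR_def conj_assoc cong: ball_cong bex_cong)

lemma sat_principles:
  "sat BOOT e \<longleftrightarrow> (\<forall>Y\<in>dom (T1 \<leadsto> T0 \<leadsto> T0). \<exists>X\<in>dom T1. (\<forall>n\<in>N. X $ n = ze \<or> X $ n = su ze) \<and>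
     (\<forall>n\<in>N. X $ n = su ze \<longleftrightarrow> (\<exists>f\<in>dom T1. Y $ f $ n = ze)))"
  "sat INTERIOR e = InteriorP False" "sat INTERIOR_CODE e = InteriorP True"
  "sat CLOSURE e = ClosureP False" "sat CLOSURE_CODE e = ClosureP True"
  by (simp_all add: BOOT_def INTERIOR_def INTERIOR_CODE_def CLOSURE_def CLOSURE_CODE_def
      AllSet_def ExSet_def AllR_def InteriorP_def ClosureP_def Interior_def Closure_def isInteriorOf_def isClosureOf_def conj_assoc
      cong: ball_cong bex_cong)

section \<open>Arithmetical comprehension for sets of reals, complements and closures\<close>

lemma set_comprehension:
  assumes \<phi>: "arith \<phi>" "wff \<phi>" and e: "std_env e"
    and P: "\<And>x. Real x \<Longrightarrow> P x \<longleftrightarrow> sat \<phi> (e((0, T1) := x))"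
    and ext: "\<And>x y. \<lbrakk>Real x; Real y; EqR x y\<rbrakk> \<Longrightarrow> P x = P y"
  shows "\<exists>U. IsSet U \<and> (\<forall>x. Real x \<longrightarrow> InSet x U = P x)"
proof -
  \<comment> \<open>The representation function takes the constant reals 1 and 0 as values, selected
    by the characteristic term; \<open>ext\<close> is what makes it respect equality of
    reals.\<close>
  let ?q = "rat (CaseC \<cdot> charterm \<phi> \<cdot> One \<cdot> Zero) Zero One"
  define U where "U = ev e (lam 0 T1 (realQ ?q))"
  have U: "U \<in> dom (T1 \<leadsto> T1)" unfolding U_def using \<phi> e by (intro ev_lam_dom) auto
  have val: "rv (U $ x) n = (if P x then 1 else 0)" if "Real x" "n \<in> N" for x n
  proof -
    let ?e = "e((0, T1) := x)"
    have e': "std_env ?e" using e that by simp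
    then have c: "ev ?e (charterm \<phi>) \<in> N" using \<phi> by (intro ev_domI) auto
    have "U $ x = ev ?e (realQ ?q)" unfolding U_def using that e \<phi> by simp
    moreover have "qv (ev ?e ?q) = (if P x then 1 else 0)" "ev ?e ?q \<in> N"
      using c charterm[OF \<phi> e'] P[OF that(1)] by (simp_all add: qv_qcode val_one)
    ultimately show ?thesis using that by (simp del: ev_rat)
  qed
  have "Gt 0 (U $ x) = P x" if "Real x" for x
  proof
    assume "P x"
    \<comment> \<open>The index 2 is the least one at which the error 2 * \<open>hp n\<close> is
      below the value 1.\<close>
    have "2 * hp (su (su ze)) < 1" by simp
    then show "Gt 0 (U $ x)" unfolding Gt_def using val[OF that] \<open>P x\<close>
      by (intro bexI[of _ "su (su ze)"]) auto
  next
    assume "Gt 0 (U $ x)"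
    then obtain n where "n \<in> N" "2 * hp n < rv (U $ x) n" unfolding Gt_def by auto
    then show "P x" using val[OF that] hp_pos[of n] by (auto split: if_splits simp del: hp_pos)
  qed
  moreover have "\<not> Lt (U $ x) 0" if "Real x" for x
  proof
    assume "Lt (U $ x) 0"
    then obtain n where "n \<in> N" "rv (U $ x) n + 2 * hp n < 0" unfolding Lt_def by auto
    then show False using val[OF that] hp_pos[of n] by (auto split: if_splits simp del: hp_pos)
  qed
  moreover have "Real (U $ x)" if "Real x" for x
    unfolding Real_def using val[OF that] U that by simp
  moreover have "EqR (U $ x) (U $ y)" if "Real x" "Real y" "EqR x y" for x y
    unfolding EqR_def using val ext that by (auto simp: less_imp_le)
  ultimately show ?thesis using U unfolding IsSet_def InSet_def by (intro exI[of _ U]) auto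
qed

lemma InSet_EqR:
  "\<lbrakk>IsSet A; Real x; Real y; EqR x y\<rbrakk> \<Longrightarrow> InSet x A = InSet y A"
  unfolding InSet_def IsSet_def using Gt_EqR EqR_sym by metis

lemma complement:
  assumes "IsSet X" shows "\<exists>X'. IsSet X' \<and> (\<forall>x. Real x \<longrightarrow> InSet x X' = (\<not> InSet x X))"
proof (rule set_comprehension)
  let ?\<phi> = "(\<^bold>\<not> inSet (Var 0 T1) (Var 0 (T1 \<leadsto> T1))) 1" and ?e = "env0((0, T1 \<leadsto> T1) := X)"
  show "arith ?\<phi>" "wff ?\<phi>" by simp_all
  show "std_env ?e" using assms by simp
  show "(\<not> InSet x X) \<longleftrightarrow> sat ?\<phi> (?e((0, T1) := x))" if "Real x" for x
    using assms that by simp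
qed (use InSet_EqR assms in blast)

text \<open>A point of X near x that equals x puts x itself into X by \<open>InSet_EqR\<close>,
  which is the other disjunct. So the clause that the two points differ is absorbed, and duality of
  the quantifiers does the rest.\<close>

lemma closure_iff_interior:
  assumes "Real x" "IsSet X" and X': "\<forall>x. Real x \<longrightarrow> InSet x X' = (\<not> InSet x X)"
  shows "InCl x X \<longleftrightarrow> \<not> InInt x X'"
proof -
  have "InCl x X \<longleftrightarrow> InSet x X \<or> (\<forall>k\<in>N. \<exists>y. Real y \<and> InBall y x k \<and> InSet y X)"
    unfolding InCl_def using InSet_EqR[OF assms(2)] assms(1) by blast
  then show ?thesis unfolding InInt_def using X' assms(1) by blast
qed

text \<open>Complements are taken before and after. A closed code is an open code of the complement,
  so the same intervals serve on both sides.\<close>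

lemma interior_imp_closure: "InteriorP coded \<Longrightarrow> ClosureP coded"
  unfolding ClosureP_def
proof (intro allI impI)
  fix X assume int: "InteriorP coded" and X: "IsSet X"
  obtain X' where X': "IsSet X'" "\<forall>x. Real x \<longrightarrow> InSet x X' = (\<not> InSet x X)"
    using complement[OF X] by blast
  obtain U where U: "Interior U X'" "coded \<longrightarrow> OpenCode U" using int X' unfolding InteriorP_def by blast
  then obtain C where C: "IsSet C" "\<forall>x. Real x \<longrightarrow> InSet x C = (\<not> InSet x U)"
    using complement[of U] unfolding Interior_def by blast
  have "Closure C X" unfolding Closure_def
    using C U closure_iff_interior[OF _ X X'(2)] unfolding Interior_def by simp
  moreover have "coded \<longrightarrow> ClosedCode C" using U C unfolding OpenCode_def ClosedCode_def by simp
  ultimately show "\<exists>C. Closure C X \<and> (coded \<longrightarrow> ClosedCode C)" by blast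
qed

lemma closure_imp_interior: "ClosureP coded \<Longrightarrow> InteriorP coded"
  unfolding InteriorP_def
proof (intro allI impI)
  fix X assume cl: "ClosureP coded" and X: "IsSet X"
  obtain X' where X': "IsSet X'" "\<forall>x. Real x \<longrightarrow> InSet x X' = (\<not> InSet x X)"
    using complement[OF X] by blast
  then have X'': "\<forall>x. Real x \<longrightarrow> InSet x X = (\<not> InSet x X')" by simp
  obtain C where C: "Closure C X'" "coded \<longrightarrow> ClosedCode C" using cl X' unfolding ClosureP_def by blast
  then obtain U where U: "IsSet U" "\<forall>x. Real x \<longrightarrow> InSet x U = (\<not> InSet x C)"
    using complement[of C] unfolding Closure_def by blast
  have "Interior U X" unfolding Interior_def
    using C U closure_iff_interior[OF _ X'(1) X''] unfolding Closure_def by simp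
  moreover have "coded \<longrightarrow> OpenCode U" using U C unfolding OpenCode_def ClosedCode_def by simp
  ultimately show "\<exists>U. Interior U X \<and> (coded \<longrightarrow> OpenCode U)" by blast
qed

section \<open>From BOOT to interiors with a code\<close>

lemma boot_imp_interior_code:
  assumes "sat BOOT e" shows "InteriorP True"
  unfolding InteriorP_def
proof (intro allI impI)
  fix X assume X: "IsSet X"
  define e1 where "e1 = env0((0, T1 \<leadsto> T1) := X)"
  have e1: "std_env e1" "e1 (0, T1 \<leadsto> T1) = X" using X by (auto simp: e1_def)
  \<comment> \<open>The number n codes a pair of rational endpoints, and Y(f, n) = 0 says that f is
    a real in that interval outside X. BOOT thus decides which intervals contain such a
    point.\<close>
  let ?\<phi> = "(isReal (Var 0 T1) \<^bold>\<and> (realQ (pfst (nv 0)) <\<^sub>R Var 0 T1) \<^bold>\<and>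
    (Var 0 T1 <\<^sub>R realQ (psnd (nv 0))) \<^bold>\<and> (\<^bold>\<not> inSet (Var 0 T1) (Var 0 (T1 \<leadsto> T1)))) 1"
  define Y where "Y = ev e1 (lam 0 T1 (lam 0 T0 (charterm ?\<phi>)))"
  have \<phi>: "arith ?\<phi>" "wff ?\<phi>" by simp_all
  have Y_iff: "Y $ f $ n = ze \<longleftrightarrow> Real f \<and> Gt (qv (p1 n)) f \<and> Lt f (qv (p2 n)) \<and> \<not> InSet f X"
    if "f \<in> dom T1" "n \<in> N" for f n
  proof -
    have "std_env (e1((0, T1) := f, (0, T0) := n))" using e1 that by simp
    from charterm[OF \<phi> this] show ?thesis unfolding Y_def using that e1 X by simp
  qed
  have "Y \<in> dom (T1 \<leadsto> T0 \<leadsto> T0)" unfolding Y_def using e1 by (intro ev_lam_dom) simp_all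
  with assms obtain B where B: "B \<in> dom T1" "\<And>n. n \<in> N \<Longrightarrow> B $ n = ze \<or> B $ n = su ze"
    "\<And>n. n \<in> N \<Longrightarrow> B $ n = su ze \<longleftrightarrow> (\<exists>f\<in>dom T1. Y $ f $ n = ze)"
    unfolding sat_principles by metis
  define good where "good n = (\<forall>f. Real f \<longrightarrow> Gt (qv (p1 n)) f \<longrightarrow> Lt f (qv (p2 n)) \<longrightarrow> InSet f X)" for n
  have good: "B $ n = ze \<longleftrightarrow> good n" if "n \<in> N" for n
  proof -
    have "good n \<longleftrightarrow> B $ n \<noteq> su ze" unfolding B(3)[OF that] good_def using Y_iff[OF _ that] by auto
    then show ?thesis using B(2)[OF that] by auto
  qed
  define e2 where "e2 = env0((0, T1) := B)"
  have e2: "good_env e2" "e2 (0, T1) = B" using B by (auto simp: e2_def)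
  \<comment> \<open>The factor 1 - B(n) is 1 for an interval contained in X and 0 otherwise. In the
    latter case both endpoint codes become the code 0, so the interval is empty and the sequences
    stay total.\<close>
  define a b where "a = ev e2 (lam 0 T0 (realQ (pfst (nv 0) \<otimes> (One \<ominus> Var 0 T1 \<cdot> nv 0))))"
    and "b = ev e2 (lam 0 T0 (realQ (psnd (nv 0) \<otimes> (One \<ominus> Var 0 T1 \<cdot> nv 0))))"
  have ab: "a \<in> dom (T0 \<leadsto> T1)" "b \<in> dom (T0 \<leadsto> T1)"
    unfolding a_def b_def using e2 by (auto intro!: ev_lam_dom)
  have rv_ab: "rv (a $ n) m = qv (if good n then p1 n else ze) \<and> rv (b $ n) m = qv (if good n then p2 n else ze)"
    if "n \<in> N" "m \<in> N" for n m
  proof -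
    have "B $ n = (if good n then ze else su ze)" using B(2) good that by auto
    then show ?thesis using that e2 B(1) unfolding a_def b_def by simp
  qed
  have code: "Code a b" unfolding Code_def Real_def using rv_ab ab by simp
  have in_code: "InCode x a b = (\<exists>n\<in>N. good n \<and> Gt (qv (p1 n)) x \<and> Lt x (qv (p2 n)))" if x: "Real x" for x
  proof -
    have "LtR (a $ n) x \<and> LtR x (b $ n) \<longleftrightarrow>
        Gt (qv (if good n then p1 n else ze)) x \<and> Lt x (qv (if good n then p2 n else ze))" if "n \<in> N" for n
      unfolding LtR_def Gt_def Lt_def using rv_ab[OF that] by (simp cong: bex_cong)
    moreover have "\<not> (Gt q x \<and> Lt x q)" for q using Gt_Lt_less[OF _ _ x, of q q] by blast
    ultimately show ?thesis unfolding InCode_def by auto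
  qed
  have "\<exists>U. IsSet U \<and> (\<forall>x. Real x \<longrightarrow> InSet x U = InCode x a b)"
  proof (rule set_comprehension)
    let ?\<phi> = "inCode (Var 0 T1) (Var 0 (T0 \<leadsto> T1)) (Var 1 (T0 \<leadsto> T1)) 2"
    let ?e = "env0((0, T0 \<leadsto> T1) := a, (1, T0 \<leadsto> T1) := b)"
    show "arith ?\<phi>" "wff ?\<phi>" "std_env ?e" using ab by simp_all
    show "InCode x a b \<longleftrightarrow> sat ?\<phi> (?e((0, T1) := x))" if "Real x" for x
      using that ab by simp
  qed (use in_code Gt_EqR Lt_EqR EqR_sym in metis)
  then obtain U where U: "IsSet U" "\<forall>x. Real x \<longrightarrow> InSet x U = InCode x a b"
    by blast
  have "InCode x a b = InInt x X" if x: "Real x" for x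
  proof
    assume "InCode x a b"
    then obtain n where n: "n \<in> N" "good n" "Gt (qv (p1 n)) x" "Lt x (qv (p2 n))" using in_code x by blast
    then show "InInt x X" using ball_in_interval[OF x n(3,4)] x unfolding good_def InInt_def by blast
  next
    assume "InInt x X"
    then obtain k where k: "k \<in> N" "\<forall>y. Real y \<longrightarrow> InBall y x k \<longrightarrow> InSet y X" unfolding InInt_def by blast
    obtain s t where st: "Gt s x" "Lt x t" "\<And>y. \<lbrakk>Real y; Gt s y; Lt y t\<rbrakk> \<Longrightarrow> InBall y x k"
      using interval_in_ball[OF x k(1)] by blast
    \<comment> \<open>Every field element has a code, so the interval found inside the ball is among
      those tested, at the index \<open>pr u v\<close>.\<close>
    obtain u v where uv: "u \<in> N" "v \<in> N" "qv u = s" "qv v = t" using qv_surj by metis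
    then have "good (pr u v)" unfolding good_def using st k by simp
    then show "InCode x a b" using uv st in_code[OF x] by (auto intro!: bexI[of _ "pr u v"])
  qed
  then show "\<exists>U. Interior U X \<and> (True \<longrightarrow> OpenCode U)"
    using U ab code unfolding Interior_def OpenCode_def by (intro exI[of _ U]) auto
qed

end

section \<open>Coding functions by the tails of base-4 expansions\<close>

abbreviation quad :: "tm \<Rightarrow> tm" where "quad p \<equiv> p \<oplus> p \<oplus> (p \<oplus> p)"

text \<open>The digit of \<open>x\<close> at place \<open>4\<^sup>-\<^sup>m\<^sup>-\<^sup>2\<close> is 1, where the digits 0 and 1 are the only ones of
  interest: \<open>4 p + 1/2 < 4\<^sup>m\<^sup>+\<^sup>2 x < 4 p + 2\<close> for some \<open>p\<close>.\<close>

definition digit :: "tm \<Rightarrow> tm \<Rightarrow> lfm" where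
  "digit x m = (\<^bold>\<exists>p:T0.
     (realQ (rat (quad p \<oplus> quad p \<oplus> One) Zero (Pow2C \<cdot> (Succ \<cdot> (Succ \<cdot> (Succ \<cdot> (Succ \<cdot> (Succ \<cdot> (m \<oplus> m)))))))) <\<^sub>R x) \<^bold>\<and>
     (x <\<^sub>R realQ (rat (quad p \<oplus> Two) Zero (Pow2C \<cdot> (Succ \<cdot> (Succ \<cdot> (Succ \<cdot> (Succ \<cdot> (m \<oplus> m)))))))))"

text \<open>The places \<open>pair (pair i j) l\<close> are reserved for the statement f(i) = j.
  Since only large l count, changing finitely many digits does not affect the decoded
  function.\<close>

definition decodes :: "tm \<Rightarrow> tm \<Rightarrow> tm \<Rightarrow> lfm" where
  "decodes x i j = (\<^bold>\<exists>k:T0. \<^bold>\<forall>l:T0. leN k l \<^bold>\<longrightarrow> digit x (pair (pair i j) l))"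

context valued_model
begin

text \<open>The thresholds of \<open>digit\<close> in the field: \<open>hp (pl m m) / 16\<close> is
  4 to the power -m-2, and (8p + 1)/32 equals (4p + 1/2)/16.\<close>

definition Digit :: "'a \<Rightarrow> 'a \<Rightarrow> bool" where
  "Digit x m = (\<exists>p\<in>N. Gt ((8 * val p + 1) * (hp (pl m m) / 32)) x \<and>
     Lt x ((4 * val p + 2) * (hp (pl m m) / 16)))"

definition Decodes :: "'a \<Rightarrow> 'a \<Rightarrow> 'a \<Rightarrow> bool" where
  "Decodes x i j = (\<exists>k\<in>N. \<forall>l\<in>N. val k \<le> val l \<longrightarrow> Digit x (pr (pr i j) l))"

lemma qv_dyadic: "a \<in> N \<Longrightarrow> t \<in> N \<Longrightarrow> qv (qcode a ze (po t)) = val a * hp t"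
  by (simp add: qv_qcode hp_def field_simps)

lemma sat_digit [simp]:
  assumes "below d x" "below d m" "ev e x \<in> dom T1" "ev e m \<in> N"
  shows "sat (digit x m d) e = Digit (ev e x) (ev e m)"
  unfolding digit_def Digit_def using assms
  by (simp add: qv_dyadic algebra_simps del: po_rec pl_rec cong: bex_cong)

lemma sat_leN [simp]:
  "ev e s \<in> N \<Longrightarrow> ev e t \<in> N \<Longrightarrow> sat (leN s t d) e \<longleftrightarrow> val (ev e s) \<le> val (ev e t)"
  by (simp add: leN_def)

lemma sat_decodes [simp]:
  assumes "below d x" "below d i" "below d j" "ev e x \<in> dom T1" "ev e i \<in> N" "ev e j \<in> N"
  shows "sat (decodes x i j d) e = Decodes (ev e x) (ev e i) (ev e j)"
  unfolding decodes_def Decodes_def using assms by (simp cong: bex_cong ball_cong)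

lemma arith_decodes [simp]: "arith (decodes x i j d)"
  by (simp add: decodes_def digit_def)

lemma wff_decodes [simp]:
  "\<lbrakk>wt x; wt i; wt j; tyof x = T1; tyof i = T0; tyof j = T0\<rbrakk> \<Longrightarrow> wff (decodes x i j d)"
  by (simp add: decodes_def digit_def)

lemma Decodes_EqR:
  assumes "Real x" "Real y" "EqR x y" shows "Decodes x i j = Decodes y i j"
proof -
  have "Gt q x = Gt q y" "Lt x q = Lt y q" for q
    using assms Gt_EqR Lt_EqR EqR_sym by blast+
  then show ?thesis unfolding Decodes_def Digit_def by simp
qed

text \<open>For each i a function is formed that vanishes at j iff \<open>Decodes x i j\<close>, and
  the search operator is applied to it. Equal reals yield the same function by extensionality, hence
  the same value. If the decoded relation is the graph of f, the zero found can only be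
  f(i).\<close>

lemma decoder_exists:
  "\<exists>dec\<in>dom (T1 \<leadsto> T1).
     (\<forall>x y. Real x \<longrightarrow> Real y \<longrightarrow> EqR x y \<longrightarrow> dec $ x = dec $ y) \<and>
     (\<forall>x\<in>dom T1. \<forall>f\<in>dom T1. (\<forall>i\<in>N. \<forall>j\<in>N. Decodes x i j = (f $ i = j)) \<longrightarrow> dec $ x = f)"
proof -
  let ?\<phi> = "decodes (Var 0 T1) (nv 0) (nv 1) 2"
  let ?s = "lam 1 T0 (CaseC \<cdot> charterm ?\<phi> \<cdot> Zero \<cdot> One)"
  define dec where "dec = ev env0 (lam 0 T1 (lam 0 T0 (Var 0 T2 \<cdot> ?s)))"
  define s where "s x i = ev (env0((0, T1) := x, (0, T0) := i)) ?s" for x i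
  have dec: "dec \<in> dom (T1 \<leadsto> T1)" unfolding dec_def by (intro ev_lam_dom) simp_all
  have s: "s x i \<in> dom T1" if "x \<in> dom T1" "i \<in> N" for x i
    unfolding s_def using that by (intro ev_lam_dom) simp_all
  have dec_s: "dec $ x $ i = MU $ s x i" if "x \<in> dom T1" "i \<in> N" for x i
    unfolding dec_def s_def using that by (simp add: env0_def MU(1) EQD(1) del: std_good)
  have s_ap: "s x i $ j = (if Decodes x i j then ze else su ze)" if "x \<in> dom T1" "i \<in> N" "j \<in> N" for x i j
  proof -
    let ?e = "env0((0, T1) := x, (0, T0) := i, (1, T0) := j)"
    have e: "std_env ?e" using that by simp
    have "ev ?e (charterm ?\<phi>) \<in> N" using e by (intro ev_domI) auto
    moreover have "ev ?e (charterm ?\<phi>) = ze \<longleftrightarrow> Decodes x i j"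
      using charterm[OF _ _ e, of ?\<phi>] that by simp
    ultimately show ?thesis unfolding s_def using that by simp
  qed
  have "dec $ x = dec $ y" if "Real x" "Real y" "EqR x y" for x y
  proof (rule dom_ext[where \<rho> = T0 and \<tau> = T0])
    fix i assume i: "i \<in> N"
    have "s x i = s y i"
      by (rule dom_ext[where \<rho> = T0 and \<tau> = T0]) (use that i s s_ap Decodes_EqR in auto)
    then show "dec $ x $ i = dec $ y $ i" using dec_s that i by simp
  qed (use dec that in auto)
  moreover have "dec $ x = f" if "x \<in> dom T1" "f \<in> dom T1" "\<forall>i\<in>N. \<forall>j\<in>N. Decodes x i j = (f $ i = j)" for x f
  proof (rule dom_ext[where \<rho> = T0 and \<tau> = T0])
    fix i assume i: "i \<in> N"
    have fi: "f $ i \<in> N" using that(2) i by simp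
    then have "s x i $ (f $ i) = ze" using s_ap[OF that(1) i fi] that(3) i by auto
    then have *: "s x i $ (MU $ s x i) = ze" using MU(2)[OF s[OF that(1) i] fi] by simp
    have mu: "MU $ s x i \<in> N" using ap_dom[OF MU(1) s[OF that(1) i]] .
    have "Decodes x i (MU $ s x i)" using * s_ap[OF that(1) i mu] by (simp split: if_splits)
    then have "f $ i = MU $ s x i" using that(3) i mu by blast
    then show "dec $ x $ i = f $ i" using dec_s[OF that(1) i] by simp
  qed (use dec that(1,2) in simp_all)
  ultimately show ?thesis using dec by blast
qed

text \<open>The real is n + 1/2 plus the sum of 4 to the power -m-2 over the places m with
  \<open>G m\<close>. Starting at place k keeps it within the ball of radius 2 to the power
  -k.\<close>

lemma encoding_exists:
  assumes f: "f \<in> dom T1" and n: "n \<in> N" and k: "k \<in> N"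
  shows "\<exists>x. Real x \<and> Gt (val n) x \<and> Lt x (val n + 1) \<and>
    (\<exists>m\<in>N. \<bar>val n + 1/2 - rv x (su m)\<bar> + 2 * hp m < hp k) \<and>
    (\<forall>i\<in>N. \<forall>j\<in>N. Decodes x i j = (f $ i = j))"
proof -
  define G where "G m \<longleftrightarrow> val k \<le> val m \<and> f $ p1 (p1 m) = p2 (p1 m)" for m
  let ?\<phi> = "Con (leN (nv 0) (nv 1) 2) (Eq (Var 0 T1 \<cdot> pfst (pfst (nv 1))) (psnd (pfst (nv 1))))"
  define g where "g = ev (env0((0, T1) := f, (0, T0) := k)) (lam 1 T0 (CaseC \<cdot> charterm ?\<phi> \<cdot> One \<cdot> Zero))"
  have \<phi>: "arith ?\<phi>" "wff ?\<phi>" by simp_all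
  have g: "g \<in> dom T1" unfolding g_def using \<phi> f k by (intro ev_lam_dom) simp_all
  have g_ap: "g $ m = (if G m then su ze else ze)" if "m \<in> N" for m
  proof -
    let ?e = "env0((0, T1) := f, (0, T0) := k, (1, T0) := m)"
    have e: "std_env ?e" using that f k by simp
    have "ev ?e (charterm ?\<phi>) \<in> N" using e by (intro ev_domI) auto
    moreover have "ev ?e (charterm ?\<phi>) = ze \<longleftrightarrow> G m"
      using charterm[OF \<phi> e] that f k unfolding G_def by simp
    ultimately show ?thesis unfolding g_def using that f k \<phi> by simp
  qed
  \<comment> \<open>Numerators by Horner's scheme: the j-th approximation is A(j) times 4 to the
    power -j-1. The start 4n + 2 is the numerator of n + 1/2 over 4.\<close>
  let ?A = "Rec \<cdot> nv 1 \<cdot> (quad (nv 0) \<oplus> Two) \<cdot> lam0 2 (lam0 3 (quad (nv 2) \<oplus> Var 0 T1 \<cdot> nv 3))"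
  let ?e = "env0((0, T1) := g, (0, T0) := n)"
  define A where "A m = ev (?e((1, T0) := m)) ?A" for m
  have A_dom: "A m \<in> N" if "m \<in> N" for m
    unfolding A_def using that g n by (intro ev_domI) simp_all
  have A_ze: "val (A ze) = 4 * val n + 2"
    unfolding A_def using g n by simp
  have A_su: "val (A (su m)) = 4 * val (A m) + val (g $ m)" if "m \<in> N" for m
  proof -
    have "A (su m) = pl (pl (pl (A m) (A m)) (pl (A m) (A m))) (g $ m)"
      unfolding A_def using that g n by simp
    then show ?thesis using A_dom[OF that] g that by simp
  qed
  define x where "x = ev ?e (lam0 1 (rat ?A Zero (Pow2C \<cdot> (Succ \<cdot> (Succ \<cdot> (nv 1 \<oplus> nv 1))))))"
  have x: "x \<in> dom T1" unfolding x_def using g n by (intro ev_lam_dom) simp_all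
  define u where "u j = hp (pl j j) / 4" for j
  have u_pos: "0 < u j" if "j \<in> N" for j using that by (simp add: u_def)
  have u_su: "u (su j) = u j / 4" if "j \<in> N" for j using that by (simp add: u_def)
  have u_hp: "u j \<le> hp j / 4" if "j \<in> N" for j using that hp_mono[of j j] by (simp add: u_def)
  have rv_x: "rv x j = val (A j) * u j" if "j \<in> N" for j
  proof -
    have "x $ j = qcode (A j) ze (po (su (su (pl j j))))"
      unfolding x_def A_def using that g n by simp
    then show ?thesis using A_dom that by (simp add: rv_def qv_dyadic u_def del: po_rec)
  qed
  have x_ze: "rv x ze = val n + 1/2"
    using rv_x[of ze] A_ze by (simp add: u_def field_simps)
  define \<gamma> where "\<gamma> m = (if G m then 1 else 0 :: 'q)" for m
  have \<gamma>: "val (g $ m) = \<gamma> m" if "m \<in> N" for m using g_ap[OF that] by (simp add: \<gamma>_def)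
  have \<gamma>_bounds: "0 \<le> \<gamma> m" "\<gamma> m \<le> 1" for m by (simp_all add: \<gamma>_def)
  have x_su: "rv x (su j) = rv x j + \<gamma> j * (u j / 4)" if "j \<in> N" for j
    using rv_x[OF that] rv_x[of "su j"] A_su[OF that] \<gamma>[OF that] u_su[OF that] that
    by (simp add: algebra_simps)
  \<comment> \<open>The remainder is carried along to make the bound inductive: one step costs at
    most u/4 + u/8 \<le> u/2. The sharp bound would be u/3, but u/2 is a power of two and so
    expressible by \<open>pow2Q\<close>.\<close>
  have mono: "rv x j \<le> rv x (pl j i) \<and> rv x (pl j i) + u (pl j i) / 2 \<le> rv x j + u j / 2"
    if j: "j \<in> N" and i: "i \<in> N" for i j
  proof (rule arith_induct[where e = "env0((0, T1) := x, (1, T0) := j)" and x = 0 and n = i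
      and P = "\<lambda>i. rv x j \<le> rv x (pl j i) \<and> rv x (pl j i) + u (pl j i) / 2 \<le> rv x j + u j / 2"
      and \<phi> = "Con (leQ (Var 0 T1 \<cdot> nv 1) (Var 0 T1 \<cdot> (nv 1 \<oplus> nv 0)) 2)
        (leQ (addQ (Var 0 T1 \<cdot> (nv 1 \<oplus> nv 0)) (pow2Q (Succ \<cdot> (Succ \<cdot> (Succ \<cdot> ((nv 1 \<oplus> nv 0) \<oplus> (nv 1 \<oplus> nv 0)))))))
          (addQ (Var 0 T1 \<cdot> nv 1) (pow2Q (Succ \<cdot> (Succ \<cdot> (Succ \<cdot> (nv 1 \<oplus> nv 1)))))) 2)"])
    fix i assume i: "i \<in> N" and IH: "rv x j \<le> rv x (pl j i) \<and> rv x (pl j i) + u (pl j i) / 2 \<le> rv x j + u j / 2"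
    define t where "t = pl j i"
    have t: "t \<in> N" using i j by (simp add: t_def)
    have "0 \<le> \<gamma> t * (u t / 4)" "\<gamma> t * (u t / 4) \<le> u t / 4"
      using \<gamma>_bounds[of t] u_pos[OF t] by (simp_all add: \<gamma>_def)
    moreover have "pl j (su i) = su t" using i j by (simp add: t_def)
    ultimately show "rv x j \<le> rv x (pl j (su i)) \<and> rv x (pl j (su i)) + u (pl j (su i)) / 2 \<le> rv x j + u j / 2"
      using IH[folded t_def] x_su[OF t] u_su[OF t] u_pos[OF t] by (auto; linarith)
  qed (use x i j u_pos in \<open>auto simp: rv_def u_def\<close>)
  have between: "rv x j - hp t \<le> rv x t" "rv x t \<le> rv x j + u j / 2" if t: "t \<in> N" and j: "j \<in> N" for t j
  proof -
    have "rv x j - hp t \<le> rv x t \<and> rv x t \<le> rv x j + u j / 2"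
      using pl_total[OF t j]
    proof
      assume "pl j (mo t j) = t"
      then show ?thesis using mono[OF j, of "mo t j"] t j u_pos[OF t] u_pos[OF j] hp_pos[OF t] by (auto simp del: hp_pos)
    next
      assume "pl t (mo j t) = j"
      then show ?thesis using mono[OF t, of "mo j t"] t j u_pos[OF t] u_pos[OF j] hp_pos[OF t] u_hp[OF t]
        by (auto simp del: hp_pos)
    qed
    then show "rv x j - hp t \<le> rv x t" "rv x t \<le> rv x j + u j / 2" by auto
  qed
  have real: "Real x" unfolding Real_def
  proof (intro conjI ballI)
    fix j i assume "j \<in> N" "i \<in> N"
    then show "\<bar>rv x j - rv x (pl j i)\<bar> < hp j"
      using mono[of j i] u_hp[of j] hp_pos[of j] u_pos[of "pl j i"] by (simp add: abs_less_iff del: hp_pos)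
  qed (rule x)
  have above: "val n + 1/2 \<le> rv x j" if "j \<in> N" for j
    using mono[of ze j] that x_ze by simp
  have below_k: "val j \<le> val k \<longrightarrow> rv x j \<le> rv x ze" if j: "j \<in> N" for j
  proof (rule arith_induct[where e = "env0((0, T1) := x, (1, T0) := k)" and x = 0 and n = j
      and P = "\<lambda>j. val j \<le> val k \<longrightarrow> rv x j \<le> rv x ze"
      and \<phi> = "Imp (leN (nv 0) (nv 1) 2) (leQ (Var 0 T1 \<cdot> nv 0) (Var 0 T1 \<cdot> Zero) 2)"])
    fix j assume j: "j \<in> N" and IH: "val j \<le> val k \<longrightarrow> rv x j \<le> rv x ze"
    show "val (su j) \<le> val k \<longrightarrow> rv x (su j) \<le> rv x ze"
    proof
      assume "val (su j) \<le> val k"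
      then have "val j + 1 \<le> val k" using j by simp
      then have "\<gamma> j = 0" "val j \<le> val k" by (auto simp: \<gamma>_def G_def)
      then show "rv x (su j) \<le> rv x ze" using IH x_su[OF j] by simp
    qed
  qed (use x j k in \<open>auto simp: rv_def\<close>)
  \<comment> \<open>No digit before place k contributes and the rest adds at most
    \<open>hp k\<close> / 8. With m = k + 2 the error 2 * \<open>hp m\<close> is \<open>hp k\<close>
    / 2, and 1/8 + 1/2 < 1.\<close>
  have ball: "\<bar>val n + 1/2 - rv x (su m)\<bar> + 2 * hp m < hp k" if "m = su (su k)" for m
  proof -
    have m: "m \<in> N" "hp m = hp k / 4" using k that by simp_all
    then have "rv x (su m) \<le> val n + 1/2 + hp k / 8"
      using between(2)[of "su m" k] below_k[OF k] u_hp[OF k] k x_ze by simp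
    then show ?thesis using above[of "su m"] m hp_pos[OF k] by (simp add: abs_if del: hp_pos)
  qed
  have "Gt (val n) x"
  proof (rule Gt_intro[of "1/2"])
    fix j assume j: "j \<in> N"
    show "val n + 1/2 - 3 * hp j \<le> rv x j" using above[OF j] hp_pos[OF j] by linarith
  qed simp
  moreover have "Lt x (val n + 1)"
  proof (rule Lt_intro[of "1/4"])
    fix j assume j: "j \<in> N"
    have "u ze = 1/4" by (simp add: u_def)
    then show "rv x j \<le> val n + 1 - 1/4 + 3 * hp j"
      using between(2)[OF j, of ze] x_ze hp_pos[OF j] by (simp del: hp_pos)
  qed simp
  moreover have digits: "Digit x m = G m" if m: "m \<in> N" for m
  proof -
    define h where "h = u (su m)"
    have h: "h = hp (pl m m) / 16" "0 < h" using m by (simp_all add: h_def u_def)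
    have "(8 * val p + 1) * (hp (pl m m) / 32) = (4 * val p + 1/2) * h" for p
      by (simp add: h field_simps)
    then have Digit: "Digit x m = (\<exists>p\<in>N. Gt ((4 * val p + 1/2) * h) x \<and> Lt x ((4 * val p + 2) * h))"
      unfolding Digit_def h(1)[symmetric] by simp
    have xm: "rv x (su m) = (4 * val (A m) + \<gamma> m) * h"
      using rv_x[of "su m"] A_su[OF m] \<gamma>[OF m] m by (simp add: h_def)
    \<comment> \<open>All places after m together add at most h/2, so x/h lies between 4A + \<gamma>
      and 4A + \<gamma> + 1/2. For digit 1 this is at distance at least 1/2 from both thresholds 4A
      + 1/2 and 4A + 2.\<close>
    have bt: "(4 * val (A m) + \<gamma> m) * h - hp t \<le> rv x t" "rv x t \<le> (4 * val (A m) + \<gamma> m) * h + h / 2" if "t \<in> N" for t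
      using between[OF that su_dom[OF m]] xm by (simp_all add: h_def)
    show ?thesis
    proof
      assume "G m"
      then have \<gamma>1: "\<gamma> m = 1" by (simp add: \<gamma>_def)
      have "Gt ((4 * val (A m) + 1/2) * h) x"
      proof (rule Gt_intro[of "h / 2"])
        fix t assume t: "t \<in> N"
        have "(4 * val (A m) + 1/2) * h + h / 2 = (4 * val (A m) + \<gamma> m) * h" by (simp add: \<gamma>1 algebra_simps)
        then show "(4 * val (A m) + 1/2) * h + h / 2 - 3 * hp t \<le> rv x t"
          using bt(1)[OF t] hp_pos[OF t] by linarith
      qed (use h in simp)
      moreover have "Lt x ((4 * val (A m) + 2) * h)"
      proof (rule Lt_intro[of "h / 2"])
        fix t assume t: "t \<in> N"
        have "(4 * val (A m) + 2) * h - h / 2 = (4 * val (A m) + \<gamma> m) * h + h / 2" by (simp add: \<gamma>1 algebra_simps)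
        then show "rv x t \<le> (4 * val (A m) + 2) * h - h / 2 + 3 * hp t"
          using bt(2)[OF t] hp_pos[OF t] by linarith
      qed (use h in simp)
      ultimately show "Digit x m" unfolding Digit using A_dom m by blast
    next
      assume "Digit x m"
      then obtain p where p: "p \<in> N" "Gt ((4 * val p + 1/2) * h) x" "Lt x ((4 * val p + 2) * h)"
        unfolding Digit by blast
      show "G m"
      proof (rule ccontr)
        \<comment> \<open>For digit 0, x/h lies between 4A and 4A + 1/2. Exceeding 4p + 1/2 forces p
          < A, while staying below 4p + 2 forces 4A < 4p + 2, which is impossible by
          discreteness.\<close>
        assume "\<not> G m"
        then have \<gamma>0: "\<gamma> m = 0" by (simp add: \<gamma>_def)
        obtain t where t: "t \<in> N" "(4 * val p + 1/2) * h + 2 * hp t < rv x t" using p(2) unfolding Gt_def by blast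
        have "(4 * val p) * h < (4 * val (A m)) * h"
          using t bt(2)[OF t(1)] hp_pos[OF t(1)] by (simp add: \<gamma>0 algebra_simps del: hp_pos)
        then have "val p < val (A m)" using h(2) by simp
        then have pA: "val p + 1 \<le> val (A m)" using val_less[of p "A m"] p(1) A_dom m by simp
        obtain t where t: "t \<in> N" "rv x t + 2 * hp t < (4 * val p + 2) * h" using p(3) unfolding Lt_def by blast
        have "(4 * val (A m)) * h < (4 * val p + 2) * h"
          using t bt(1)[OF t(1)] hp_pos[OF t(1)] by (simp add: \<gamma>0 del: hp_pos)
        then have "4 * val (A m) < 4 * val p + 2" using h(2) by simp
        then show False using pA by simp
      qed
    qed
  qed
  moreover have "Decodes x i j \<longleftrightarrow> f $ i = j" if ij: "i \<in> N" "j \<in> N" for i j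
  proof -
    \<comment> \<open>A pair is at least its second component, so for l at least k the place is
      beyond the initial segment on which all digits are 0.\<close>
    have "val l \<le> val (pr (pr i j) l)" if "l \<in> N" for l
      using that ij by (simp add: pr_eq[of "pr i j" l])
    then have "G (pr (pr i j) l) \<longleftrightarrow> f $ i = j" if "l \<in> N" "val k \<le> val l" for l
      unfolding G_def using that ij by (auto intro: order_trans)
    moreover have "G (pr (pr i j) l) \<Longrightarrow> f $ i = j" if "l \<in> N" for l
      unfolding G_def using that ij by simp
    ultimately show ?thesis unfolding Decodes_def using digits ij k
      by (metis arith_dom(10) order_refl)
  qed
  moreover have "\<exists>m\<in>N. \<bar>val n + 1/2 - rv x (su m)\<bar> + 2 * hp m < hp k"
    using ball[OF refl] k by (intro bexI[of _ "su (su k)"]) auto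
  ultimately show ?thesis using real by blast
qed

section \<open>From interiors to BOOT\<close>

lemma interior_imp_boot:
  assumes int: "InteriorP False" shows "sat BOOT e"
  unfolding sat_principles
proof
  fix Y assume Y: "Y \<in> dom (T1 \<leadsto> T0 \<leadsto> T0)"
  obtain dec where dec: "dec \<in> dom (T1 \<leadsto> T1)"
    "\<And>x y. \<lbrakk>Real x; Real y; EqR x y\<rbrakk> \<Longrightarrow> dec $ x = dec $ y"
    "\<And>x f. x \<in> dom T1 \<Longrightarrow> f \<in> dom T1 \<Longrightarrow> \<forall>i\<in>N. \<forall>j\<in>N. Decodes x i j = (f $ i = j) \<Longrightarrow> dec $ x = f"
    using decoder_exists by blast
  have Y_ap [simp]: "Y $ f $ n \<in> N" if "f \<in> dom T1" "n \<in> N" for f n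
    using Y that ap_dom by blast
  \<comment> \<open>One set treats all n at once: the intervals (n, n + 1) are disjoint, and outside
    them the condition holds vacuously.\<close>
  define P where "P x = (\<forall>n\<in>N. Gt (val n) x \<longrightarrow> Lt x (val n + 1) \<longrightarrow> Y $ (dec $ x) $ n \<noteq> ze)" for x
  have "\<exists>X. IsSet X \<and> (\<forall>x. Real x \<longrightarrow> InSet x X = P x)"
  proof (rule set_comprehension)
    let ?\<phi> = "(\<^bold>\<forall>n:T0. (realQ (rat n Zero One) <\<^sub>R Var 0 T1) \<^bold>\<longrightarrow> (Var 0 T1 <\<^sub>R realQ (rat (Succ \<cdot> n) Zero One)) \<^bold>\<longrightarrow>
      (\<^bold>\<not> (Var 1 (T1 \<leadsto> T0 \<leadsto> T0) \<cdot> (Var 0 (T1 \<leadsto> T1) \<cdot> Var 0 T1) \<cdot> n \<^bold>= Zero))) 2"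
    let ?e = "env0((1, T1 \<leadsto> T0 \<leadsto> T0) := Y, (0, T1 \<leadsto> T1) := dec)"
    show "arith ?\<phi>" "wff ?\<phi>" "std_env ?e" using Y dec by simp_all
    show "P x \<longleftrightarrow> sat ?\<phi> (?e((0, T1) := x))" if "Real x" for x
      unfolding P_def using that Y dec by (simp add: qv_qcode val_one cong: ball_cong)
    show "P x = P y" if "Real x" "Real y" "EqR x y" for x y
      unfolding P_def using dec(2)[OF that] Gt_EqR Lt_EqR EqR_sym that by metis
  qed
  then obtain X where X: "IsSet X" "\<And>x. Real x \<Longrightarrow> InSet x X = P x"
    by blast
  obtain U where U: "Interior U X" "U \<in> dom (T1 \<leadsto> T1)"
    using int X IsSet_dom unfolding InteriorP_def Interior_def by blast
  \<comment> \<open>The midpoint n + 1/2 as the constant sequence (2n + 1)/2; its distance 1/2 from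
    both integers gives the margins for \<open>Gt_intro\<close> and \<open>Lt_intro\<close>.\<close>
  define z where "z n = ev (env0((0, T0) := n)) (realQ (rat (Succ \<cdot> (nv 0 \<oplus> nv 0)) Zero Two))" for n
  have z: "rv (z n) m = val n + 1/2" "Real (z n)" if "n \<in> N" "m \<in> N" for n m
  proof -
    have *: "rv (z n) m = val n + 1/2" if "m \<in> N" for m
      unfolding z_def using that \<open>n \<in> N\<close> by (simp add: qv_qcode val_one field_simps)
    then show "rv (z n) m = val n + 1/2" using that by blast
    have "z n \<in> dom T1" unfolding z_def using that by simp
    then show "Real (z n)" unfolding Real_def using * that by simp
  qed
  have key: "InSet (z n) U = (\<forall>f\<in>dom T1. Y $ f $ n \<noteq> ze)" if n: "n \<in> N" for n
  proof -
    have "InSet (z n) U = InInt (z n) X"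
      using U(1) z(2)[OF n ze_dom] unfolding Interior_def by blast
    also have "\<dots> \<longleftrightarrow> (\<forall>f\<in>dom T1. Y $ f $ n \<noteq> ze)"
    proof
      assume "InInt (z n) X"
      then obtain k where k: "k \<in> N" "\<forall>y. Real y \<longrightarrow> InBall y (z n) k \<longrightarrow> InSet y X"
        unfolding InInt_def by blast
      show "\<forall>f\<in>dom T1. Y $ f $ n \<noteq> ze"
      proof
        fix f assume f: "f \<in> dom T1"
        obtain x m where x: "Real x" "Gt (val n) x" "Lt x (val n + 1)"
          and m: "m \<in> N" "\<bar>val n + 1/2 - rv x (su m)\<bar> + 2 * hp m < hp k"
          and d: "\<forall>i\<in>N. \<forall>j\<in>N. Decodes x i j = (f $ i = j)"
          using encoding_exists[OF f n k(1)] by blast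
        have "InBall x (z n) k" unfolding InBall_def using m z(1)[OF n su_dom[OF m(1)]]
          by (intro bexI[of _ m]) auto
        then have "P x" using k(2) x X(2) by blast
        then have "Y $ (dec $ x) $ n \<noteq> ze" unfolding P_def using x n by blast
        then show "Y $ f $ n \<noteq> ze" using dec(3)[OF Real_dom[OF x(1)] f d] by simp
      qed
    next
      assume none: "\<forall>f\<in>dom T1. Y $ f $ n \<noteq> ze"
      have P: "P y" if y: "Real y" "Gt (val n) y" "Lt y (val n + 1)" for y
        unfolding P_def
      proof (intro ballI impI)
        fix n' assume n': "n' \<in> N" "Gt (val n') y" "Lt y (val n' + 1)"
        \<comment> \<open>Two unit intervals with integer endpoints that share the point y coincide,
          again by discreteness of the order.\<close>
        have "val n < val n' + 1" "val n' < val n + 1" using Gt_Lt_less y n' by blast+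
        then have "\<not> val n < val n'" "\<not> val n' < val n"
          using val_less[of n n'] val_less[of n' n] n n' by auto
        then have "n' = n" using val_inj n n' by (metis linorder_less_linear)
        then show "Y $ (dec $ y) $ n' \<noteq> ze" using none dec(1) y(1) by simp
      qed
      have gt: "Gt (val n) (z n)" "Lt (z n) (val n + 1)"
        using Gt_intro[of "1/2" "val n" "z n"] Lt_intro[of "1/2" "z n" "val n + 1"] z(1)[OF n] less_imp_le[OF hp_pos] by auto
      then have "InSet (z n) X" using P z[OF n ze_dom] X(2) by blast
      moreover have "\<exists>k\<in>N. \<forall>y. Real y \<longrightarrow> InBall y (z n) k \<longrightarrow> InSet y X"
        using ball_in_interval[OF z(2)[OF n ze_dom] gt] P X(2) by blast
      ultimately show "InInt (z n) X" unfolding InInt_def by blast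
    qed
    finally show ?thesis .
  qed
  let ?\<phi> = "inSet (realQ (rat (Succ \<cdot> (nv 0 \<oplus> nv 0)) Zero Two)) (Var 0 (T1 \<leadsto> T1)) 1"
  let ?e = "env0((0, T1 \<leadsto> T1) := U)"
  \<comment> \<open>The characteristic term is 0 when the midpoint is in U, that is when no f
    satisfies Y(f, n) = 0. Keeping 0 in that case and 1 otherwise is the encoding that BOOT asks
    for.\<close>
  define B where "B = ev ?e (lam 0 T0 (CaseC \<cdot> charterm ?\<phi> \<cdot> Zero \<cdot> One))"
  have B: "B \<in> dom T1" unfolding B_def using U by (intro ev_lam_dom) simp_all
  have B_ap: "B $ n = (if InSet (z n) U then ze else su ze)" if n: "n \<in> N" for n
  proof -
    let ?e' = "?e((0, T0) := n)"
    have e: "std_env ?e'" using n U by simp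
    have "ev ?e' (charterm ?\<phi>) \<in> N" using e by (intro ev_domI) auto
    moreover have "ev ?e' (realQ (rat (Succ \<cdot> (nv 0 \<oplus> nv 0)) Zero Two)) = z n"
      unfolding z_def realQ_def by simp
    then have "ev ?e' (charterm ?\<phi>) = ze \<longleftrightarrow> InSet (z n) U"
      using charterm[OF _ _ e, of ?\<phi>] n U z(2)[OF n ze_dom] by simp
    ultimately show ?thesis unfolding B_def using n U by simp
  qed
  show "\<exists>B\<in>dom T1. (\<forall>n\<in>N. B $ n = ze \<or> B $ n = su ze) \<and>
      (\<forall>n\<in>N. B $ n = su ze \<longleftrightarrow> (\<exists>f\<in>dom T1. Y $ f $ n = ze))"
    using B B_ap key by (intro bexI[of _ B]) auto
qed

text \<open>Coded interiors give plain interiors, these give BOOT, and BOOT gives coded interiors;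
  each closure principle is matched with its interior principle by complements.\<close>

lemma principles_equivalent:
  assumes "\<phi> \<in> principles" "\<psi> \<in> principles" shows "sat (Iff \<phi> \<psi>) e"
proof -
  have coded: "InteriorP True \<Longrightarrow> InteriorP False" unfolding InteriorP_def by blast
  have boot: "sat BOOT e = InteriorP True"
    using boot_imp_interior_code[of e] interior_imp_boot[of e] coded by blast
  have int: "InteriorP False = InteriorP True"
    using boot_imp_interior_code[of e] interior_imp_boot[of e] coded by blast
  have cl: "ClosureP coded = InteriorP coded" for coded
    using interior_imp_closure[of coded] closure_imp_interior[of coded] by blast
  have "\<forall>\<chi>\<in>principles. sat \<chi> e = InteriorP True"
    by (simp add: principles_def sat_principles(2-) boot cl int)
  then show ?thesis using assms by simp
qed

end

section \<open>The principles are sentences, and the conclusion\<close>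

lemma fv_macros [simp]:
  "fv ((s \<^bold>= t) d) \<subseteq> V \<longleftrightarrow> fvt s \<subseteq> V \<and> fvt t \<subseteq> V"
  "fv ((\<^bold>\<not> P) d) \<subseteq> V \<longleftrightarrow> fv (P d) \<subseteq> V"
  "fv ((P \<^bold>\<and> Q) d) \<subseteq> V \<longleftrightarrow> fv (P d) \<subseteq> V \<and> fv (Q d) \<subseteq> V"
  "fv ((P \<^bold>\<or> Q) d) \<subseteq> V \<longleftrightarrow> fv (P d) \<subseteq> V \<and> fv (Q d) \<subseteq> V"
  "fv ((P \<^bold>\<longrightarrow> Q) d) \<subseteq> V \<longleftrightarrow> fv (P d) \<subseteq> V \<and> fv (Q d) \<subseteq> V"
  "fv ((P \<^bold>\<longleftrightarrow> Q) d) \<subseteq> V \<longleftrightarrow> fv (P d) \<subseteq> V \<and> fv (Q d) \<subseteq> V"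
  "fv (lAll \<tau> F d) \<subseteq> V \<longleftrightarrow> fv (F (Var d \<tau>) (Suc d)) \<subseteq> insert (d, \<tau>) V"
  "fv (lEx \<tau> F d) \<subseteq> V \<longleftrightarrow> fv (F (Var d \<tau>) (Suc d)) \<subseteq> insert (d, \<tau>) V"
  by (auto simp: macro_defs)

lemma wff_more_macros [simp]:
  "wff ((P \<^bold>\<or> Q) d) \<longleftrightarrow> wff (P d) \<and> wff (Q d)" "wff ((P \<^bold>\<longleftrightarrow> Q) d) \<longleftrightarrow> wff (P d) \<and> wff (Q d)"
  by (auto simp: macro_defs)

lemmas rational_defs = absQ_def subQ_def addQ_def pow2Q_def dpow2Q_def zeroQ_def realQ_def rat_def
  pos_def neg_def den_def

lemma fv_ltQ [simp]:
  "fvt p \<subseteq> V \<Longrightarrow> fvt q \<subseteq> V \<Longrightarrow> fv (ltQ p q d) \<subseteq> V"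
  "fvt p \<subseteq> V \<Longrightarrow> fvt q \<subseteq> V \<Longrightarrow> fv (leQ p q d) \<subseteq> V"
  by (simp_all add: ltQ_def leQ_def ltN_def leN_def rational_defs)

lemma fvt_rational [simp]:
  "fvt (absQ p) = fvt p" "fvt (subQ p q) = fvt p \<union> fvt q" "fvt (addQ p q) = fvt p \<union> fvt q"
  "fvt (pow2Q p) = fvt p" "fvt (dpow2Q p) = fvt p" "fvt zeroQ = {}" "fvt (realQ p) = fvt p"
  by (auto simp: rational_defs)

lemma fv_reals [simp]:
  "fvt x \<subseteq> V \<Longrightarrow> fv (isReal x d) \<subseteq> V"
  "fvt x \<subseteq> V \<Longrightarrow> fvt y \<subseteq> V \<Longrightarrow> fv ((x =\<^sub>R y) d) \<subseteq> V"
  "fvt x \<subseteq> V \<Longrightarrow> fvt y \<subseteq> V \<Longrightarrow> fv ((x <\<^sub>R y) d) \<subseteq> V"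
  by (simp_all add: isReal_def eqR_def ltR_def subset_insertI2)

lemma sentence_principles: "\<phi> \<in> principles \<Longrightarrow> sentence \<phi>"
proof -
  note defs = BOOT_def INTERIOR_def INTERIOR_CODE_def CLOSURE_def CLOSURE_CODE_def AllSet_def
    ExSet_def AllR_def ExR_def isSet_def inSet_def limitPoint_def inClosure_def inInterior_def
    isClosureOf_def isInteriorOf_def inCode_def hasOpenCode_def hasClosedCode_def inBall_def
  \<comment> \<open>The arbitrary bound \<open>V\<close> lets the simplifier pass under quantifiers,
    each of which adds its variable to the bound; the empty set is inserted only afterwards.\<close>
  have "fv BOOT \<subseteq> V" "fv INTERIOR \<subseteq> V" "fv INTERIOR_CODE \<subseteq> V" "fv CLOSURE \<subseteq> V"
    "fv CLOSURE_CODE \<subseteq> V" for V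
    by (simp_all add: defs fvt_DistC)
  note fv = this[of "{}"]
  have wff: "wff BOOT" "wff INTERIOR" "wff INTERIOR_CODE" "wff CLOSURE" "wff CLOSURE_CODE"
    by (simp_all add: defs eqR_def)
  show "\<phi> \<in> principles \<Longrightarrow> sentence \<phi>"
    using fv wff by (auto simp: principles_def sentence_def)
qed

theorem theorem2p6:
  shows "\<forall>\<phi> \<in> {BOOT, INTERIOR, INTERIOR_CODE, CLOSURE, CLOSURE_CODE}.
         \<forall>\<psi> \<in> {BOOT, INTERIOR, INTERIOR_CODE, CLOSURE, CLOSURE_CODE}.
           ACA0w \<turnstile> Iff \<phi> \<psi>"
proof (rule ccontr)
  assume "\<not> ?thesis"
  then obtain \<phi> \<psi> where *: "\<phi> \<in> principles" "\<psi> \<in> principles" "\<not> (ACA0w \<turnstile> Iff \<phi> \<psi>)"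
    unfolding principles_def by blast
  have sent: "sentence (Iff \<phi> \<psi>)" if "\<phi> \<in> principles" "\<psi> \<in> principles" for \<phi> \<psi>
    using that sentence_principles by (simp add: Iff_def Con_def)
  obtain \<Gamma> where "henkin_set \<Gamma>" "ACA0w \<subseteq> \<Gamma>" "Iff \<phi> \<psi> \<notin> \<Gamma>"
    using ACA0w.henkin_set_exists[OF sent[OF *(1,2)] *(3)] by blast
  then have "aca_set \<Gamma>" by (simp add: aca_set_def aca_set_axioms_def)
  from refuting_valued_model[OF this *(1,2) \<open>Iff \<phi> \<psi> \<notin> \<Gamma>\<close>]
  obtain \<Gamma> \<phi> \<psi> and val :: "tm set \<Rightarrow> diff fract" where r: "aca_set \<Gamma>" "\<phi> \<in> principles" "\<psi> \<in> principles" "Iff \<phi> \<psi> \<notin> \<Gamma>"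
    "valued_model (aca_set.cdom \<Gamma>) (aca_set.cap \<Gamma>) (aca_set.cl \<Gamma>) val"
    by blast
  interpret aca_set \<Gamma> by fact
  have "sat (Iff \<phi> \<psi>) default_env"
    using valued_model.principles_equivalent[OF r(5,2,3)] .
  then show False using truth[OF sent[OF r(2,3)]] r(4) by blast
qed

end
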